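(* Let $d\ge2$ and let $\xi,\xi_1,\xi_2,\ldots$ be i.i.d. random variables in $\mathbb{R}^d$ with $\mathbb{E}[\|\xi\|^2]<\infty$ and $\mathbb{E}\xi=\mu\neq0$. Let $S_0:=0$ and $S_n:=\sum_{i=1}^n\xi_i$. Then, as $n\to\infty$, in the sense of weak convergence of random elements of $(\mathfrak{C}_0^d,\rho_H)$, $$\psi_{n,\mu}(\operatorname{hull}\{S_0,S_1,\ldots,S_n\})\Rightarrow\tilde h_d^{\Sigma}.$$
   Context: Let $\{u_1,\ldots,u_d\}$ be an orthonormal basis of $\mathbb{R}^d$ with $u_1=\mu/\|\mu\|$. For $n\in\mathbb{N}$ define $\psi_{n,\mu}:\mathbb{R}^d\to\mathbb{R}^d$ by $$\psi_{n,\mu}(x)=\Big(\frac{x\cdot u_1}{n\|\mu\|},\frac{x\cdot u_2}{\sqrt n},\ldots,\frac{x\cdot u_d}{\sqrt n}\Big),$$ and $\psi_{n,\mu}(A):=\{\psi_{n,\mu}(x):x\in A\}$ for $A\subseteq\mathbb{R}^d$. Let $\xi'_\perp:=(\xi\cdot u_2,\ldots,\xi\cdot u_d)^{\top}$ and let $\Sigma_{\mu_\perp}:=\mathbb{E}[\xi'_\perp(\xi'_\perp)^{\top}]$, a $(d-1)\times(d-1)$ nonnegative-definite matrix with nonnegative-definite symmetric square root $\Sigma_{\mu_\perp}^{1/2}$. Let $\tilde\Sigma_{\mu_\perp}^{1/2}$ be the $d\times d$ block-diagonal matrix with blocks $1$ and $\Sigma_{\mu_\perp}^{1/2}$ (in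 this order). Let $\tilde b_d(t):=(t,b_{d-1}(t))$ for $t\in[0,1]$, where $b_{d-1}$ is standard $(d-1)$-dimensional Brownian motion started at $0$ with continuous paths, and $\tilde h_d^{\Sigma}:=\operatorname{hull}\{\tilde\Sigma_{\mu_\perp}^{1/2}\tilde b_d(t):t\in[0,1]\}$. Here $\operatorname{hull}$ is the convex hull, $\mathfrak{C}_0^d$ is the set of convex compact subsets of $\mathbb{R}^d$ containing $0$, and $\rho_H(A,B):=\max\{\sup_{x\in A}\inf_{y\in B}\|x-y\|,\ \sup_{y\in B}\inf_{x\in A}\|x-y\|\}$ is the Hausdorff distance. Weak convergence $X_n\Rightarrow X$ in a metric space means $\mathbb{E}f(X_n)\to\mathbb{E}f(X)$ for all bounded continuous real-valued $f$. *)

theory Defs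
  imports "HOL-Probability.Probability"
begin

section \<open>The space of convex compact sets containing the origin\<close>

text \<open>The formula is the usual one on nonempty bounded sets. It is set to \<open>0\<close> elsewhere because
  the real \<open>SUP\<close> and \<open>INF\<close> are unspecified there, while the locale \<^locale>\<open>Metric_space\<close>
  asks for nonnegativity of the distance function even off the carrier.\<close>

definition hausdorff_dist :: "'a::real_normed_vector set \<Rightarrow> 'a set \<Rightarrow> real" where
  "hausdorff_dist A B =
     (if A \<noteq> {} \<and> B \<noteq> {} \<and> bounded A \<and> bounded B
      then max (SUP x\<in>A. INF y\<in>B. norm (x - y)) (SUP y\<in>B. INF x\<in>A. norm (x - y))
      else 0)"

definition convex_compacts0 :: "'a::real_normed_vector set set" where
  "convex_compacts0 = {A. convex A \<and> compact A \<and> 0 \<in> A}"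

abbreviation hausdorff_topology0 :: "'a::real_normed_vector set topology" where
  "hausdorff_topology0 \<equiv> Metric_space.mtopology convex_compacts0 hausdorff_dist"

lemma hausdorff_dist_infdist:
  assumes "A \<noteq> {}" "B \<noteq> {}" "bounded A" "bounded B"
  shows "hausdorff_dist A B = max (SUP x\<in>A. infdist x B) (SUP y\<in>B. infdist y A)"
  using assms by (simp add: hausdorff_dist_def infdist_def dist_norm norm_minus_commute)

lemma bdd_above_infdist:
  assumes "A \<noteq> {}" "B \<noteq> {}" "bounded A" "bounded B"
  shows "bdd_above ((\<lambda>x. infdist x B) ` A)"
proof -
  obtain b where b: "b \<in> B" using assms by blast
  obtain e where e: "\<And>x. x \<in> A \<Longrightarrow> dist b x \<le> e"
    using assms(3) bounded_any_center by blast
  show ?thesis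
    by (rule bdd_aboveI2[where M=e]) (metis b e dist_commute infdist_le order_trans)
qed

lemma hausdorff_dist_le_iff:
  assumes "A \<noteq> {}" "B \<noteq> {}" "bounded A" "bounded B"
  shows "hausdorff_dist A B \<le> r \<longleftrightarrow>
    (\<forall>x\<in>A. infdist x B \<le> r) \<and> (\<forall>y\<in>B. infdist y A \<le> r)"
  using assms
  by (simp add: hausdorff_dist_infdist cSUP_le_iff bdd_above_infdist)

lemma infdist_triangle_sets:
  assumes "B \<noteq> {}" "C \<noteq> {}" "\<forall>y\<in>B. infdist y C \<le> r"
  shows "infdist x C \<le> infdist x B + r"
proof -
  have "infdist x C - r \<le> dist x y" if "y \<in> B" for y
  proof -
    have "infdist y C \<le> r" using assms(3) that by blast
    then show ?thesis using infdist_triangle[of x C y] by linarith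
  qed
  then have "infdist x C - r \<le> infdist x B"
    unfolding infdist_notempty[OF assms(1)] by (intro cINF_greatest[OF assms(1)])
  then show ?thesis by simp
qed

lemma Metric_space_convex_compacts0:
  "Metric_space (convex_compacts0 :: 'a::real_normed_vector set set) hausdorff_dist"
proof
  fix A B C :: "'a set"
  show "0 \<le> hausdorff_dist A B"
  proof (cases "A \<noteq> {} \<and> B \<noteq> {} \<and> bounded A \<and> bounded B")
    case True
    then obtain a where "a \<in> A" by blast
    then have "infdist a B \<le> hausdorff_dist A B"
      using hausdorff_dist_le_iff[of A B "hausdorff_dist A B"] True by blast
    then show ?thesis using infdist_nonneg[of a B] by linarith
  qed (auto simp: hausdorff_dist_def)
  show "hausdorff_dist A B = hausdorff_dist B A"
    by (auto simp: hausdorff_dist_def norm_minus_commute max.commute)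
  have ok: "X \<noteq> {} \<and> bounded X \<and> closed X" if "X \<in> convex_compacts0" for X :: "'a set"
    using that by (auto simp: convex_compacts0_def compact_imp_bounded compact_imp_closed)
  assume A: "A \<in> convex_compacts0" and B: "B \<in> convex_compacts0"
  show "hausdorff_dist A B = 0 \<longleftrightarrow> A = B"
  proof
    assume "hausdorff_dist A B = 0"
    then have "\<forall>x\<in>A. infdist x B \<le> 0" "\<forall>y\<in>B. infdist y A \<le> 0"
      using hausdorff_dist_le_iff[of A B 0] ok[OF A] ok[OF B] by auto
    then have "\<forall>x\<in>A. infdist x B = 0" "\<forall>y\<in>B. infdist y A = 0"
      by (meson antisym infdist_nonneg)+
    then show "A = B"
      using in_closed_iff_infdist_zero ok[OF A] ok[OF B] by blast
  next
    assume "A = B"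
    then show "hausdorff_dist A B = 0"
      using hausdorff_dist_infdist[of A A] ok[OF A] by simp
  qed
  assume C: "C \<in> convex_compacts0"
  have AB: "\<forall>x\<in>A. infdist x B \<le> hausdorff_dist A B" "\<forall>y\<in>B. infdist y A \<le> hausdorff_dist A B"
    using hausdorff_dist_le_iff[of A B "hausdorff_dist A B"] ok A B by blast+
  have BC: "\<forall>x\<in>B. infdist x C \<le> hausdorff_dist B C" "\<forall>y\<in>C. infdist y B \<le> hausdorff_dist B C"
    using hausdorff_dist_le_iff[of B C "hausdorff_dist B C"] ok B C by blast+
  have "\<forall>x\<in>A. infdist x C \<le> hausdorff_dist A B + hausdorff_dist B C"
  proof
    fix x assume "x \<in> A"
    moreover have "infdist x C \<le> infdist x B + hausdorff_dist B C"
      using ok[OF B] ok[OF C] BC(1) by (intro infdist_triangle_sets) auto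
    ultimately show "infdist x C \<le> hausdorff_dist A B + hausdorff_dist B C"
      using AB(1) by (meson add_right_mono order_trans)
  qed
  moreover have "\<forall>z\<in>C. infdist z A \<le> hausdorff_dist A B + hausdorff_dist B C"
  proof
    fix z assume "z \<in> C"
    then have "infdist z B \<le> hausdorff_dist B C" using BC(2) by blast
    moreover have "infdist z A \<le> infdist z B + hausdorff_dist A B"
      using ok[OF B] ok[OF A] AB(2) by (intro infdist_triangle_sets) auto
    ultimately show "infdist z A \<le> hausdorff_dist A B + hausdorff_dist B C" by linarith
  qed
  ultimately show "hausdorff_dist A C \<le> hausdorff_dist A B + hausdorff_dist B C"
    using hausdorff_dist_le_iff[of A C] ok A C by blast
qed

section \<open>Weak convergence of random elements\<close>

definition borel_of :: "'a topology \<Rightarrow> 'a measure" where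
  "borel_of T = sigma (topspace T) {U. openin T U}"

text \<open>The measurability clauses say that \<open>X n\<close> and \<open>Y\<close> are random elements of the space; without
  them the Bochner integrals below could be the default value \<open>0\<close>.\<close>

definition weakly_converges ::
  "'e topology \<Rightarrow> 'a measure \<Rightarrow> (nat \<Rightarrow> 'a \<Rightarrow> 'e) \<Rightarrow> 'b measure \<Rightarrow> ('b \<Rightarrow> 'e) \<Rightarrow> bool" where
  "weakly_converges T M X N Y \<longleftrightarrow>
     (\<forall>n. X n \<in> M \<rightarrow>\<^sub>M borel_of T) \<and> Y \<in> N \<rightarrow>\<^sub>M borel_of T \<and>
     (\<forall>f. continuous_map T euclideanreal f \<and> bounded (f ` topspace T) \<longrightarrow>
        (\<lambda>n. \<integral>\<omega>. f (X n \<omega>) \<partial>M) \<longlonglongrightarrow> (\<integral>\<omega>. f (Y \<omega>) \<partial>N))"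

section \<open>Coordinates, scaling and covariance\<close>

text \<open>With \<open>d = CARD('m) + 1\<close>, the space of dimension \<open>d\<close> is \<^typ>\<open>real ^ 'm option\<close>: the index
  \<open>None\<close> is the first coordinate and the indices \<open>Some j\<close> are the remaining \<open>d - 1\<close> ones. Since
  \<open>'m\<close> is nonempty and otherwise arbitrary, \<open>d\<close> ranges over all integers \<open>\<ge> 2\<close>.\<close>

definition vec_cons :: "real \<Rightarrow> real ^ 'm \<Rightarrow> real ^ ('m option)" where
  "vec_cons a v = (\<chi> k. case k of None \<Rightarrow> a | Some j \<Rightarrow> v $ j)"

definition block_diag1 :: "real ^ 'm ^ 'm \<Rightarrow> real ^ ('m option) ^ ('m option)" where
  "block_diag1 A = (\<chi> i k. case (i, k) of
      (None, None) \<Rightarrow> 1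
    | (Some a, Some b) \<Rightarrow> A $ a $ b
    | _ \<Rightarrow> 0)"

definition orthonormal_basis :: "('i::finite \<Rightarrow> real ^ 'i) \<Rightarrow> bool" where
  "orthonormal_basis u \<longleftrightarrow>
     (\<forall>i k. u i \<bullet> u k = (if i = k then 1 else 0)) \<and> span (range u) = UNIV"

text \<open>For \<open>n = 0\<close> division by zero makes this the zero map, which is irrelevant in the limit.\<close>

definition scaling :: "('m option \<Rightarrow> real ^ ('m::finite option)) \<Rightarrow> real ^ ('m option) \<Rightarrow>
    nat \<Rightarrow> real ^ ('m option) \<Rightarrow> real ^ ('m option)" where
  "scaling u \<mu> n x =
     vec_cons ((x \<bullet> u None) / (real n * norm \<mu>)) (\<chi> j. (x \<bullet> u (Some j)) / sqrt (real n))"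

definition perp_part :: "('m option \<Rightarrow> real ^ ('m::finite option)) \<Rightarrow> real ^ ('m option) \<Rightarrow> real ^ 'm" where
  "perp_part u x = (\<chi> j. x \<bullet> u (Some j))"

definition second_moment_matrix :: "'a measure \<Rightarrow> ('a \<Rightarrow> real ^ 'm) \<Rightarrow> real ^ 'm ^ 'm" where
  "second_moment_matrix M X = (\<chi> i k. \<integral>\<omega>. X \<omega> $ i * X \<omega> $ k \<partial>M)"

definition nonneg_definite :: "real ^ 'm ^ 'm \<Rightarrow> bool" where
  "nonneg_definite A \<longleftrightarrow> (\<forall>x. 0 \<le> x \<bullet> (A *v x))"

definition matrix_sqrt :: "real ^ 'm ^ 'm \<Rightarrow> real ^ 'm ^ 'm" where
  "matrix_sqrt A = (THE R. transpose R = R \<and> nonneg_definite R \<and> R ** R = A)"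

section \<open>Walk and Brownian motion\<close>

definition walk :: "(nat \<Rightarrow> 'a \<Rightarrow> 'v::real_vector) \<Rightarrow> nat \<Rightarrow> 'a \<Rightarrow> 'v" where
  "walk \<xi> n \<omega> = (\<Sum>i=1..n. \<xi> i \<omega>)"

definition standard_brownian_motion01 :: "'b measure \<Rightarrow> (real \<Rightarrow> 'b \<Rightarrow> real ^ 'm) \<Rightarrow> bool" where
  "standard_brownian_motion01 N b \<longleftrightarrow>
     prob_space N \<and>
     (\<forall>t\<in>{0..1}. b t \<in> borel_measurable N) \<and>
     (\<forall>\<omega>\<in>space N. b 0 \<omega> = 0 \<and> continuous_on {0..1} (\<lambda>t. b t \<omega>)) \<and>
     \<comment> \<open>independent increments\<close>
     (\<forall>k (t :: nat \<Rightarrow> real). strict_mono_on {..k} t \<and> t ` {..k} \<subseteq> {0..1} \<longrightarrow>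
        prob_space.indep_vars N (\<lambda>_. borel) (\<lambda>i \<omega>. b (t (Suc i)) \<omega> - b (t i) \<omega>) {..<k}) \<and>
     \<comment> \<open>\<open>b t - b s\<close> is centred Gaussian with covariance \<open>t - s\<close> times the identity\<close>
     (\<forall>s t. 0 \<le> s \<and> s < t \<and> t \<le> 1 \<longrightarrow>
        prob_space.indep_vars N (\<lambda>_. borel) (\<lambda>j \<omega>. (b t \<omega> - b s \<omega>) $ j) UNIV \<and>
        (\<forall>j. distributed N lborel (\<lambda>\<omega>. (b t \<omega> - b s \<omega>) $ j) (normal_density 0 (sqrt (t - s)))))"

definition brownian_hull :: "real ^ 'm ^ 'm \<Rightarrow> (real \<Rightarrow> 'b \<Rightarrow> real ^ 'm) \<Rightarrow> 'b \<Rightarrow> (real ^ ('m option)) set" where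
  "brownian_hull \<Sigma> b \<omega> =
     convex hull ((\<lambda>t. block_diag1 (matrix_sqrt \<Sigma>) *v vec_cons t (b t \<omega>)) ` {0..1})"

end

theory Submission
  imports Defs
begin

text \<open>Write the walk as its drift plus a centred walk. After the scaling the drift contributes the
  deterministic coordinate \<open>t\<close>, and the fluctuation of the first coordinate, being of order
  \<open>sqrt n / n\<close>, vanishes. The other coordinates form a centred walk in \<open>d - 1\<close> dimensions whose
  limit is Brownian motion with covariance \<open>\<Sigma>\<close>. Splitting the time interval into \<open>k\<close> blocks reduces
  the claim to the joint convergence of the \<open>k\<close> block increments and to a bound, uniform in \<open>n\<close>, on
  the oscillation inside the blocks: the hull of a path is within the largest oscillation of the hull
  of its block end points. Joint convergence follows from Lindeberg's exchange argument, the increments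
  of the given Brownian motion serving as Gaussian replacements, and the test functions are extended
  from smooth to continuous ones by the Stone--Weierstrass theorem. The oscillation is controlled by
  Ottaviani's inequality and the fourth moment of the Gaussian limit. Finally, bounded Lipschitz
  functions suffice as test functions in any metric space, because the infimal convolutions of a
  continuous function increase to it.\<close>

section \<open>Convex hulls and the Hausdorff distance\<close>

text \<open>Two obstacles shape the argument. The first is that only second moments are given. A
  block of about \<open>n / k\<close> steps has variance of order \<open>1 / k\<close> after
  scaling, so Chebyshev bounds the probability of a large oscillation in one block by order
  \<open>1 / k\<close>, and the sum over \<open>k\<close> blocks does not become small. Ottaviani's
  inequality therefore moves the question to the end point of each block, whose law converges as
  \<open>n\<close> grows; the Gaussian limit has a fourth moment of order \<open>1 / k^2\<close>,
  and the sum over the blocks is of order \<open>1 / k\<close>. This dictates the order of the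
  limits: \<open>n\<close> tends to infinity with \<open>k\<close> fixed, and only then
  \<open>k\<close>. The second is that the walk and the Brownian motion live on unrelated
  probability spaces, so hybrid sums of both cannot be formed; the exchange compares averaging
  operators of laws instead. With Brownian increments over time steps \<open>1 / n\<close> as
  replacements the covariances agree exactly, and the replaced sums telescope to values of the
  Brownian path at grid times, so that path continuity carries them to the limit.\<close>

lemma convex_hull_in_convex_compacts0:
  fixes S :: "'a::euclidean_space set"
  shows "compact S \<Longrightarrow> 0 \<in> S \<Longrightarrow> convex hull S \<in> convex_compacts0"
  by (simp add: convex_compacts0_def compact_convex_hull hull_inc)

text \<open>The closed \<open>r\<close>-neighbourhood of \<open>C\<close> is the Minkowski sum of
  \<open>C\<close> with a ball, hence convex; once it contains \<open>A\<close> it contains the hull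
  of \<open>A\<close>. Compactness of \<open>C\<close> makes the infimum in \<open>infdist\<close>
  attained, which keeps the radius exactly \<open>r\<close>.\<close>

lemma infdist_convex_hull_le:
  fixes A :: "'a::euclidean_space set"
  assumes C: "compact C" "convex C" "C \<noteq> {}" and r: "\<And>a. a \<in> A \<Longrightarrow> infdist a C \<le> r"
    and x: "x \<in> convex hull A"
  shows "infdist x C \<le> r"
proof -
  let ?D = "\<Union>c\<in>C. \<Union>e\<in>cball 0 r. {c + e}"
  have "A \<subseteq> ?D"
  proof
    fix a assume "a \<in> A"
    obtain c where c: "c \<in> C" "infdist a C = dist a c"
      using infdist_attains_inf[OF compact_imp_closed[OF C(1)] C(3)] by blast
    with r[OF \<open>a \<in> A\<close>] have "norm (a - c) \<le> r" by (simp add: dist_norm)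
    then show "a \<in> ?D" using c(1) by (intro UN_I[of c] UN_I[of "a - c"]) auto
  qed
  moreover have "convex ?D"
    by (rule convex_sums[OF C(2) convex_cball])
  ultimately have "convex hull A \<subseteq> ?D" by (rule hull_minimal)
  with x have "x \<in> ?D" by (rule rev_subsetD)
  then obtain c e where "x = c + e" "c \<in> C" "norm e \<le> r" by auto
  then show ?thesis using infdist_le[of c C x] by (simp add: dist_norm)
qed

text \<open>Taking hulls does not increase the Hausdorff distance. All later estimates between hulls
  go through this form, which asks only for a nearby partner of each generating point.\<close>

lemma hausdorff_dist_convex_hull_le:
  fixes A B :: "'a::euclidean_space set"
  assumes "compact A" "compact B" "A \<noteq> {}" "B \<noteq> {}"
    and "\<And>a. a \<in> A \<Longrightarrow> \<exists>b\<in>B. norm (a - b) \<le> r" "\<And>b. b \<in> B \<Longrightarrow> \<exists>a\<in>A. norm (a - b) \<le> r"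
  shows "hausdorff_dist (convex hull A) (convex hull B) \<le> r"
proof (subst hausdorff_dist_le_iff)
  show "convex hull A \<noteq> {}" "convex hull B \<noteq> {}" "bounded (convex hull A)" "bounded (convex hull B)"
    using assms by (auto simp: compact_imp_bounded compact_convex_hull)
  have 1: "infdist x (convex hull B) \<le> r" if "x \<in> A" for x
  proof -
    obtain b where "b \<in> B" "norm (x - b) \<le> r" using assms(5) \<open>x \<in> A\<close> by blast
    then show ?thesis using infdist_le2[of b "convex hull B" x r] by (simp add: hull_inc dist_norm)
  qed
  have 2: "infdist x (convex hull A) \<le> r" if "x \<in> B" for x
  proof -
    obtain a where "a \<in> A" "norm (a - x) \<le> r" using assms(6) \<open>x \<in> B\<close> by blast
    then show ?thesis using infdist_le2[of a "convex hull A" x r]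
      by (simp add: hull_inc dist_norm norm_minus_commute)
  qed
  show "(\<forall>x\<in>convex hull A. infdist x (convex hull B) \<le> r) \<and> (\<forall>y\<in>convex hull B. infdist y (convex hull A) \<le> r)"
    using assms infdist_convex_hull_le[of "convex hull B" A r, OF _ _ _ 1]
      infdist_convex_hull_le[of "convex hull A" B r, OF _ _ _ 2]
    by (simp add: compact_convex_hull)
qed

section \<open>Borel measurability of maps into a metric space\<close>

lemma measurable_borel_ofI:
  assumes "f \<in> space M \<rightarrow> topspace T" "\<And>U. openin T U \<Longrightarrow> f -` U \<inter> space M \<in> sets M"
  shows "f \<in> M \<rightarrow>\<^sub>M borel_of T"
  unfolding borel_of_def
  by (rule measurable_measure_of) (use assms in \<open>auto dest: openin_subset[THEN subsetD]\<close>)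

lemma openin_sets_borel_of: "openin T U \<Longrightarrow> U \<in> sets (borel_of T)"
  unfolding borel_of_def
  by (subst sets_measure_of) (auto dest: openin_subset[THEN subsetD])

lemma space_borel_of: "space (borel_of T) = topspace T"
  by (simp add: borel_of_def space_measure_of_conv)

lemma continuous_map_measurable_borel_of:
  assumes "continuous_map T euclideanreal f"
  shows "f \<in> borel_measurable (borel_of T)"
proof (rule borel_measurableI)
  fix S :: "real set" assume "open S"
  then have "openin T {x \<in> topspace T. f x \<in> S}"
    using assms openin_continuous_map_preimage by fastforce
  moreover have "f -` S \<inter> space (borel_of T) = {x \<in> topspace T. f x \<in> S}"
    by (auto simp: space_borel_of)
  ultimately show "f -` S \<inter> space (borel_of T) \<in> sets (borel_of T)"
    by (simp add: openin_sets_borel_of)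
qed

context Metric_space
begin

lemma measurable_borel_of_mtopologyI:
  fixes f :: "'e::topological_space \<Rightarrow> 'a"
  assumes M: "\<And>x. f x \<in> M" and f: "\<And>x e. 0 < e \<Longrightarrow> eventually (\<lambda>y. d (f x) (f y) < e) (nhds x)"
  shows "f \<in> borel \<rightarrow>\<^sub>M borel_of mtopology"
proof (rule measurable_borel_ofI)
  fix U assume U: "openin mtopology U"
  have "\<exists>T. open T \<and> x \<in> T \<and> T \<subseteq> f -` U" if "x \<in> f -` U" for x
  proof -
    have "f x \<in> U" using that by simp
    then obtain e where e: "0 < e" "mball (f x) e \<subseteq> U" using U openin_mtopology by blast
    obtain S where "open S" "x \<in> S" "\<And>y. y \<in> S \<Longrightarrow> d (f x) (f y) < e"
      using f[OF e(1), of x] by (auto simp: eventually_nhds)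
    then show "\<exists>T. open T \<and> x \<in> T \<and> T \<subseteq> f -` U"
      using e(2) M by (intro exI[of _ S]) (auto simp: subset_iff)
  qed
  then have "open (f -` U)" using open_subopen by blast
  then show "f -` U \<inter> space borel \<in> sets borel" by simp
qed (use M in auto)

text \<open>Inside an open \<open>U\<close>, the points whose ball of radius
  \<open>1 / (m + 1)\<close> stays in \<open>U\<close> form a closed set \<open>C m\<close>. A limit
  lies in \<open>U\<close> exactly if the sequence is eventually in one of these sets, and this
  condition combines countably many measurable ones.\<close>

lemma measurable_borel_of_mtopology_limit:
  assumes F: "\<And>k. F k \<in> N \<rightarrow>\<^sub>M borel_of mtopology"
    and f: "\<And>x. x \<in> space N \<Longrightarrow> f x \<in> M"
    and lim: "\<And>x. x \<in> space N \<Longrightarrow> (\<lambda>k. d (F k x) (f x)) \<longlonglongrightarrow> 0"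
  shows "f \<in> N \<rightarrow>\<^sub>M borel_of mtopology"
proof (rule measurable_borel_ofI)
  fix U assume U: "openin mtopology U"
  have FM: "F k x \<in> M" if "x \<in> space N" for k x
    using measurable_space[OF F that] by (simp add: space_borel_of)
  define C where "C m = {x \<in> M. mball x (1 / real (Suc m)) \<subseteq> U}" for m
  have C: "C m \<in> sets (borel_of mtopology)" for m
  proof -
    \<comment> \<open>By symmetry of the distance, a point fails to be in \<open>C m\<close> exactly
      if it lies in such a ball around some point outside \<open>U\<close>. The complement is thus a
      union of open balls.\<close>
    have "M - C m = M \<inter> (\<Union>y\<in>M - U. mball y (1 / real (Suc m)))"
      by (auto simp: C_def commute)
    then have "openin mtopology (M - C m)" by auto
    then have "M - (M - C m) \<in> sets (borel_of mtopology)"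
      by (metis openin_sets_borel_of sets.compl_sets space_borel_of topspace_mtopology)
    moreover have "M - (M - C m) = C m" by (auto simp: C_def)
    ultimately show ?thesis by simp
  qed
  have "f x \<in> U \<longleftrightarrow> (\<exists>m K. \<forall>k\<in>{K..}. F k x \<in> C m)" if x: "x \<in> space N" for x
  proof
    assume "f x \<in> U"
    then obtain e where e: "0 < e" "mball (f x) e \<subseteq> U" using U openin_mtopology by blast
    obtain m where m: "1 / real (Suc m) < e / 2" using nat_approx_posE[of "e/2"] e(1) by auto
    obtain K where K: "\<And>k. k \<ge> K \<Longrightarrow> d (F k x) (f x) < e / 2"
      using lim[OF x] e(1) unfolding lim_sequentially dist_real_def
      by (metis abs_of_nonneg diff_zero half_gt_zero nonneg)
    have "F k x \<in> C m" if "k \<ge> K" for k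
    proof -
      have "y \<in> U" if "y \<in> mball (F k x) (1 / real (Suc m))" for y
      proof -
        have "d (f x) y \<le> d (f x) (F k x) + d (F k x) y" using that FM f x by (intro triangle) auto
        also have "\<dots> < e" using K[OF \<open>k \<ge> K\<close>] that m by (simp add: commute)
        finally show ?thesis using e(2) f x that by auto
      qed
      then show ?thesis using FM x by (auto simp: C_def)
    qed
    then show "\<exists>m K. \<forall>k\<in>{K..}. F k x \<in> C m" by (meson atLeast_iff)
  next
    assume "\<exists>m K. \<forall>k\<in>{K..}. F k x \<in> C m"
    then obtain m K where *: "\<forall>k\<in>{K..}. F k x \<in> C m" by blast
    obtain k where "k \<ge> K" "d (F k x) (f x) < 1 / real (Suc m)"
    proof -
      obtain K' where K: "\<And>k. k \<ge> K' \<Longrightarrow> d (F k x) (f x) < 1 / real (Suc m)"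
        using lim[OF x] unfolding lim_sequentially dist_real_def
        by (metis abs_of_nonneg diff_zero nonneg of_nat_0_less_iff zero_less_Suc zero_less_divide_1_iff)
      show ?thesis using that[of "max K K'"] K by simp
    qed
    moreover have "F k x \<in> C m" using * \<open>k \<ge> K\<close> by auto
    ultimately show "f x \<in> U" using FM f x by (auto simp: C_def)
  qed
  then have "f -` U \<inter> space N = {x \<in> space N. \<exists>m K. \<forall>k\<in>{K..}. F k x \<in> C m}"
    by auto
  also have "\<dots> \<in> sets N"
  proof -
    have [measurable]: "C m \<in> sets (borel_of mtopology)" "F k \<in> N \<rightarrow>\<^sub>M borel_of mtopology" for m k by fact+
    show ?thesis by measurable
  qed
  finally show "f -` U \<inter> space N \<in> sets N" .
qed (use f in auto)

end

section \<open>Weak convergence in metric spaces\<close>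

lemma integrable_bounded_compose:
  fixes f :: "'e \<Rightarrow> real"
  assumes "finite_measure M" "X \<in> M \<rightarrow>\<^sub>M N" "f \<in> borel_measurable N" "\<And>x. x \<in> space N \<Longrightarrow> \<bar>f x\<bar> \<le> B"
  shows "integrable M (\<lambda>\<omega>. f (X \<omega>))"
proof -
  interpret finite_measure M by fact
  show ?thesis
    using assms measurable_space[OF assms(2)] by (intro integrable_const_bound[of _ B]) auto
qed

context Metric_space
begin

text \<open>For bounded \<open>f\<close> on the carrier this is the largest
  \<open>m\<close>-Lipschitz function below \<open>f\<close>.\<close>

definition inf_conv :: "('a \<Rightarrow> real) \<Rightarrow> nat \<Rightarrow> 'a \<Rightarrow> real" where
  "inf_conv f m x = (INF y\<in>M. f y + real m * d x y)"

context
  fixes f :: "'a \<Rightarrow> real" and B :: real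
  assumes bound: "\<And>x. x \<in> M \<Longrightarrow> \<bar>f x\<bar> \<le> B"
begin

lemma bdd_below_inf_conv: "bdd_below ((\<lambda>y. f y + real m * d x y) ` M)"
proof (rule bdd_belowI2)
  fix y assume "y \<in> M"
  have "0 \<le> real m * d x y" by simp
  then show "- B \<le> f y + real m * d x y" using bound[OF \<open>y \<in> M\<close>] by linarith
qed

lemma inf_conv_le: "x \<in> M \<Longrightarrow> inf_conv f m x \<le> f x"
  unfolding inf_conv_def by (rule cINF_lower2[OF bdd_below_inf_conv]) auto

lemma inf_conv_greatest:
  "x \<in> M \<Longrightarrow> (\<And>y. y \<in> M \<Longrightarrow> c \<le> f y + real m * d x y) \<Longrightarrow> c \<le> inf_conv f m x"
  unfolding inf_conv_def by (rule cINF_greatest) auto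

lemma abs_inf_conv_le: "x \<in> M \<Longrightarrow> \<bar>inf_conv f m x\<bar> \<le> B"
proof -
  assume x: "x \<in> M"
  have "- B \<le> inf_conv f m x"
  proof (rule inf_conv_greatest[OF x])
    fix y assume "y \<in> M"
    have "0 \<le> real m * d x y" by simp
    then show "- B \<le> f y + real m * d x y" using bound[OF \<open>y \<in> M\<close>] by linarith
  qed
  then show ?thesis using inf_conv_le[OF x, of m] bound[OF x] by linarith
qed

lemma inf_conv_Lipschitz:
  assumes "x \<in> M" "x' \<in> M"
  shows "\<bar>inf_conv f m x - inf_conv f m x'\<bar> \<le> real m * d x x'"
proof -
  have *: "inf_conv f m x - real m * d x x' \<le> inf_conv f m x'" if "x \<in> M" "x' \<in> M" for x x'
  proof (rule inf_conv_greatest[OF that(2)])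
    fix y assume y: "y \<in> M"
    have "inf_conv f m x \<le> f y + real m * d x y"
      unfolding inf_conv_def by (rule cINF_lower[OF bdd_below_inf_conv y])
    also have "real m * d x y \<le> real m * (d x x' + d x' y)"
      using that y by (intro mult_left_mono triangle) auto
    finally show "inf_conv f m x - real m * d x x' \<le> f y + real m * d x' y"
      by (simp add: algebra_simps)
  qed
  show ?thesis using *[OF assms] *[OF assms(2,1)] by (simp add: commute abs_le_iff)
qed

lemma inf_conv_tendsto:
  assumes cont: "continuous_map mtopology euclideanreal f" and x: "x \<in> M"
  shows "(\<lambda>m. inf_conv f m x) \<longlonglongrightarrow> f x"
proof (rule LIMSEQ_I)
  fix r :: real assume r: "0 < r"
  obtain \<delta> where \<delta>: "0 < \<delta>" "\<And>y. y \<in> M \<Longrightarrow> d x y < \<delta> \<Longrightarrow> dist (f x) (f y) < r / 2"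
  proof -
    have "openin mtopology {y \<in> topspace mtopology. f y \<in> ball (f x) (r / 2)}"
      using cont openin_continuous_map_preimage by (metis open_ball open_openin)
    then obtain \<delta> where "0 < \<delta>" "mball x \<delta> \<subseteq> {y \<in> M. f y \<in> ball (f x) (r / 2)}"
      using x r unfolding openin_mtopology by auto
    then show thesis using that[of \<delta>] x by (auto simp: subset_iff)
  qed
  \<comment> \<open>From this index on, the penalty \<open>m * \<delta>\<close> exceeds
    \<open>2 * B\<close>, the largest possible drop of \<open>f\<close>, so points at distance
    \<open>\<delta>\<close> or more cannot pull the infimum below \<open>f x\<close>.\<close>
  obtain N :: nat where N: "2 * B / \<delta> < N" using reals_Archimedean2 by blast
  have "norm (inf_conv f m x - f x) < r" if "m \<ge> N" for m
  proof -
    have "f x - r / 2 \<le> inf_conv f m x"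
    proof (rule inf_conv_greatest[OF x])
      fix y assume y: "y \<in> M"
      show "f x - r / 2 \<le> f y + real m * d x y"
      proof (cases "d x y < \<delta>")
        case True
        have "0 \<le> real m * d x y" by simp
        then show ?thesis using \<delta>(2)[OF y True] unfolding dist_real_def by linarith
      next
        case False
        have "2 * B < real m * \<delta>" using N \<open>m \<ge> N\<close> \<delta>(1) by (simp add: field_simps)
          (smt (verit, best) mult_left_mono of_nat_mono)
        also have "\<dots> \<le> real m * d x y" using False by (intro mult_left_mono) auto
        finally show ?thesis using bound[OF y] bound[OF x] r by linarith
      qed
    qed
    then show ?thesis using inf_conv_le[OF x, of m] r by simp
  qed
  then show "\<exists>N. \<forall>m\<ge>N. norm (inf_conv f m x - f x) < r" by blast
qed

end

lemma continuous_map_Lipschitz_real: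
  fixes f :: "'a \<Rightarrow> real"
  assumes L: "\<And>x y. x \<in> M \<Longrightarrow> y \<in> M \<Longrightarrow> \<bar>f x - f y\<bar> \<le> L * d x y"
  shows "continuous_map mtopology euclideanreal f"
proof -
  have "\<exists>\<delta>>0. \<forall>y. y \<in> M \<and> d x y < \<delta> \<longrightarrow> dist (f x) (f y) < \<epsilon>" if "x \<in> M" "0 < \<epsilon>" for x \<epsilon>
  proof (intro exI conjI allI impI)
    \<comment> \<open>The sign of \<open>L\<close> is not known; \<open>\<bar>L\<bar> + 1\<close> is
      a positive constant above it.\<close>
    show "0 < \<epsilon> / (\<bar>L\<bar> + 1)" using that by simp
    fix y assume y: "y \<in> M \<and> d x y < \<epsilon> / (\<bar>L\<bar> + 1)"
    have "dist (f x) (f y) \<le> (\<bar>L\<bar> + 1) * d x y"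
    proof -
      have "L * d x y \<le> (\<bar>L\<bar> + 1) * d x y" by (intro mult_right_mono) auto
      then show ?thesis using L[of x y] y that unfolding dist_real_def by linarith
    qed
    also have "\<dots> < \<epsilon>" using y by (simp add: field_simps)
    finally show "dist (f x) (f y) < \<epsilon>" .
  qed
  then show ?thesis using metric_continuous_map[OF Met_TC.Metric_space_axioms, of f] by simp
qed

text \<open>One half of the portmanteau theorem. The function \<open>inf_conv f m\<close> lies below
  \<open>f\<close>, so its limit expectation bounds those of \<open>f (X n)\<close> asymptotically
  from below; by dominated convergence that limit is as close to the expectation of
  \<open>f (Y)\<close> as desired once \<open>m\<close> is large.\<close>

lemma weak_limit_lower_bound:
  fixes f :: "'a \<Rightarrow> real"
  assumes P: "prob_space P" and Q: "prob_space Q"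
    and X: "\<And>n. X n \<in> P \<rightarrow>\<^sub>M borel_of mtopology" and Y: "Y \<in> Q \<rightarrow>\<^sub>M borel_of mtopology"
    and lim: "\<And>(g :: 'a \<Rightarrow> real) L B. \<lbrakk>\<And>x. x \<in> M \<Longrightarrow> \<bar>g x\<bar> \<le> B;
        \<And>x y. x \<in> M \<Longrightarrow> y \<in> M \<Longrightarrow> \<bar>g x - g y\<bar> \<le> L * d x y\<rbrakk> \<Longrightarrow>
        (\<lambda>n. \<integral>\<omega>. g (X n \<omega>) \<partial>P) \<longlonglongrightarrow> (\<integral>\<omega>. g (Y \<omega>) \<partial>Q)"
    and f: "continuous_map mtopology euclideanreal f" "\<And>x. x \<in> M \<Longrightarrow> \<bar>f x\<bar> \<le> B" and "0 < e"
  shows "eventually (\<lambda>n. (\<integral>\<omega>. f (Y \<omega>) \<partial>Q) - e < (\<integral>\<omega>. f (X n \<omega>) \<partial>P)) sequentially"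
proof -
  interpret P: prob_space P by fact
  interpret Q: prob_space Q by fact
  let ?g = "inf_conv f"
  have g_cont: "continuous_map mtopology euclideanreal (?g m)" for m
    by (rule continuous_map_Lipschitz_real) (rule inf_conv_Lipschitz[of _ B], use f(2) in auto)
  note meas = continuous_map_measurable_borel_of[OF g_cont] continuous_map_measurable_borel_of[OF f(1)]
  have YM: "Y \<omega> \<in> M" if "\<omega> \<in> space Q" for \<omega>
    using measurable_space[OF Y that] by (simp add: space_borel_of)
  have XM: "X n \<omega> \<in> M" if "\<omega> \<in> space P" for n \<omega>
    using measurable_space[OF X that] by (simp add: space_borel_of)
  have "(\<lambda>m. \<integral>\<omega>. ?g m (Y \<omega>) \<partial>Q) \<longlonglongrightarrow> (\<integral>\<omega>. f (Y \<omega>) \<partial>Q)"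
  proof (rule integral_dominated_convergence[where w="\<lambda>_. B"])
    show "(\<lambda>\<omega>. f (Y \<omega>)) \<in> borel_measurable Q" "(\<lambda>\<omega>. ?g m (Y \<omega>)) \<in> borel_measurable Q" for m
      using meas Y by (auto intro: measurable_compose)
    show "AE \<omega> in Q. (\<lambda>m. ?g m (Y \<omega>)) \<longlonglongrightarrow> f (Y \<omega>)"
      using inf_conv_tendsto[OF f(2,1)] YM by auto
    show "AE \<omega> in Q. norm (?g m (Y \<omega>)) \<le> B" for m
      using abs_inf_conv_le[OF f(2)] YM by auto
  qed auto
  then obtain m where m: "(\<integral>\<omega>. f (Y \<omega>) \<partial>Q) - e / 2 < (\<integral>\<omega>. ?g m (Y \<omega>) \<partial>Q)"
    using order_tendstoD(1)[of _ "\<integral>\<omega>. f (Y \<omega>) \<partial>Q" sequentially "(\<integral>\<omega>. f (Y \<omega>) \<partial>Q) - e / 2"] \<open>0 < e\<close>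
    by (auto simp: eventually_sequentially)
  have "(\<lambda>n. \<integral>\<omega>. ?g m (X n \<omega>) \<partial>P) \<longlonglongrightarrow> (\<integral>\<omega>. ?g m (Y \<omega>) \<partial>Q)"
    by (rule lim[of _ B "real m"]) (use abs_inf_conv_le[OF f(2)] inf_conv_Lipschitz[OF f(2)] in auto)
  from order_tendstoD(1)[OF this, of "(\<integral>\<omega>. f (Y \<omega>) \<partial>Q) - e"] m \<open>0 < e\<close>
  have "eventually (\<lambda>n. (\<integral>\<omega>. f (Y \<omega>) \<partial>Q) - e < (\<integral>\<omega>. ?g m (X n \<omega>) \<partial>P)) sequentially" by simp
  then show ?thesis
  proof eventually_elim
    case (elim n)
    also have "(\<integral>\<omega>. ?g m (X n \<omega>) \<partial>P) \<le> (\<integral>\<omega>. f (X n \<omega>) \<partial>P)"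
      using inf_conv_le[of f B, OF f(2)] XM abs_inf_conv_le[of f B, OF f(2)] f(2)
      by (intro integral_mono integrable_bounded_compose[OF P.finite_measure_axioms X, where B=B] meas)
        (auto simp: space_borel_of)
    finally show ?case .
  qed
qed

lemma weakly_converges_LipschitzI:
  assumes "prob_space P" "prob_space Q"
    and "\<And>n. X n \<in> P \<rightarrow>\<^sub>M borel_of mtopology" "Y \<in> Q \<rightarrow>\<^sub>M borel_of mtopology"
    and "\<And>(g :: 'a \<Rightarrow> real) L B. \<lbrakk>\<And>x. x \<in> M \<Longrightarrow> \<bar>g x\<bar> \<le> B;
        \<And>x y. x \<in> M \<Longrightarrow> y \<in> M \<Longrightarrow> \<bar>g x - g y\<bar> \<le> L * d x y\<rbrakk> \<Longrightarrow>
        (\<lambda>n. \<integral>\<omega>. g (X n \<omega>) \<partial>P) \<longlonglongrightarrow> (\<integral>\<omega>. g (Y \<omega>) \<partial>Q)"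
  shows "weakly_converges mtopology P X Q Y"
  unfolding weakly_converges_def
proof (intro conjI allI impI)
  fix f :: "'a \<Rightarrow> real"
  assume f: "continuous_map mtopology euclideanreal f \<and> bounded (f ` topspace mtopology)"
  then obtain B where B: "\<And>x. x \<in> M \<Longrightarrow> \<bar>f x\<bar> \<le> B" by (auto simp: bounded_iff)
  show "(\<lambda>n. \<integral>\<omega>. f (X n \<omega>) \<partial>P) \<longlonglongrightarrow> (\<integral>\<omega>. f (Y \<omega>) \<partial>Q)"
    unfolding tendsto_iff
  proof (intro allI impI)
    fix e :: real assume "0 < e"
    have "eventually (\<lambda>n. (\<integral>\<omega>. f (Y \<omega>) \<partial>Q) - e < (\<integral>\<omega>. f (X n \<omega>) \<partial>P)) sequentially"
      by (rule weak_limit_lower_bound[OF assms, where f=f and B=B]) (use f B \<open>0 < e\<close> in auto)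
    \<comment> \<open>The lower bound for \<open>- f\<close> is the missing upper bound for
      \<open>f\<close>.\<close>
    moreover have "eventually (\<lambda>n. (\<integral>\<omega>. - f (Y \<omega>) \<partial>Q) - e < (\<integral>\<omega>. - f (X n \<omega>) \<partial>P)) sequentially"
      by (rule weak_limit_lower_bound[OF assms, where f="\<lambda>x. - f x" and B=B])
        (use f B \<open>0 < e\<close> in \<open>auto intro: continuous_intros\<close>)
    ultimately show "eventually (\<lambda>n. dist (\<integral>\<omega>. f (X n \<omega>) \<partial>P) (\<integral>\<omega>. f (Y \<omega>) \<partial>Q) < e) sequentially"
      by eventually_elim (simp add: dist_real_def)
  qed
qed (use assms in auto)

end

section \<open>Square roots of nonnegative-definite matrices\<close>

lemma dot_symmetric_matrix:
  fixes A :: "real ^ 'n ^ 'n"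
  assumes "transpose A = A"
  shows "x \<bullet> (A *v y) = (A *v x) \<bullet> y"
  by (metis assms dot_lmul_matrix transpose_matrix_vector)

text \<open>A unit vector \<open>v\<close> of \<open>W\<close> maximising the quadratic form of
  \<open>A\<close>, with maximum \<open>c\<close>, is an eigenvector: the form of
  \<open>g = c - A\<close> is nonnegative on \<open>W\<close> and vanishes at \<open>v\<close>, and
  a nonnegative symmetric form can vanish at \<open>v\<close> only if
  \<open>g v = 0\<close>.\<close>

lemma symmetric_matrix_eigenvector:
  fixes A :: "real ^ 'n ^ 'n"
  assumes sym: "transpose A = A" and W: "subspace W" "\<And>x. x \<in> W \<Longrightarrow> A *v x \<in> W" "W \<noteq> {0}"
  obtains v c where "v \<in> W" "norm v = 1" "A *v v = c *\<^sub>R v"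
proof -
  let ?S = "W \<inter> sphere 0 1"
  have "compact ?S" using closed_subspace[OF W(1)] by (simp add: closed_Int_compact)
  moreover have "?S \<noteq> {}"
  proof -
    obtain w where "w \<in> W" "w \<noteq> 0" using W(1,3) subspace_0 by fastforce
    then have "w /\<^sub>R norm w \<in> ?S" using subspace_scale[OF W(1)] by simp
    then show ?thesis by blast
  qed
  moreover have "continuous_on ?S (\<lambda>x. x \<bullet> (A *v x))"
    by (intro continuous_on_inner continuous_on_id matrix_vector_mult_linear_continuous_on)
  ultimately obtain v where "v \<in> ?S" "\<forall>y\<in>?S. y \<bullet> (A *v y) \<le> v \<bullet> (A *v v)"
    using continuous_attains_sup by blast
  then have v: "v \<in> W" "norm v = 1"
    and vmax: "\<And>y. y \<in> W \<Longrightarrow> norm y = 1 \<Longrightarrow> y \<bullet> (A *v y) \<le> v \<bullet> (A *v v)"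
    by auto
  define c where "c = v \<bullet> (A *v v)"
  define g where "g x = c *\<^sub>R x - A *v x" for x
  have gW: "g x \<in> W" if "x \<in> W" for x
    unfolding g_def using W that by (simp add: subspace_diff subspace_scale)
  have g_add: "g (x + y) = g x + g y" and g_scale: "g (t *\<^sub>R x) = t *\<^sub>R g x" for x y t
    by (simp_all add: g_def algebra_simps matrix_vector_right_distrib matrix_vector_mult_scaleR)
  have g_sym: "x \<bullet> g y = g x \<bullet> y" for x y
    by (simp add: g_def inner_diff_left inner_diff_right dot_symmetric_matrix[OF sym])
  have g_nonneg: "0 \<le> x \<bullet> g x" if "x \<in> W" for x
  proof (cases "x = 0")
    case False
    let ?y = "x /\<^sub>R norm x"
    have "?y \<bullet> (A *v ?y) \<le> c"
      unfolding c_def using False that W(1) by (intro vmax) (auto simp: subspace_scale)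
    moreover have "?y \<bullet> ?y = 1" unfolding dot_square_norm using False by simp
    ultimately have "0 \<le> ?y \<bullet> g ?y"
      unfolding g_def inner_diff_right inner_scaleR_right[of ?y c] by simp
    also have "?y \<bullet> g ?y = (x \<bullet> g x) / (norm x)\<^sup>2"
      by (simp only: g_scale inner_scaleR_left inner_scaleR_right)
        (simp add: power2_eq_square field_simps)
    finally show ?thesis using False by (simp add: zero_le_divide_iff)
  qed simp
  have gv0: "v \<bullet> g v = 0" using v by (simp add: g_def inner_diff_right dot_square_norm c_def)
  define w where "w = g v"
  have "w \<in> W" unfolding w_def by (rule gW[OF v(1)])
  define q where "q = w \<bullet> g w"
  have q: "0 \<le> q" unfolding q_def by (rule g_nonneg[OF \<open>w \<in> W\<close>])
  have "w \<bullet> w \<le> 0"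
  proof (rule ccontr)
    assume "\<not> w \<bullet> w \<le> 0"
    then have pos: "0 < w \<bullet> w" by linarith
    \<comment> \<open>Moving from \<open>v\<close> by \<open>- s\<close> times
      \<open>w = g v\<close> changes the form by \<open>- 2 * s * (w \<bullet> w) + s^2 * q\<close>.
      This \<open>s\<close> makes the change negative, and the summand \<open>1\<close> covers the
      case \<open>q = 0\<close>.\<close>
    define s where "s = (w \<bullet> w) / (q + 1)"
    have s: "0 < s" using pos q by (simp add: s_def)
    have "0 \<le> (v + (- s) *\<^sub>R w) \<bullet> g (v + (- s) *\<^sub>R w)"
      using v(1) \<open>w \<in> W\<close> W(1) by (intro g_nonneg subspace_add subspace_scale)
    also have "\<dots> = v \<bullet> g v - s * (v \<bullet> g w) - s * (w \<bullet> g v) + s * s * q"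
      by (simp only: g_add g_scale inner_add_left inner_add_right inner_scaleR_left inner_scaleR_right q_def)
        (simp add: algebra_simps)
    also have "v \<bullet> g w = w \<bullet> w" unfolding w_def by (rule g_sym)
    also have "w \<bullet> g v = w \<bullet> w" by (simp add: w_def)
    finally have "2 * s * (w \<bullet> w) \<le> s * (s * q)" using gv0 by simp
    then have "2 * (w \<bullet> w) \<le> s * q" using s by simp
    also have "s * q = (w \<bullet> w) * (q / (q + 1))" by (simp add: s_def)
    also have "\<dots> \<le> (w \<bullet> w) * 1" using pos q by (intro mult_left_mono) auto
    finally show False using pos by simp
  qed
  then have "g v = 0" unfolding w_def by (metis antisym inner_eq_zero_iff inner_ge_zero)
  then have "A *v v = c *\<^sub>R v" by (simp add: g_def)
  then show thesis using that v by blast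
qed

definition orthonormal_eigenvectors :: "real ^ 'n ^ 'n \<Rightarrow> (real ^ 'n) set \<Rightarrow> bool" where
  "orthonormal_eigenvectors A B \<longleftrightarrow> finite B \<and> (\<forall>b\<in>B. norm b = 1) \<and>
     pairwise orthogonal B \<and> (\<forall>b\<in>B. \<exists>c. A *v b = c *\<^sub>R b)"

lemma orthonormal_eigenvectors_eigenvalue:
  assumes "orthonormal_eigenvectors A B" "b \<in> B"
  shows "A *v b = (b \<bullet> (A *v b)) *\<^sub>R b"
proof -
  obtain c where c: "A *v b = c *\<^sub>R b" and "norm b = 1"
    using assms by (auto simp: orthonormal_eigenvectors_def)
  then have "b \<bullet> (A *v b) = c" by (simp add: dot_square_norm)
  then show ?thesis using c by simp
qed

text \<open>An orthonormal set of eigenvectors of greatest cardinality exists because the dimension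
  bounds the cardinality. Symmetry makes its orthogonal complement invariant, so a nonzero
  complement would contain a further eigenvector.\<close>

lemma symmetric_matrix_eigenbasis:
  fixes A :: "real ^ 'n ^ 'n"
  assumes sym: "transpose A = A"
  obtains B where "orthonormal_eigenvectors A B" "\<And>x. (\<Sum>b\<in>B. (b \<bullet> x) *\<^sub>R b) = x"
proof -
  let ?P = "\<lambda>n. \<exists>B. orthonormal_eigenvectors A B \<and> card B = n"
  have bound: "n \<le> DIM(real ^ 'n)" if P: "?P n" for n
  proof -
    obtain B where B: "orthonormal_eigenvectors A B" "card B = n" using P by blast
    then have "independent B"
      by (intro pairwise_orthogonal_independent) (auto simp: orthonormal_eigenvectors_def)
    then show ?thesis using independent_bound B by blast
  qed
  have P0: "?P 0" by (intro exI[of _ "{}"]) (simp add: orthonormal_eigenvectors_def)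
  obtain B where B: "orthonormal_eigenvectors A B" "card B = (GREATEST n. ?P n)"
    using GreatestI_nat[of ?P, OF P0 bound] by blast
  have max: "card B' \<le> card B" if "orthonormal_eigenvectors A B'" for B'
    unfolding B(2) by (rule Greatest_le_nat[OF _ bound]) (use that in auto)
  have fin: "finite B" and dotB: "\<And>b b'. b \<in> B \<Longrightarrow> b' \<in> B \<Longrightarrow> b \<bullet> b' = (if b = b' then 1 else 0)"
    using B(1) by (auto simp: orthonormal_eigenvectors_def pairwise_def orthogonal_def dot_square_norm)
  define W where "W = {x. \<forall>b\<in>B. b \<bullet> x = 0}"
  have W: "subspace W" by (auto simp: W_def subspace_def inner_add_right)
  have inv: "A *v x \<in> W" if "x \<in> W" for x
  proof -
    have "b \<bullet> (A *v x) = 0" if "b \<in> B" for b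
    proof -
      obtain c where "A *v b = c *\<^sub>R b" using B(1) \<open>b \<in> B\<close> by (auto simp: orthonormal_eigenvectors_def)
      then show ?thesis
        using \<open>x \<in> W\<close> \<open>b \<in> B\<close> by (simp add: W_def dot_symmetric_matrix[OF sym, of b x])
    qed
    then show ?thesis by (simp add: W_def)
  qed
  have "W = {0}"
  proof (rule ccontr)
    assume "W \<noteq> {0}"
    then obtain v c where v: "v \<in> W" "norm v = 1" "A *v v = c *\<^sub>R v"
      using symmetric_matrix_eigenvector[OF sym W inv] by blast
    have "v \<notin> B"
    proof
      assume "v \<in> B"
      then have "v \<bullet> v = 0" using v(1) by (simp add: W_def)
      then show False using v(2) by simp
    qed
    from v B(1) have "orthonormal_eigenvectors A (insert v B)"
      unfolding orthonormal_eigenvectors_def W_def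
      by (auto simp: pairwise_insert orthogonal_def inner_commute)
    from max[OF this] show False using \<open>v \<notin> B\<close> fin by simp
  qed
  moreover have "x - (\<Sum>b\<in>B. (b \<bullet> x) *\<^sub>R b) \<in> W" for x
  proof -
    have "a \<bullet> (\<Sum>b\<in>B. (b \<bullet> x) *\<^sub>R b) = a \<bullet> x" if "a \<in> B" for a
    proof -
      have "a \<bullet> (\<Sum>b\<in>B. (b \<bullet> x) *\<^sub>R b) = (\<Sum>b\<in>B. if a = b then b \<bullet> x else 0)"
        unfolding inner_sum_right using dotB that by (intro sum.cong) auto
      then show ?thesis using that fin by simp
    qed
    then show ?thesis by (simp add: W_def inner_diff_right)
  qed
  ultimately have "(\<Sum>b\<in>B. (b \<bullet> x) *\<^sub>R b) = x" for x by (metis eq_iff_diff_eq_0 singletonD)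
  then show thesis using that B(1) by blast
qed

lemma matrix_sqrt_exists:
  fixes A :: "real ^ 'n ^ 'n"
  assumes sym: "transpose A = A" and psd: "nonneg_definite A"
  obtains R where "transpose R = R" "nonneg_definite R" "R ** R = A"
proof -
  obtain B where B: "orthonormal_eigenvectors A B" and sp: "\<And>x. (\<Sum>b\<in>B. (b \<bullet> x) *\<^sub>R b) = x"
    using symmetric_matrix_eigenbasis[OF sym] by blast
  have fin: "finite B" and dotB: "\<And>b b'. b \<in> B \<Longrightarrow> b' \<in> B \<Longrightarrow> b \<bullet> b' = (if b = b' then 1 else 0)"
    using B(1) by (auto simp: orthonormal_eigenvectors_def pairwise_def orthogonal_def dot_square_norm)
  define l where "l b = sqrt (b \<bullet> (A *v b))" for b
  have l: "0 \<le> l b" "l b * l b = b \<bullet> (A *v b)" for b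
    using psd by (auto simp: l_def nonneg_definite_def)
  \<comment> \<open>The spectral formula: the sum of the projections \<open>b b^T\<close> weighted
    by the roots of the eigenvalues.\<close>
  define R :: "real ^ 'n ^ 'n" where "R = (\<chi> i j. \<Sum>b\<in>B. l b * b $ i * b $ j)"
  have Rv: "R *v x = (\<Sum>b\<in>B. (l b * (b \<bullet> x)) *\<^sub>R b)" for x
  proof -
    have "(R *v x) $ i = (\<Sum>b\<in>B. (l b * (b \<bullet> x)) *\<^sub>R b) $ i" for i
    proof -
      have "(R *v x) $ i = (\<Sum>j\<in>UNIV. \<Sum>b\<in>B. l b * b $ i * b $ j * x $ j)"
        by (simp add: R_def matrix_vector_mult_def sum_distrib_right)
      also have "\<dots> = (\<Sum>b\<in>B. \<Sum>j\<in>UNIV. l b * b $ i * b $ j * x $ j)" by (rule sum.swap)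
      also have "\<dots> = (\<Sum>b\<in>B. (l b * (b \<bullet> x)) *\<^sub>R b) $ i"
        by (simp add: inner_vec_def sum_distrib_left sum_distrib_right mult_ac)
      finally show ?thesis .
    qed
    then show ?thesis by (simp add: vec_eq_iff)
  qed
  have Rb: "R *v b = l b *\<^sub>R b" if "b \<in> B" for b
  proof -
    have "R *v b = (\<Sum>b'\<in>B. if b' = b then l b *\<^sub>R b else 0)"
      unfolding Rv using dotB that by (intro sum.cong) auto
    then show ?thesis using fin that by simp
  qed
  have "(R ** R) *v x = A *v x" for x
  proof -
    have "(R ** R) *v b = A *v b" if "b \<in> B" for b
    proof -
      have "(R ** R) *v b = (b \<bullet> (A *v b)) *\<^sub>R b"
        using that by (simp add: Rb matrix_vector_mult_scaleR l flip: matrix_vector_mul_assoc)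
      then show ?thesis using orthonormal_eigenvectors_eigenvalue[OF B that] by simp
    qed
    then have "(\<Sum>b\<in>B. (b \<bullet> x) *\<^sub>R ((R ** R) *v b)) = (\<Sum>b\<in>B. (b \<bullet> x) *\<^sub>R (A *v b))" by simp
    then have "(R ** R) *v (\<Sum>b\<in>B. (b \<bullet> x) *\<^sub>R b) = A *v (\<Sum>b\<in>B. (b \<bullet> x) *\<^sub>R b)"
      by (simp add: linear_sum[OF matrix_vector_mul_linear] matrix_vector_mult_scaleR)
    then show ?thesis by (simp add: sp)
  qed
  then have "R ** R = A" by (simp add: matrix_eq)
  moreover have "transpose R = R" by (simp add: R_def transpose_def mult_ac)
  moreover have "nonneg_definite R"
    unfolding nonneg_definite_def Rv inner_sum_right
  proof (intro allI sum_nonneg)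
    fix x b
    have "x \<bullet> ((l b * (b \<bullet> x)) *\<^sub>R b) = l b * (b \<bullet> x)\<^sup>2"
      by (simp add: inner_commute[of x b] power2_eq_square)
    moreover have "0 \<le> l b * (b \<bullet> x)\<^sup>2" using l(1) by simp
    ultimately show "0 \<le> x \<bullet> ((l b * (b \<bullet> x)) *\<^sub>R b)" by linarith
  qed
  ultimately show thesis using that by blast
qed

text \<open>For an eigenvector \<open>v\<close> of \<open>R - S\<close> with eigenvalue
  \<open>c\<close>, equality of the squares gives equal norms of \<open>R *v v\<close> and
  \<open>S *v v\<close>, that is
  \<open>c * (v \<bullet> (R *v v) + v \<bullet> (S *v v)) = 0\<close>. Both summands are
  nonnegative and their difference is \<open>c\<close>, so \<open>c = 0\<close>.\<close>

lemma matrix_sqrt_unique: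
  fixes R S :: "real ^ 'n ^ 'n"
  assumes R: "transpose R = R" "nonneg_definite R" and S: "transpose S = S" "nonneg_definite S"
    and eq: "R ** R = S ** S"
  shows "R = S"
proof -
  have D: "transpose (R - S) = R - S" using R(1) S(1) by (simp add: transpose_def vec_eq_iff)
  obtain B where B: "orthonormal_eigenvectors (R - S) B" and sp: "\<And>x. (\<Sum>b\<in>B. (b \<bullet> x) *\<^sub>R b) = x"
    using symmetric_matrix_eigenbasis[OF D] by blast
  have "(R - S) *v v = 0" if "v \<in> B" for v
  proof -
    define c where "c = v \<bullet> ((R - S) *v v)"
    have c: "R *v v - S *v v = c *\<^sub>R v"
      using orthonormal_eigenvectors_eigenvalue[OF B that] unfolding c_def
      by (metis matrix_vector_mult_diff_rdistrib)
    have "v \<bullet> (R *v (R *v v)) = v \<bullet> (S *v (S *v v))" by (simp add: matrix_vector_mul_assoc eq)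
    then have "(R *v v) \<bullet> (R *v v) = (S *v v) \<bullet> (S *v v)"
      by (simp add: dot_symmetric_matrix[OF R(1)] dot_symmetric_matrix[OF S(1)])
    then have "(R *v v - S *v v) \<bullet> (R *v v + S *v v) = 0"
      unfolding inner_diff_left inner_add_right
      using inner_commute[of "R *v v" "S *v v"] by linarith
    then have "c * (v \<bullet> (R *v v) + v \<bullet> (S *v v)) = 0" unfolding c by (simp add: inner_add_right distrib_left)
    moreover have "c = v \<bullet> (R *v v) - v \<bullet> (S *v v)"
      by (simp add: c_def inner_diff_right matrix_vector_mult_diff_rdistrib)
    moreover have "0 \<le> v \<bullet> (R *v v)" "0 \<le> v \<bullet> (S *v v)" using R S by (auto simp: nonneg_definite_def)
    ultimately have "c = 0" by (smt (verit) mult_eq_0_iff)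
    then show ?thesis using c by (simp add: matrix_vector_mult_diff_rdistrib)
  qed
  then have "(\<Sum>b\<in>B. (b \<bullet> x) *\<^sub>R ((R - S) *v b)) = 0" for x by simp
  then have "(R - S) *v (\<Sum>b\<in>B. (b \<bullet> x) *\<^sub>R b) = 0" for x
    by (simp only: linear_sum[OF matrix_vector_mul_linear] matrix_vector_mult_scaleR)
  then have "R *v x = S *v x" for x by (simp add: sp matrix_vector_mult_diff_rdistrib)
  then show ?thesis by (simp add: matrix_eq)
qed

lemma matrix_sqrt_properties:
  fixes A :: "real ^ 'n ^ 'n"
  assumes "transpose A = A" "nonneg_definite A"
  shows "transpose (matrix_sqrt A) = matrix_sqrt A" "nonneg_definite (matrix_sqrt A)"
    "matrix_sqrt A ** matrix_sqrt A = A"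
proof -
  obtain R where "transpose R = R \<and> nonneg_definite R \<and> R ** R = A"
    using matrix_sqrt_exists[OF assms] by blast
  then have "\<exists>!R. transpose R = R \<and> nonneg_definite R \<and> R ** R = A"
    by (intro ex1I[of _ R]) (auto intro: matrix_sqrt_unique)
  from theI'[OF this]
  show "transpose (matrix_sqrt A) = matrix_sqrt A" "nonneg_definite (matrix_sqrt A)"
    "matrix_sqrt A ** matrix_sqrt A = A"
    unfolding matrix_sqrt_def by blast+
qed

section \<open>Lindeberg's exchange argument\<close>

definition add_at :: "nat \<Rightarrow> (nat \<Rightarrow> 'v::ab_group_add) \<Rightarrow> 'v \<Rightarrow> nat \<Rightarrow> 'v" where
  "add_at j x v = x(j := x j + v)"

text \<open>All blocks are treated jointly: summand \<open>i\<close> moves only the coordinate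
  \<open>\<beta> i\<close> of a sequence, so the tuple of block sums is a single walk in sequence
  space, to which the exchange is applied once.\<close>

definition block_sum :: "(nat \<Rightarrow> nat) \<Rightarrow> (nat \<Rightarrow> 'a \<Rightarrow> 'v::ab_group_add) \<Rightarrow> nat \<Rightarrow> 'a \<Rightarrow> nat \<Rightarrow> 'v" where
  "block_sum \<beta> X n \<omega> j = (\<Sum>i | i < n \<and> \<beta> i = j. X i \<omega>)"

text \<open>The source of the commutation of the averaging operators below, also when both steps
  move the same coordinate.\<close>

lemma add_at_commute: "add_at i (add_at j x v) w = add_at j (add_at i x w) v"
  by (auto simp: add_at_def fun_eq_iff algebra_simps)

lemma block_sum_Suc: "block_sum \<beta> X (Suc n) \<omega> = add_at (\<beta> n) (block_sum \<beta> X n \<omega>) (X n \<omega>)"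
proof
  fix j
  have "{i. i < Suc n \<and> \<beta> i = j} = (if \<beta> n = j then insert n {i. i < n \<and> \<beta> i = j} else {i. i < n \<and> \<beta> i = j})"
    by (auto simp: less_Suc_eq)
  then show "block_sum \<beta> X (Suc n) \<omega> j = add_at (\<beta> n) (block_sum \<beta> X n \<omega>) (X n \<omega>) j"
    by (simp add: block_sum_def add_at_def add.commute)
qed

lemma measurable_add_at [measurable (raw)]:
  fixes f :: "'a \<Rightarrow> nat \<Rightarrow> 'v::euclidean_space"
  assumes [measurable]: "f \<in> borel_measurable M" "g \<in> borel_measurable M"
  shows "(\<lambda>x. add_at j (f x) (g x)) \<in> borel_measurable M"
proof (rule measurable_coordinatewise_then_product)
  fix i
  have [measurable]: "(\<lambda>x. f x i) \<in> borel_measurable M"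
    by (rule measurable_product_then_coordinatewise) fact
  have "(\<lambda>x. f x i + g x) \<in> borel_measurable M" by measurable
  then show "(\<lambda>x. add_at j (f x) (g x) i) \<in> borel_measurable M"
    by (cases "i = j") (simp_all add: add_at_def)
qed

lemma measurable_block_sum:
  fixes X :: "nat \<Rightarrow> 'a \<Rightarrow> 'v::euclidean_space"
  assumes "\<And>i. i < n \<Longrightarrow> X i \<in> borel_measurable M"
  shows "block_sum \<beta> X n \<in> borel_measurable M"
  by (rule measurable_coordinatewise_then_product)
    (use assms in \<open>auto simp: block_sum_def intro!: borel_measurable_sum\<close>)

text \<open>Conditioning on \<open>X\<close> in elementary form: independence turns the joint law
  into a product, and Fubini averages over the second variable first. The inner average runs over a
  second sample point of the same space.\<close>

lemma (in prob_space) expectation_indep_var: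
  fixes H :: "'b \<Rightarrow> 'b \<Rightarrow> real"
  assumes ind: "indep_var S X T Y" and H: "case_prod H \<in> borel_measurable (S \<Otimes>\<^sub>M T)" "\<And>x y. \<bar>H x y\<bar> \<le> B"
  shows "expectation (\<lambda>\<omega>. H (X \<omega>) (Y \<omega>)) = expectation (\<lambda>\<omega>. \<integral>\<omega>'. H (X \<omega>) (Y \<omega>') \<partial>M)"
proof -
  have X [measurable]: "random_variable S X" and Y [measurable]: "random_variable T Y"
    using ind indep_var_rv1 indep_var_rv2 by blast+
  interpret X: prob_space "distr M S X" by (rule prob_space_distr) fact
  interpret Y: prob_space "distr M T Y" by (rule prob_space_distr) fact
  interpret XY: pair_prob_space "distr M S X" "distr M T Y" ..
  note [measurable] = H(1)
  have "expectation (\<lambda>\<omega>. H (X \<omega>) (Y \<omega>)) = (\<integral>p. case_prod H p \<partial>distr M (S \<Otimes>\<^sub>M T) (\<lambda>\<omega>. (X \<omega>, Y \<omega>)))"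
    by (subst integral_distr) auto
  also have "\<dots> = (\<integral>p. case_prod H p \<partial>(distr M S X \<Otimes>\<^sub>M distr M T Y))"
    using ind by (simp add: indep_var_distribution_eq)
  also have "\<dots> = (\<integral>x. \<integral>y. H x y \<partial>distr M T Y \<partial>distr M S X)"
    by (subst XY.integral_fst'[symmetric]) (auto intro!: XY.P.integrable_const_bound[of _ B] H(2))
  also have "\<dots> = expectation (\<lambda>\<omega>. \<integral>y. H (X \<omega>) y \<partial>distr M T Y)"
    by (subst integral_distr) (auto intro!: Y.borel_measurable_lebesgue_integral)
  also have "\<dots> = expectation (\<lambda>\<omega>. \<integral>\<omega>'. H (X \<omega>) (Y \<omega>') \<partial>M)"
  proof (rule Bochner_Integration.integral_cong[OF refl])
    fix \<omega> assume "\<omega> \<in> space M"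
    then have [measurable]: "X \<omega> \<in> space S" using measurable_space[OF X] by blast
    show "(\<integral>y. H (X \<omega>) y \<partial>distr M T Y) = (\<integral>\<omega>'. H (X \<omega>) (Y \<omega>') \<partial>M)"
      by (rule integral_distr) auto
  qed
  finally show ?thesis .
qed

text \<open>\<^const>\<open>prob_space.indep_var\<close> relates variables with values in the same type only, so the last
  summand is turned into a constant sequence.\<close>

lemma (in prob_space) expectation_block_sum:
  fixes X :: "nat \<Rightarrow> 'a \<Rightarrow> 'v::euclidean_space" and H :: "(nat \<Rightarrow> 'v) \<Rightarrow> 'v \<Rightarrow> real"
  assumes ind: "indep_vars (\<lambda>_. borel) X {..<Suc n}"
    and H: "case_prod H \<in> borel_measurable (borel \<Otimes>\<^sub>M borel)" "\<And>x y. \<bar>H x y\<bar> \<le> B"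
  shows "expectation (\<lambda>\<omega>. H (block_sum \<beta> X n \<omega>) (X n \<omega>)) =
    expectation (\<lambda>\<omega>. \<integral>v. H (block_sum \<beta> X n \<omega>) v \<partial>distr M borel (X n))"
proof -
  have [measurable]: "X n \<in> borel_measurable M" using ind by (auto simp: indep_vars_def)
  note [measurable] = H(1)
  let ?F = "\<lambda>(f :: nat \<Rightarrow> 'v) j. \<Sum>i | i < n \<and> \<beta> i = j. f i"
  have "indep_var borel (?F \<circ> (\<lambda>\<omega>. restrict (\<lambda>i. X i \<omega>) {..<n}))
      borel ((\<lambda>f (j::nat). f n) \<circ> (\<lambda>\<omega>. restrict (\<lambda>i. X i \<omega>) {n}))"
  proof (rule indep_var_compose[OF indep_var_restrict[OF ind]])
    show "?F \<in> Pi\<^sub>M {..<n} (\<lambda>_. borel) \<rightarrow>\<^sub>M borel"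
      by (rule measurable_coordinatewise_then_product) (auto intro!: borel_measurable_sum measurable_component_singleton)
    show "(\<lambda>f (j::nat). f n) \<in> Pi\<^sub>M {n} (\<lambda>_. borel :: 'v measure) \<rightarrow>\<^sub>M borel"
      by (rule measurable_coordinatewise_then_product) (auto intro!: measurable_component_singleton)
  qed auto
  moreover have "?F \<circ> (\<lambda>\<omega>. restrict (\<lambda>i. X i \<omega>) {..<n}) = block_sum \<beta> X n"
    by (auto simp: block_sum_def fun_eq_iff intro!: sum.cong)
  ultimately have ind': "indep_var borel (block_sum \<beta> X n) borel (\<lambda>\<omega> j. X n \<omega>)" by (simp add: comp_def)
  have [measurable]: "(\<lambda>y :: nat \<Rightarrow> 'v. y 0) \<in> borel_measurable borel"
    by (rule measurable_product_coordinates)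
  have "(\<lambda>(x, y). H x (y 0)) \<in> borel_measurable (borel \<Otimes>\<^sub>M (borel :: (nat \<Rightarrow> 'v) measure))" by measurable
  from expectation_indep_var[OF ind' this H(2)]
  have eq: "expectation (\<lambda>\<omega>. H (block_sum \<beta> X n \<omega>) (X n \<omega>)) =
    expectation (\<lambda>\<omega>. \<integral>\<omega>'. H (block_sum \<beta> X n \<omega>) (X n \<omega>') \<partial>M)" .
  have "(\<integral>\<omega>'. H x (X n \<omega>') \<partial>M) = (\<integral>v. H x v \<partial>distr M borel (X n))" for x
    by (subst integral_distr) auto
  with eq show ?thesis by simp
qed

lemma measurable_integral_add_at:
  fixes H :: "(nat \<Rightarrow> 'v::euclidean_space) \<Rightarrow> real"
  assumes [measurable]: "H \<in> borel_measurable borel" and "prob_space P" and [simp]: "sets P = sets borel"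
  shows "(\<lambda>x. \<integral>v. H (add_at j x v) \<partial>P) \<in> borel_measurable borel"
proof -
  interpret prob_space P by fact
  have [measurable_cong]: "sets P = sets borel" by simp
  show ?thesis by measurable
qed

lemma (in prob_space) abs_integral_le_const:
  fixes f :: "'a \<Rightarrow> real"
  assumes "f \<in> borel_measurable M" "\<And>x. \<bar>f x\<bar> \<le> B"
  shows "\<bar>\<integral>x. f x \<partial>M\<bar> \<le> B"
proof -
  have "0 \<le> B" using assms(2) abs_ge_zero order_trans by blast
  have "\<bar>\<integral>x. f x \<partial>M\<bar> \<le> (\<integral>x. \<bar>f x\<bar> \<partial>M)" by (rule integral_abs_bound)
  also have "\<dots> \<le> (\<integral>x. B \<partial>M)"
    using assms \<open>0 \<le> B\<close> by (intro integral_mono integrable_abs integrable_const_bound[of _ B]) auto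
  finally show ?thesis by (simp add: prob_space)
qed

text \<open>Trotter's form of the Lindeberg argument: the averaging operators of the single steps
  commute and are contractions, so the errors of the individual exchanges add up.\<close>

lemma block_sum_exchange:
  fixes X :: "nat \<Rightarrow> 'a \<Rightarrow> 'v::euclidean_space" and X' :: "nat \<Rightarrow> 'b \<Rightarrow> 'v"
  assumes M: "prob_space M" and N: "prob_space N"
    and X: "prob_space.indep_vars M (\<lambda>_. borel) X {..<n}"
    and X': "prob_space.indep_vars N (\<lambda>_. borel) X' {..<n}"
    and H: "H \<in> borel_measurable borel" "\<And>x. \<bar>H x\<bar> \<le> (B::real)"
    and e: "\<And>i x. i < n \<Longrightarrow> \<bar>(\<integral>v. H (add_at (\<beta> i) x v) \<partial>distr M borel (X i)) -
      (\<integral>v. H (add_at (\<beta> i) x v) \<partial>distr N borel (X' i))\<bar> \<le> e i"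
  shows "\<bar>(\<integral>\<omega>. H (block_sum \<beta> X n \<omega>) \<partial>M) - (\<integral>\<omega>. H (block_sum \<beta> X' n \<omega>) \<partial>N)\<bar> \<le> (\<Sum>i<n. e i)"
  using X X' H e
proof (induction n arbitrary: H)
  case 0
  interpret M: prob_space M by fact
  interpret N: prob_space N by fact
  show ?case by (simp add: block_sum_def M.prob_space N.prob_space)
next
  case (Suc n)
  interpret M: prob_space M by fact
  interpret N: prob_space N by fact
  note [measurable] = Suc.prems(3)
  have rvX [measurable]: "X i \<in> borel_measurable M" and rvX' [measurable]: "X' i \<in> borel_measurable N"
    if "i < Suc n" for i
    using Suc.prems(1,2) that by (auto simp: M.indep_vars_def N.indep_vars_def)
  note [measurable] = rvX[OF lessI] rvX'[OF lessI]
  let ?P = "\<lambda>i. distr M borel (X i)" and ?P' = "\<lambda>i. distr N borel (X' i)"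
  have P: "prob_space (?P i)" and P': "prob_space (?P' i)" if "i < Suc n" for i
    using that by (auto intro!: M.prob_space_distr N.prob_space_distr)
  let ?h = "\<lambda>x. \<integral>v. H (add_at (\<beta> n) x v) \<partial>?P n" and ?h' = "\<lambda>x. \<integral>v. H (add_at (\<beta> n) x v) \<partial>?P' n"
  have meas: "?h \<in> borel_measurable borel" "?h' \<in> borel_measurable borel"
    using measurable_integral_add_at[OF Suc.prems(3) P] measurable_integral_add_at[OF Suc.prems(3) P'] by auto
  have bnd: "\<bar>?h x\<bar> \<le> B" "\<bar>?h' x\<bar> \<le> B" for x
    using P P' Suc.prems(4) by (auto intro!: prob_space.abs_integral_le_const)
  have pair: "(\<lambda>(x, v). H (add_at (\<beta> n) x v)) \<in> borel_measurable (borel \<Otimes>\<^sub>M borel)" by measurable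
  have [measurable]: "block_sum \<beta> X n \<in> borel_measurable M" "block_sum \<beta> X' n \<in> borel_measurable N"
    by (auto intro!: measurable_block_sum)
  have 1: "(\<integral>\<omega>. H (block_sum \<beta> X (Suc n) \<omega>) \<partial>M) = (\<integral>\<omega>. ?h (block_sum \<beta> X n \<omega>) \<partial>M)"
    unfolding block_sum_Suc
    by (rule M.expectation_block_sum[OF Suc.prems(1) pair Suc.prems(4)])
  have 2: "(\<integral>\<omega>. H (block_sum \<beta> X' (Suc n) \<omega>) \<partial>N) = (\<integral>\<omega>. ?h' (block_sum \<beta> X' n \<omega>) \<partial>N)"
    unfolding block_sum_Suc
    by (rule N.expectation_block_sum[OF Suc.prems(2) pair Suc.prems(4)])
  \<comment> \<open>Only the law of the last summand changes here; the first \<open>n\<close>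
    summands still come from \<open>M\<close>.\<close>
  have "\<bar>(\<integral>\<omega>. ?h (block_sum \<beta> X n \<omega>) \<partial>M) - (\<integral>\<omega>. ?h' (block_sum \<beta> X n \<omega>) \<partial>M)\<bar>
      = \<bar>\<integral>\<omega>. ?h (block_sum \<beta> X n \<omega>) - ?h' (block_sum \<beta> X n \<omega>) \<partial>M\<bar>"
    using bnd meas by (subst Bochner_Integration.integral_diff) (auto intro!: M.integrable_const_bound[of _ B])
  also have "\<dots> \<le> e n"
    using meas Suc.prems(5)[of n] by (intro M.abs_integral_le_const) auto
  finally have 3: "\<bar>(\<integral>\<omega>. ?h (block_sum \<beta> X n \<omega>) \<partial>M) - (\<integral>\<omega>. ?h' (block_sum \<beta> X n \<omega>) \<partial>M)\<bar> \<le> e n" .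
  \<comment> \<open>The induction hypothesis is applied to \<open>?h'\<close>, the test function
    already averaged over the replaced last step; this is why the induction generalises
    \<open>H\<close>.\<close>
  have 4: "\<bar>(\<integral>\<omega>. ?h' (block_sum \<beta> X n \<omega>) \<partial>M) - (\<integral>\<omega>. ?h' (block_sum \<beta> X' n \<omega>) \<partial>N)\<bar> \<le> (\<Sum>i<n. e i)"
  proof (rule Suc.IH)
    fix i x assume i: "i < n"
    then have i': "i < Suc n" by simp
    interpret Pi: prob_space "?P i" by (rule P[OF i'])
    interpret Pi': prob_space "?P' i" by (rule P'[OF i'])
    interpret Pn': prob_space "?P' n" by (rule P'[OF lessI])
    interpret A: pair_prob_space "?P i" "?P' n" ..
    interpret A': pair_prob_space "?P' i" "?P' n" ..
    \<comment> \<open>Fubini and \<open>add_at_commute\<close> move the average over step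
      \<open>n\<close> outside. The two averages over step \<open>i\<close> then differ by an
      average of differences of the original \<open>H\<close>, each bounded by
      \<open>e i\<close>.\<close>
    have swap: "(\<integral>v. ?h' (add_at (\<beta> i) x v) \<partial>?P i) = (\<integral>w. \<integral>v. H (add_at (\<beta> i) (add_at (\<beta> n) x w) v) \<partial>?P i \<partial>?P' n)"
      by (subst A.Fubini_integral[symmetric])
        (auto intro!: A.P.integrable_const_bound[of _ B] Suc.prems(4) simp: add_at_commute[of "\<beta> i" "\<beta> n"] split_beta')
    have swap': "(\<integral>v. ?h' (add_at (\<beta> i) x v) \<partial>?P' i) = (\<integral>w. \<integral>v. H (add_at (\<beta> i) (add_at (\<beta> n) x w) v) \<partial>?P' i \<partial>?P' n)"
      by (subst A'.Fubini_integral[symmetric])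
        (auto intro!: A'.P.integrable_const_bound[of _ B] Suc.prems(4) simp: add_at_commute[of "\<beta> i" "\<beta> n"] split_beta')
    let ?f = "\<lambda>y. \<integral>v. H (add_at (\<beta> i) y v) \<partial>?P i" and ?f' = "\<lambda>y. \<integral>v. H (add_at (\<beta> i) y v) \<partial>?P' i"
    have fm [measurable]: "?f \<in> borel_measurable borel" "?f' \<in> borel_measurable borel"
      using measurable_integral_add_at[OF Suc.prems(3) P[OF i']] measurable_integral_add_at[OF Suc.prems(3) P'[OF i']] by auto
    have fb: "\<bar>?f y\<bar> \<le> B" "\<bar>?f' y\<bar> \<le> B" for y
      using P P' i' Suc.prems(4) by (auto intro!: prob_space.abs_integral_le_const)
    have "(\<integral>v. ?h' (add_at (\<beta> i) x v) \<partial>?P i) - (\<integral>v. ?h' (add_at (\<beta> i) x v) \<partial>?P' i) =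
        (\<integral>w. ?f (add_at (\<beta> n) x w) - ?f' (add_at (\<beta> n) x w) \<partial>?P' n)"
      unfolding swap swap' using fb
      by (subst Bochner_Integration.integral_diff) (auto intro!: Pn'.integrable_const_bound[of _ B])
    also have "\<bar>\<dots>\<bar> \<le> e i"
      using Suc.prems(5)[OF i'] by (intro Pn'.abs_integral_le_const) auto
    finally show "\<bar>(\<integral>v. ?h' (add_at (\<beta> i) x v) \<partial>?P i) - (\<integral>v. ?h' (add_at (\<beta> i) x v) \<partial>?P' i)\<bar> \<le> e i" .
  next
    show "M.indep_vars (\<lambda>_. borel) X {..<n}" "N.indep_vars (\<lambda>_. borel) X' {..<n}"
      using Suc.prems(1,2) by (auto intro: M.indep_vars_subset N.indep_vars_subset)
  qed (use meas bnd in auto)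
  show ?case using 1 2 3 4 by simp
qed

section \<open>Second-order expansions with a remainder suited to second moments\<close>

abbreviation capped :: "'v::real_normed_vector \<Rightarrow> real" where
  "capped v \<equiv> min (norm v ^ 2) (norm v ^ 3)"

text \<open>This is \<open>n\<close> times \<open>capped (v / sqrt n)\<close>, so the errors of
  \<open>n\<close> steps scaled by \<open>sqrt n\<close> add up to its expectation.\<close>

abbreviation capped_at :: "nat \<Rightarrow> 'v::real_normed_vector \<Rightarrow> real" where
  "capped_at n v \<equiv> min (norm v ^ 2) (norm v ^ 3 / sqrt (real n))"

text \<open>\<open>g\<close> plays the part of the gradient at \<open>0\<close> and \<open>L\<close>
  that of half the Hessian; \<open>L\<close> may be nonsymmetric. Asking for mere existence of an
  expansion with bounded coefficients makes closure under sums and products a computation with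
  polynomials instead of derivatives.\<close>

definition taylor2 :: "real \<Rightarrow> ('v::euclidean_space \<Rightarrow> real) \<Rightarrow> bool" where
  "taylor2 C h \<longleftrightarrow> \<bar>h 0\<bar> \<le> C \<and> (\<exists>g L. norm g \<le> C \<and> linear L \<and> (\<forall>v. norm (L v) \<le> C * norm v) \<and>
     (\<forall>v. norm v \<le> 1 \<longrightarrow> \<bar>h v - h 0 - g \<bullet> v - v \<bullet> L v\<bar> \<le> C * norm v ^ 3))"

lemma taylor2_nonneg: "taylor2 C h \<Longrightarrow> 0 \<le> C"
  by (auto simp: taylor2_def)

lemma taylor2_mono:
  assumes "taylor2 C h" "C \<le> C'"
  shows "taylor2 C' h"
proof -
  obtain g L where *: "\<bar>h 0\<bar> \<le> C" "norm g \<le> C" "linear L" "\<And>v. norm (L v) \<le> C * norm v"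
     "\<And>v. norm v \<le> 1 \<Longrightarrow> \<bar>h v - h 0 - g \<bullet> v - v \<bullet> L v\<bar> \<le> C * norm v ^ 3"
    using assms(1) unfolding taylor2_def by blast
  have "C * norm v \<le> C' * norm v" "C * norm v ^ 3 \<le> C' * norm v ^ 3" for v :: 'a
    using assms(2) by (auto intro!: mult_right_mono)
  then have "norm (L v) \<le> C' * norm v"
    "norm v \<le> 1 \<Longrightarrow> \<bar>h v - h 0 - g \<bullet> v - v \<bullet> L v\<bar> \<le> C' * norm v ^ 3" for v
    using *(4,5) order_trans by blast+
  then show ?thesis
    unfolding taylor2_def using *(1-3) assms(2) by (intro conjI exI[of _ g] exI[of _ L]) auto
qed

lemma taylor2_add:
  assumes "taylor2 C h" "taylor2 C k"
  shows "taylor2 (2 * C) (\<lambda>v. h v + k v)"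
proof -
  obtain g L where h: "\<bar>h 0\<bar> \<le> C" "norm g \<le> C" "linear L" "\<And>v. norm (L v) \<le> C * norm v"
     "\<And>v. norm v \<le> 1 \<Longrightarrow> \<bar>h v - h 0 - g \<bullet> v - v \<bullet> L v\<bar> \<le> C * norm v ^ 3"
    using assms(1) unfolding taylor2_def by blast
  obtain g' L' where k: "\<bar>k 0\<bar> \<le> C" "norm g' \<le> C" "linear L'" "\<And>v. norm (L' v) \<le> C * norm v"
     "\<And>v. norm v \<le> 1 \<Longrightarrow> \<bar>k v - k 0 - g' \<bullet> v - v \<bullet> L' v\<bar> \<le> C * norm v ^ 3"
    using assms(2) unfolding taylor2_def by blast
  show ?thesis unfolding taylor2_def
  proof (intro conjI exI[of _ "g + g'"] exI[of _ "\<lambda>v. L v + L' v"] allI impI)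
    show "\<bar>h 0 + k 0\<bar> \<le> 2 * C" using h(1) k(1) by linarith
    show "norm (g + g') \<le> 2 * C" using h(2) k(2) norm_triangle_ineq[of g g'] by linarith
    show "linear (\<lambda>v. L v + L' v)" using h(3) k(3) by (rule linear_compose_add)
    show "norm (L v + L' v) \<le> 2 * C * norm v" for v
      using h(4)[of v] k(4)[of v] norm_triangle_ineq[of "L v" "L' v"] by linarith
    show "\<bar>h v + k v - (h 0 + k 0) - (g + g') \<bullet> v - v \<bullet> (L v + L' v)\<bar> \<le> 2 * C * norm v ^ 3"
      if "norm v \<le> 1" for v
      using h(5)[OF that] k(5)[OF that] unfolding inner_add_left inner_add_right by linarith
  qed
qed

text \<open>The letters \<open>a\<close>, \<open>p\<close>, \<open>q\<close>, \<open>r\<close> stand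
  for the terms of order \<open>0\<close> to \<open>3\<close> in \<open>s\<close>. The products of
  total order at most \<open>2\<close> are subtracted, so each remaining one is of order at least
  \<open>3\<close>; grouped as in \<open>split\<close> they cost \<open>2 + 3 + 4 + 1 = 10\<close>
  times \<open>C^2 * s^3\<close>.\<close>

lemma remainder_product_bound:
  fixes a p q r a' p' q' r' s C :: real
  assumes s: "0 \<le> s" "s \<le> 1" and "\<bar>a\<bar> \<le> C" "\<bar>p\<bar> \<le> C * s" "\<bar>q\<bar> \<le> C * s ^ 2" "\<bar>r\<bar> \<le> C * s ^ 3"
    and "\<bar>a'\<bar> \<le> C" "\<bar>p'\<bar> \<le> C * s" "\<bar>q'\<bar> \<le> C * s ^ 2" "\<bar>r'\<bar> \<le> C * s ^ 3"
  shows "\<bar>(a + p + q + r) * (a' + p' + q' + r') - a * a' - (a * p' + a' * p) - (a * q' + a' * q + p * p')\<bar>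
    \<le> 10 * C\<^sup>2 * s ^ 3"
proof -
  have C: "0 \<le> C" using assms(3) by linarith
  have pw: "s ^ 3 \<le> s ^ 2" "s ^ 2 \<le> s ^ 1" "s ^ 1 \<le> s ^ 0"
    using power_decreasing[of 2 3 s] power_decreasing[of 1 2 s] power_decreasing[of 0 1 s] s by simp_all
  have Cpw: "C * s ^ 3 \<le> C * s ^ 2" "C * s ^ 2 \<le> C * s" "C * s \<le> C"
    using mult_left_mono[OF pw(1) C] mult_left_mono[OF pw(2) C] mult_left_mono[OF pw(3) C] by simp_all
  have split: "(a + p + q + r) * (a' + p' + q' + r') - a * a' - (a * p' + a' * p) - (a * q' + a' * q + p * p')
      = p * (q' + r') + q * (p' + q' + r') + r * (a' + p' + q' + r') + a * r'"
    by (simp add: algebra_simps)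
  have nn: "0 \<le> C * s" "0 \<le> C * s ^ 2" "0 \<le> C * s ^ 3" using C s by auto
  have "\<bar>q' + r'\<bar> \<le> 2 * C * s ^ 2" using assms(9,10) Cpw(1) by linarith
  then have 1: "\<bar>p * (q' + r')\<bar> \<le> (C * s) * (2 * C * s ^ 2)"
    unfolding abs_mult using assms(4) nn(1) by (intro mult_mono abs_ge_zero)
  have "\<bar>p' + q' + r'\<bar> \<le> 3 * C * s" using assms(8-10) Cpw by linarith
  then have 2: "\<bar>q * (p' + q' + r')\<bar> \<le> (C * s ^ 2) * (3 * C * s)"
    unfolding abs_mult using assms(5) nn(2) by (intro mult_mono abs_ge_zero)
  have "\<bar>a' + p' + q' + r'\<bar> \<le> 4 * C" using assms(7-10) Cpw by linarith
  then have 3: "\<bar>r * (a' + p' + q' + r')\<bar> \<le> (C * s ^ 3) * (4 * C)"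
    unfolding abs_mult using assms(6) nn(3) by (intro mult_mono abs_ge_zero)
  have 4: "\<bar>a * r'\<bar> \<le> C * (C * s ^ 3)"
    unfolding abs_mult using assms(3,10) C by (intro mult_mono abs_ge_zero)
  have "10 * C\<^sup>2 * s ^ 3 = (C * s) * (2 * C * s ^ 2) + (C * s ^ 2) * (3 * C * s) + (C * s ^ 3) * (4 * C) + C * (C * s ^ 3)"
    by (simp add: power2_eq_square power3_eq_cube)
  then show ?thesis unfolding split using 1 2 3 4 by linarith
qed

lemma taylor2_mult:
  assumes "taylor2 C h" "taylor2 C k"
  shows "taylor2 (10 * C\<^sup>2) (\<lambda>v. h v * k v)"
proof -
  obtain g L where h: "\<bar>h 0\<bar> \<le> C" "norm g \<le> C" "linear L" "\<And>v. norm (L v) \<le> C * norm v"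
     "\<And>v. norm v \<le> 1 \<Longrightarrow> \<bar>h v - h 0 - g \<bullet> v - v \<bullet> L v\<bar> \<le> C * norm v ^ 3"
    using assms(1) unfolding taylor2_def by blast
  obtain g' L' where k: "\<bar>k 0\<bar> \<le> C" "norm g' \<le> C" "linear L'" "\<And>v. norm (L' v) \<le> C * norm v"
     "\<And>v. norm v \<le> 1 \<Longrightarrow> \<bar>k v - k 0 - g' \<bullet> v - v \<bullet> L' v\<bar> \<le> C * norm v ^ 3"
    using assms(2) unfolding taylor2_def by blast
  have C: "0 \<le> C" using h(1) by linarith
  have C2: "C * C \<le> 10 * C\<^sup>2" "C * C + C * C + C * C \<le> 10 * C\<^sup>2" "C * C + C * C \<le> 10 * C\<^sup>2"
    using C by (auto simp: power2_eq_square)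
  \<comment> \<open>Leibniz' rule. The summand \<open>(g' \<bullet> v) *\<^sub>R g\<close> of
    \<open>?L\<close> represents the product of the two linear terms.\<close>
  let ?g = "h 0 *\<^sub>R g' + k 0 *\<^sub>R g" and ?L = "\<lambda>v. h 0 *\<^sub>R L' v + k 0 *\<^sub>R L v + (g' \<bullet> v) *\<^sub>R g"
  show ?thesis unfolding taylor2_def
  proof (intro conjI exI[of _ ?g] exI[of _ ?L] allI impI)
    show "\<bar>h 0 * k 0\<bar> \<le> 10 * C\<^sup>2"
      using mult_mono[OF h(1) k(1)] C C2(1) by (simp add: abs_mult)
    have "norm ?g \<le> norm (h 0 *\<^sub>R g') + norm (k 0 *\<^sub>R g)" by (rule norm_triangle_ineq)
    also have "\<dots> \<le> C * C + C * C"
      unfolding norm_scaleR using h k C by (intro add_mono mult_mono) auto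
    finally show "norm ?g \<le> 10 * C\<^sup>2" using C2 by linarith
    show "linear ?L"
      using h(3) k(3) by (intro linearI) (simp_all add: linear_add linear_scale algebra_simps inner_add_right)
    show "norm (?L v) \<le> 10 * C\<^sup>2 * norm v" for v
    proof -
      have gv: "\<bar>g' \<bullet> v\<bar> \<le> C * norm v"
        by (rule order_trans[OF Cauchy_Schwarz_ineq2]) (use k(2) in \<open>auto intro: mult_right_mono\<close>)
      have "norm (?L v) \<le> norm (h 0 *\<^sub>R L' v) + norm (k 0 *\<^sub>R L v) + norm ((g' \<bullet> v) *\<^sub>R g)"
        by (intro norm_triangle_le order.refl add_right_mono norm_triangle_ineq)
      also have "\<dots> \<le> C * (C * norm v) + C * (C * norm v) + (C * norm v) * C"
        unfolding norm_scaleR using h(1,2,4) k(1,4) C gv by (intro add_mono mult_mono) auto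
      also have "\<dots> = (C * C + C * C + C * C) * norm v" by (simp add: algebra_simps)
      also have "\<dots> \<le> 10 * C\<^sup>2 * norm v" using C2 by (intro mult_right_mono) auto
      finally show ?thesis .
    qed
    show "\<bar>h v * k v - h 0 * k 0 - ?g \<bullet> v - v \<bullet> ?L v\<bar> \<le> 10 * C\<^sup>2 * norm v ^ 3" if v: "norm v \<le> 1" for v
    proof -
      let ?r = "h v - h 0 - g \<bullet> v - v \<bullet> L v" and ?r' = "k v - k 0 - g' \<bullet> v - v \<bullet> L' v"
      have b: "\<bar>g \<bullet> v\<bar> \<le> C * norm v" "\<bar>g' \<bullet> v\<bar> \<le> C * norm v"
        using h(2) k(2) by (auto intro!: order_trans[OF Cauchy_Schwarz_ineq2] mult_right_mono)
      have c: "\<bar>v \<bullet> L v\<bar> \<le> C * norm v ^ 2" "\<bar>v \<bullet> L' v\<bar> \<le> C * norm v ^ 2"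
        using mult_left_mono[OF h(4)[of v], of "norm v"] mult_left_mono[OF k(4)[of v], of "norm v"]
          Cauchy_Schwarz_ineq2[of v "L v"] Cauchy_Schwarz_ineq2[of v "L' v"]
        by (simp_all add: power2_eq_square mult_ac)
      have eh: "h 0 + g \<bullet> v + v \<bullet> L v + ?r = h v" and ek: "k 0 + g' \<bullet> v + v \<bullet> L' v + ?r' = k v"
        by simp_all
      have e1: "?g \<bullet> v = h 0 * (g' \<bullet> v) + k 0 * (g \<bullet> v)" by (simp add: inner_add_left)
      have e2: "v \<bullet> ?L v = h 0 * (v \<bullet> L' v) + k 0 * (v \<bullet> L v) + (g \<bullet> v) * (g' \<bullet> v)"
        by (simp add: inner_add_right inner_commute[of v g])
      have "\<bar>(h 0 + g \<bullet> v + v \<bullet> L v + ?r) * (k 0 + g' \<bullet> v + v \<bullet> L' v + ?r') - h 0 * k 0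
          - (h 0 * (g' \<bullet> v) + k 0 * (g \<bullet> v)) - (h 0 * (v \<bullet> L' v) + k 0 * (v \<bullet> L v) + (g \<bullet> v) * (g' \<bullet> v))\<bar>
        \<le> 10 * C\<^sup>2 * norm v ^ 3"
        by (rule remainder_product_bound[OF norm_ge_zero v h(1) b(1) c(1) h(5)[OF v] k(1) b(2) c(2) k(5)[OF v]])
      then show ?thesis unfolding eh ek e1 e2 .
    qed
  qed
qed

lemma taylor2_const: "taylor2 \<bar>c\<bar> (\<lambda>_. c)"
  unfolding taylor2_def by (auto intro!: exI[of _ 0] exI[of _ "\<lambda>_. 0"] simp: linear_iff)

text \<open>Inside the unit ball the remainder is cubic. Outside, the terms \<open>h v\<close>,
  \<open>h 0\<close>, \<open>g \<bullet> v\<close> and \<open>v \<bullet> L v\<close> are each at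
  most \<open>C * norm v ^ 2\<close>, whence the factor \<open>4\<close>. The quadratic growth for
  large \<open>v\<close> is what makes finite second moments sufficient.\<close>

lemma taylor2_bound:
  assumes t: "taylor2 C h" and b: "\<And>v. \<bar>h v\<bar> \<le> C"
  obtains g L where "linear L"
    "\<And>v. \<bar>h v - h 0 - g \<bullet> v - v \<bullet> L v\<bar> \<le> 4 * C * capped v"
proof -
  obtain g L where h: "norm g \<le> C" "linear L" "\<And>v. norm (L v) \<le> C * norm v"
     "\<And>v. norm v \<le> 1 \<Longrightarrow> \<bar>h v - h 0 - g \<bullet> v - v \<bullet> L v\<bar> \<le> C * norm v ^ 3"
    using t unfolding taylor2_def by blast
  have C: "0 \<le> C" by (rule taylor2_nonneg[OF t])
  have "\<bar>h v - h 0 - g \<bullet> v - v \<bullet> L v\<bar> \<le> 4 * C * capped v" for v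
  proof (cases "norm v \<le> 1")
    case True
    then have "norm v ^ 3 \<le> norm v ^ 2" by (intro power_decreasing) auto
    then have "capped v = norm v ^ 3" by simp
    moreover have "0 \<le> C * norm v ^ 3" using C by simp
    ultimately show ?thesis using h(4)[OF True] by simp
  next
    case False
    then have n: "1 \<le> norm v" by simp
    then have "norm v ^ 2 \<le> norm v ^ 3" by (intro power_increasing) auto
    then have m: "capped v = norm v ^ 2" by simp
    have "\<bar>g \<bullet> v\<bar> \<le> C * norm v"
      using h(1) by (auto intro!: order_trans[OF Cauchy_Schwarz_ineq2] mult_right_mono)
    moreover have "\<bar>v \<bullet> L v\<bar> \<le> C * norm v ^ 2"
      using mult_left_mono[OF h(3)[of v], of "norm v"] Cauchy_Schwarz_ineq2[of v "L v"]
      by (simp add: power2_eq_square mult_ac)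
    moreover have "norm v \<le> norm v ^ 2" "1 \<le> norm v ^ 2" using n by (auto simp: self_le_power)
    then have "C * norm v \<le> C * norm v ^ 2" "C * 1 \<le> C * norm v ^ 2"
      using C mult_left_mono by blast+
    ultimately show ?thesis unfolding m using b[of v] b[of 0] by linarith
  qed
  then show thesis using that h(2) by blast
qed

lemma inner_linear_expand:
  fixes v :: "'v::euclidean_space"
  assumes "linear L"
  shows "v \<bullet> L v = (\<Sum>a\<in>Basis. \<Sum>b\<in>Basis. (a \<bullet> L b) * ((v \<bullet> a) * (v \<bullet> b)))"
proof -
  have "L v = L (\<Sum>b\<in>Basis. (v \<bullet> b) *\<^sub>R b)" by (simp add: euclidean_representation)
  also have "\<dots> = (\<Sum>b\<in>Basis. (v \<bullet> b) *\<^sub>R L b)" using assms by (simp add: linear_sum linear_scale)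
  finally have L: "L v = (\<Sum>b\<in>Basis. (v \<bullet> b) *\<^sub>R L b)" .
  have "v \<bullet> L v = (\<Sum>a\<in>Basis. (v \<bullet> a) * (L v \<bullet> a))" by (rule euclidean_inner)
  also have "\<dots> = (\<Sum>a\<in>Basis. (v \<bullet> a) * (\<Sum>b\<in>Basis. (v \<bullet> b) * (L b \<bullet> a)))"
    by (simp add: L inner_sum_left)
  finally show ?thesis by (simp add: sum_distrib_left inner_commute mult_ac)
qed

lemma le_one_plus_square: "(x :: real) \<le> 1 + x\<^sup>2"
proof -
  have "2 * x \<le> 1 + x\<^sup>2" using zero_le_power2[of "x - 1"] by (simp add: power2_diff)
  then show ?thesis using zero_le_power2[of x] by linarith
qed

lemma (in finite_measure) integrable_inner_of_square:
  fixes X :: "'a \<Rightarrow> 'v::euclidean_space"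
  assumes [measurable]: "X \<in> borel_measurable M" and X2: "integrable M (\<lambda>\<omega>. norm (X \<omega>) ^ 2)"
  shows "integrable M (\<lambda>\<omega>. X \<omega> \<bullet> w)" "integrable M (\<lambda>\<omega>. (X \<omega> \<bullet> w) * (X \<omega> \<bullet> w'))"
    "integrable M (\<lambda>\<omega>. capped (X \<omega>))"
proof -
  show "integrable M (\<lambda>\<omega>. X \<omega> \<bullet> w)"
  proof (rule Bochner_Integration.integrable_bound)
    show "integrable M (\<lambda>\<omega>. (1 + norm (X \<omega>) ^ 2) * norm w)" using X2 by auto
    have "norm x * norm w \<le> (1 + norm x ^ 2) * norm w" for x :: 'v
      by (intro mult_right_mono le_one_plus_square norm_ge_zero)
    then have "\<bar>x \<bullet> w\<bar> \<le> (1 + norm x ^ 2) * norm w" for x :: 'v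
      using Cauchy_Schwarz_ineq2[of x w] order_trans by blast
    then show "AE \<omega> in M. norm (X \<omega> \<bullet> w) \<le> norm ((1 + norm (X \<omega>) ^ 2) * norm w)"
      by (auto intro!: AE_I2 order_trans[OF _ abs_ge_self])
  qed measurable
  show "integrable M (\<lambda>\<omega>. (X \<omega> \<bullet> w) * (X \<omega> \<bullet> w'))"
  proof (rule Bochner_Integration.integrable_bound)
    show "integrable M (\<lambda>\<omega>. norm (X \<omega>) ^ 2 * (norm w * norm w'))" using X2 by auto
    have "\<bar>(x \<bullet> w) * (x \<bullet> w')\<bar> \<le> (norm x * norm w) * (norm x * norm w')" for x :: 'v
      unfolding abs_mult by (intro mult_mono Cauchy_Schwarz_ineq2) auto
    moreover have "(norm x * norm w) * (norm x * norm w') = norm x ^ 2 * (norm w * norm w')" for x :: 'v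
      by (simp add: power2_eq_square)
    ultimately have "\<bar>(x \<bullet> w) * (x \<bullet> w')\<bar> \<le> norm x ^ 2 * (norm w * norm w')" for x :: 'v
      by simp
    then show "AE \<omega> in M. norm ((X \<omega> \<bullet> w) * (X \<omega> \<bullet> w')) \<le> norm (norm (X \<omega>) ^ 2 * (norm w * norm w'))"
      by (auto intro!: AE_I2)
  qed measurable
  show "integrable M (\<lambda>\<omega>. capped (X \<omega>))"
    by (rule Bochner_Integration.integrable_bound[OF X2]) auto
qed

text \<open>The expected second-order polynomial depends on the first two moments alone, so it is
  the same for both variables and only the two remainders survive. \<open>T\<close> takes the
  moments as arguments in order to express both the pointwise polynomial and its
  expectation.\<close>

lemma lindeberg_step:
  fixes X :: "'a \<Rightarrow> 'v::euclidean_space" and X' :: "'b \<Rightarrow> 'v"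
  assumes M: "prob_space M" and N: "prob_space N"
    and X [measurable]: "X \<in> borel_measurable M" and X' [measurable]: "X' \<in> borel_measurable N"
    and X2: "integrable M (\<lambda>\<omega>. norm (X \<omega>) ^ 2)" and X2': "integrable N (\<lambda>\<omega>. norm (X' \<omega>) ^ 2)"
    and m1: "\<And>a. a \<in> Basis \<Longrightarrow> (\<integral>\<omega>. X \<omega> \<bullet> a \<partial>M) = (\<integral>\<omega>. X' \<omega> \<bullet> a \<partial>N)"
    and m2: "\<And>a b. a \<in> Basis \<Longrightarrow> b \<in> Basis \<Longrightarrow>
      (\<integral>\<omega>. (X \<omega> \<bullet> a) * (X \<omega> \<bullet> b) \<partial>M) = (\<integral>\<omega>. (X' \<omega> \<bullet> a) * (X' \<omega> \<bullet> b) \<partial>N)"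
    and t: "taylor2 C h" and b: "\<And>v. \<bar>h v\<bar> \<le> C" and [measurable]: "h \<in> borel_measurable borel"
  shows "\<bar>(\<integral>\<omega>. h (X \<omega>) \<partial>M) - (\<integral>\<omega>. h (X' \<omega>) \<partial>N)\<bar> \<le>
    4 * C * ((\<integral>\<omega>. capped (X \<omega>) \<partial>M) + (\<integral>\<omega>. capped (X' \<omega>) \<partial>N))"
proof -
  obtain g L where L: "linear L"
    and rem: "\<And>v. \<bar>h v - h 0 - g \<bullet> v - v \<bullet> L v\<bar> \<le> 4 * C * capped v"
    using taylor2_bound[OF t b] by blast
  define T where "T m c = h 0 + (\<Sum>a\<in>Basis. (g \<bullet> a) * m a) + (\<Sum>a\<in>Basis. \<Sum>b\<in>Basis. (a \<bullet> L b) * c a b)"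
    for m :: "'v \<Rightarrow> real" and c :: "'v \<Rightarrow> 'v \<Rightarrow> real"
  have T: "h 0 + g \<bullet> v + v \<bullet> L v = T (\<lambda>a. v \<bullet> a) (\<lambda>a b. (v \<bullet> a) * (v \<bullet> b))" for v
    unfolding T_def inner_linear_expand[OF L] euclidean_inner[of g v] ..
  have bound: "\<bar>(\<integral>\<omega>. h (Z \<omega>) \<partial>P) - T (\<lambda>a. \<integral>\<omega>. Z \<omega> \<bullet> a \<partial>P) (\<lambda>a b. \<integral>\<omega>. (Z \<omega> \<bullet> a) * (Z \<omega> \<bullet> b) \<partial>P)\<bar> \<le>
      4 * C * (\<integral>\<omega>. capped (Z \<omega>) \<partial>P)"
    if P: "prob_space P" and Z [measurable]: "Z \<in> borel_measurable P" and Z2: "integrable P (\<lambda>\<omega>. norm (Z \<omega>) ^ 2)"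
    for P :: "'c measure" and Z
  proof -
    interpret P: prob_space P by fact
    note int = P.integrable_inner_of_square[OF Z Z2]
    have ih: "integrable P (\<lambda>\<omega>. h (Z \<omega>))" using b by (intro P.integrable_const_bound[of _ C]) auto
    have "has_bochner_integral P (\<lambda>_. h 0) (h 0)"
      using has_bochner_integral_integrable[of P "\<lambda>_. h 0"] by (simp add: P.prob_space)
    then have hT: "has_bochner_integral P (\<lambda>\<omega>. T (\<lambda>a. Z \<omega> \<bullet> a) (\<lambda>a b. (Z \<omega> \<bullet> a) * (Z \<omega> \<bullet> b)))
        (T (\<lambda>a. \<integral>\<omega>. Z \<omega> \<bullet> a \<partial>P) (\<lambda>a b. \<integral>\<omega>. (Z \<omega> \<bullet> a) * (Z \<omega> \<bullet> b) \<partial>P))"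
      unfolding T_def
      by (intro has_bochner_integral_add has_bochner_integral_sum has_bochner_integral_mult_right
          has_bochner_integral_integrable int)
    have iT: "integrable P (\<lambda>\<omega>. T (\<lambda>a. Z \<omega> \<bullet> a) (\<lambda>a b. (Z \<omega> \<bullet> a) * (Z \<omega> \<bullet> b)))"
      using hT by (rule integrable.intros)
    have "T (\<lambda>a. \<integral>\<omega>. Z \<omega> \<bullet> a \<partial>P) (\<lambda>a b. \<integral>\<omega>. (Z \<omega> \<bullet> a) * (Z \<omega> \<bullet> b) \<partial>P) =
      (\<integral>\<omega>. T (\<lambda>a. Z \<omega> \<bullet> a) (\<lambda>a b. (Z \<omega> \<bullet> a) * (Z \<omega> \<bullet> b)) \<partial>P)"
      using has_bochner_integral_integral_eq[OF hT] by simp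
    then have "\<bar>(\<integral>\<omega>. h (Z \<omega>) \<partial>P) - T (\<lambda>a. \<integral>\<omega>. Z \<omega> \<bullet> a \<partial>P) (\<lambda>a b. \<integral>\<omega>. (Z \<omega> \<bullet> a) * (Z \<omega> \<bullet> b) \<partial>P)\<bar> =
      \<bar>\<integral>\<omega>. h (Z \<omega>) - T (\<lambda>a. Z \<omega> \<bullet> a) (\<lambda>a b. (Z \<omega> \<bullet> a) * (Z \<omega> \<bullet> b)) \<partial>P\<bar>"
      using ih iT by simp
    also have "\<dots> \<le> (\<integral>\<omega>. \<bar>h (Z \<omega>) - T (\<lambda>a. Z \<omega> \<bullet> a) (\<lambda>a b. (Z \<omega> \<bullet> a) * (Z \<omega> \<bullet> b))\<bar> \<partial>P)"
      by (rule integral_abs_bound)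
    also have "\<dots> \<le> (\<integral>\<omega>. 4 * C * capped (Z \<omega>) \<partial>P)"
    proof (rule integral_mono)
      show "\<bar>h (Z \<omega>) - T (\<lambda>a. Z \<omega> \<bullet> a) (\<lambda>a b. (Z \<omega> \<bullet> a) * (Z \<omega> \<bullet> b))\<bar> \<le>
        4 * C * capped (Z \<omega>)" for \<omega>
        unfolding T[symmetric] using rem[of "Z \<omega>"] by (simp add: algebra_simps)
      show "integrable P (\<lambda>\<omega>. \<bar>h (Z \<omega>) - T (\<lambda>a. Z \<omega> \<bullet> a) (\<lambda>a b. (Z \<omega> \<bullet> a) * (Z \<omega> \<bullet> b))\<bar>)"
        using ih iT by (intro integrable_abs Bochner_Integration.integrable_diff)
      show "integrable P (\<lambda>\<omega>. 4 * C * capped (Z \<omega>))"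
        using int(3) by (rule integrable_mult_right)
    qed
    finally show ?thesis by simp
  qed
  have eq: "T (\<lambda>a. \<integral>\<omega>. X \<omega> \<bullet> a \<partial>M) (\<lambda>a b. \<integral>\<omega>. (X \<omega> \<bullet> a) * (X \<omega> \<bullet> b) \<partial>M) =
    T (\<lambda>a. \<integral>\<omega>. X' \<omega> \<bullet> a \<partial>N) (\<lambda>a b. \<integral>\<omega>. (X' \<omega> \<bullet> a) * (X' \<omega> \<bullet> b) \<partial>N)"
    unfolding T_def by (intro arg_cong2[where f="(+)"] sum.cong refl) (simp_all only: m1 m2)
  have tri: "\<bar>x - y\<bar> \<le> 4 * C * (c + d)" if "\<bar>x - t\<bar> \<le> 4 * C * c" "\<bar>y - t\<bar> \<le> 4 * C * d" for x y t c d
    using that unfolding distrib_left by linarith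
  show ?thesis
    by (rule tri[OF bound[OF M X X2, unfolded eq] bound[OF N X' X2']])
qed

text \<open>One constant for all base points and all coordinates does the work of bounded third
  derivatives. The class is an algebra containing the constants, as the Stone--Weierstrass theorem
  requires.\<close>

definition test_function :: "((nat \<Rightarrow> 'v::euclidean_space) \<Rightarrow> real) \<Rightarrow> bool" where
  "test_function H \<longleftrightarrow> continuous_on UNIV H \<and>
     (\<exists>C. (\<forall>x. \<bar>H x\<bar> \<le> C) \<and> (\<forall>j x. taylor2 C (\<lambda>v. H (add_at j x v))))"

lemma test_functionD: "test_function H \<Longrightarrow> continuous_on UNIV H"
  by (simp add: test_function_def)

lemma test_function_const: "test_function (\<lambda>_. c)"
  unfolding test_function_def using taylor2_const by (auto intro!: exI[of _ "\<bar>c\<bar>"])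

lemma test_function_add_mult:
  assumes "test_function H" "test_function K"
  shows "test_function (\<lambda>x. H x + K x)" "test_function (\<lambda>x. H x * K x)"
proof -
  obtain C where C: "\<And>x. \<bar>H x\<bar> \<le> C" "\<And>j x. taylor2 C (\<lambda>v. H (add_at j x v))" "continuous_on UNIV H"
    using assms(1) unfolding test_function_def by blast
  obtain D where D: "\<And>x. \<bar>K x\<bar> \<le> D" "\<And>j x. taylor2 D (\<lambda>v. K (add_at j x v))" "continuous_on UNIV K"
    using assms(2) unfolding test_function_def by blast
  define E where "E = max C D"
  have E: "\<bar>H x\<bar> \<le> E" "\<bar>K x\<bar> \<le> E" "taylor2 E (\<lambda>v. H (add_at j x v))" "taylor2 E (\<lambda>v. K (add_at j x v))" for j x
    using C(1)[of x] D(1)[of x] taylor2_mono[OF C(2)] taylor2_mono[OF D(2)] by (auto simp: E_def)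
  have E0: "0 \<le> E" using E(1)[of "\<lambda>_. 0"] by linarith
  show "test_function (\<lambda>x. H x + K x)"
    unfolding test_function_def
  proof (intro conjI exI[of _ "2 * E"] allI taylor2_add E continuous_on_add C D)
    show "\<bar>H x + K x\<bar> \<le> 2 * E" for x using E(1,2)[of x] by linarith
  qed
  show "test_function (\<lambda>x. H x * K x)"
    unfolding test_function_def
  proof (intro conjI exI[of _ "10 * E\<^sup>2"] allI taylor2_mult E continuous_on_mult C D)
    have "\<bar>H x * K x\<bar> \<le> E * E" for x
      unfolding abs_mult using E(1,2)[of x] E0 by (intro mult_mono) auto
    moreover have "E * E \<le> 10 * E\<^sup>2" using E0 by (simp add: power2_eq_square)
    ultimately show "\<bar>H x * K x\<bar> \<le> 10 * E\<^sup>2" for x using order_trans by blast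
  qed
qed

lemma test_function_prod:
  "finite I \<Longrightarrow> (\<And>i. i \<in> I \<Longrightarrow> test_function (H i)) \<Longrightarrow> test_function (\<lambda>x. \<Prod>i\<in>I. H i x)"
  by (induction I rule: finite_induct) (auto intro: test_function_const test_function_add_mult)

text \<open>The constant depends on \<open>H\<close> alone: it is fixed before the number of
  summands, the assignment to blocks, the variables and their measures. Only so can the bound tend
  to \<open>0\<close> along growing \<open>n\<close>.\<close>

lemma lindeberg:
  fixes H :: "(nat \<Rightarrow> 'v::euclidean_space) \<Rightarrow> real"
  assumes "test_function H"
  obtains C where "\<And>n \<beta> (X :: nat \<Rightarrow> 'a \<Rightarrow> 'v) (X' :: nat \<Rightarrow> 'b \<Rightarrow> 'v) M N.
    \<lbrakk>prob_space M; prob_space N;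
     prob_space.indep_vars M (\<lambda>_. borel) X {..<n}; prob_space.indep_vars N (\<lambda>_. borel) X' {..<n};
     \<And>i. i < n \<Longrightarrow> integrable M (\<lambda>\<omega>. norm (X i \<omega>) ^ 2); \<And>i. i < n \<Longrightarrow> integrable N (\<lambda>\<omega>. norm (X' i \<omega>) ^ 2);
     \<And>i a. i < n \<Longrightarrow> a \<in> Basis \<Longrightarrow> (\<integral>\<omega>. X i \<omega> \<bullet> a \<partial>M) = (\<integral>\<omega>. X' i \<omega> \<bullet> a \<partial>N);
     \<And>i a b. i < n \<Longrightarrow> a \<in> Basis \<Longrightarrow> b \<in> Basis \<Longrightarrow>
       (\<integral>\<omega>. (X i \<omega> \<bullet> a) * (X i \<omega> \<bullet> b) \<partial>M) = (\<integral>\<omega>. (X' i \<omega> \<bullet> a) * (X' i \<omega> \<bullet> b) \<partial>N)\<rbrakk> \<Longrightarrow>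
    \<bar>(\<integral>\<omega>. H (block_sum \<beta> X n \<omega>) \<partial>M) - (\<integral>\<omega>. H (block_sum \<beta> X' n \<omega>) \<partial>N)\<bar> \<le>
      C * (\<Sum>i<n. (\<integral>\<omega>. capped (X i \<omega>) \<partial>M) +
        (\<integral>\<omega>. capped (X' i \<omega>) \<partial>N))"
proof -
  obtain C where C: "\<And>x. \<bar>H x\<bar> \<le> C" "\<And>j x. taylor2 C (\<lambda>v. H (add_at j x v))" and cont: "continuous_on UNIV H"
    using assms unfolding test_function_def by blast
  have H [measurable]: "H \<in> borel_measurable borel" using cont by (rule borel_measurable_continuous_onI)
  show thesis
  proof (rule that[of "4 * C"], goal_cases)
    case (1 n \<beta> X X' M N)
    interpret M: prob_space M by fact
    interpret N: prob_space N by fact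
    have [measurable]: "X i \<in> borel_measurable M" "X' i \<in> borel_measurable N" if "i < n" for i
      using 1(3,4) that by (auto simp: M.indep_vars_def N.indep_vars_def)
    show ?case unfolding sum_distrib_left
    proof (rule block_sum_exchange[OF 1(1-4) H C(1)])
      fix i x assume i: "i < n"
      note [measurable] = \<open>\<And>i. i < n \<Longrightarrow> X i \<in> borel_measurable M\<close>[OF i] \<open>\<And>i. i < n \<Longrightarrow> X' i \<in> borel_measurable N\<close>[OF i]
      have "(\<integral>v. H (add_at (\<beta> i) x v) \<partial>distr M borel (X i)) = (\<integral>\<omega>. H (add_at (\<beta> i) x (X i \<omega>)) \<partial>M)"
        "(\<integral>v. H (add_at (\<beta> i) x v) \<partial>distr N borel (X' i)) = (\<integral>\<omega>. H (add_at (\<beta> i) x (X' i \<omega>)) \<partial>N)"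
        by (auto intro!: integral_distr)
      then show "\<bar>(\<integral>v. H (add_at (\<beta> i) x v) \<partial>distr M borel (X i)) - (\<integral>v. H (add_at (\<beta> i) x v) \<partial>distr N borel (X' i))\<bar> \<le>
        4 * C * ((\<integral>\<omega>. capped (X i \<omega>) \<partial>M) +
        (\<integral>\<omega>. capped (X' i \<omega>) \<partial>N))"
        using lindeberg_step[OF 1(1,2) _ _ 1(5)[OF i] 1(6)[OF i] 1(7)[OF i] 1(8)[OF i] C(2)[of "\<beta> i" x] C(1)]
        by simp
    qed
  qed
qed

section \<open>From smooth to continuous test functions\<close>

text \<open>A compactly supported function with three continuous derivatives that is a polynomial on
  its support. It serves both for separating points and for cutting off.\<close>

definition bump :: "real \<Rightarrow> real" where
  "bump t = (max 0 (1 - t\<^sup>2)) ^ 4"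

lemma bump_bounds: "0 \<le> bump t" "bump t \<le> 1"
  by (auto simp: bump_def intro!: power_le_one)

lemma bump_0 [simp]: "bump 0 = 1"
  by (simp add: bump_def)

lemma bump_eq_0: "1 \<le> \<bar>t\<bar> \<Longrightarrow> bump t = 0"
  using power_mono[of 1 "\<bar>t\<bar>" 2] by (simp add: bump_def)

lemma bump_less_1: "t \<noteq> 0 \<Longrightarrow> bump t < 1"
proof -
  assume "t \<noteq> 0"
  then have "max 0 (1 - t\<^sup>2) < 1" by auto
  then have "max 0 (1 - t\<^sup>2) ^ 4 < 1 ^ 4" by (intro power_strict_mono) auto
  then show ?thesis by (simp add: bump_def)
qed

lemma continuous_on_bump: "continuous_on S bump"
  unfolding bump_def[abs_def] by (intro continuous_intros)

text \<open>Two derivatives would not suffice: it is the Lipschitz second derivative of the fourth power of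
  the positive part that makes the remainder cubic.\<close>

lemma positive_part_power4_taylor:
  fixes z h :: real
  shows "\<bar>max 0 (z + h) ^ 4 - max 0 z ^ 4 - 4 * max 0 z ^ 3 * h - 6 * max 0 z ^ 2 * h\<^sup>2\<bar> \<le> (4 * \<bar>z\<bar> + 11 * \<bar>h\<bar>) * \<bar>h\<bar> ^ 3"
proof -
  have nn: "0 \<le> \<bar>z\<bar> * \<bar>h\<bar> ^ 3" "0 \<le> \<bar>h\<bar> ^ 4" by simp_all
  have pw: "x ^ 3 * x = x ^ 4" "x ^ 2 * x ^ 2 = x ^ 4" for x :: real by (simp_all add: power_numeral_reduce)
  have r: "(4 * \<bar>z\<bar> + 11 * \<bar>h\<bar>) * \<bar>h\<bar> ^ 3 = 4 * (\<bar>z\<bar> * \<bar>h\<bar> ^ 3) + 11 * \<bar>h\<bar> ^ 4"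
    unfolding pw(1)[symmetric] by (simp only: algebra_simps)
  consider "0 \<le> z" "0 \<le> z + h" | "0 \<le> z" "z + h < 0" | "z < 0" "0 \<le> z + h" | "z < 0" "z + h < 0" by linarith
  then show ?thesis
  proof cases
    case 1
    then have m: "max 0 (z + h) = z + h" "max 0 z = z" by simp_all
    have e: "(z + h) ^ 4 - z ^ 4 - 4 * z ^ 3 * h - 6 * z ^ 2 * h\<^sup>2 = 4 * (z * h ^ 3) + h ^ 4"
      by (simp add: algebra_simps power_numeral_reduce)
    have "\<bar>z * h ^ 3\<bar> = \<bar>z\<bar> * \<bar>h\<bar> ^ 3" "\<bar>h ^ 4\<bar> = \<bar>h\<bar> ^ 4" by (simp_all only: abs_mult power_abs)
    then show ?thesis unfolding r m e using nn by linarith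
  next
    case 2
    then have zh: "\<bar>z\<bar> \<le> \<bar>h\<bar>" and m: "max 0 (z + h) = 0" "max 0 z = z" by simp_all
    have "\<bar>z\<bar> ^ 4 \<le> \<bar>h\<bar> ^ 4" "\<bar>z\<bar> ^ 3 \<le> \<bar>h\<bar> ^ 3" "\<bar>z\<bar> ^ 2 \<le> \<bar>h\<bar> ^ 2"
      by (rule power_mono[OF zh abs_ge_zero])+
    then have "\<bar>z\<bar> ^ 4 \<le> \<bar>h\<bar> ^ 4" "\<bar>z\<bar> ^ 3 * \<bar>h\<bar> \<le> \<bar>h\<bar> ^ 3 * \<bar>h\<bar>" "\<bar>z\<bar> ^ 2 * \<bar>h\<bar> ^ 2 \<le> \<bar>h\<bar> ^ 2 * \<bar>h\<bar> ^ 2"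
      by (auto simp only: intro!: mult_right_mono abs_ge_zero zero_le_power)
    then have "\<bar>z ^ 4\<bar> \<le> \<bar>h\<bar> ^ 4" "\<bar>z ^ 3 * h\<bar> \<le> \<bar>h\<bar> ^ 4" "\<bar>z ^ 2 * h ^ 2\<bar> \<le> \<bar>h\<bar> ^ 4"
      unfolding pw by (simp_all only: abs_mult power_abs)
    \<comment> \<open>The constant \<open>11\<close> arises here: the coefficients \<open>1\<close>,
      \<open>4\<close> and \<open>6\<close> of three terms, each bounded by
      \<open>\<bar>h\<bar> ^ 4\<close>.\<close>
    then have "\<bar>- (z ^ 4) - 4 * (z ^ 3 * h) - 6 * (z ^ 2 * h ^ 2)\<bar> \<le> 4 * (\<bar>z\<bar> * \<bar>h\<bar> ^ 3) + 11 * \<bar>h\<bar> ^ 4"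
      using nn by linarith
    then show ?thesis unfolding r m by (simp add: mult.assoc)
  next
    case 3
    then have m: "max 0 z = 0" "max 0 (z + h) = z + h" and "z + h \<le> \<bar>h\<bar>" by simp_all
    then have "(z + h) ^ 4 \<le> \<bar>h\<bar> ^ 4" using 3 by (intro power_mono)
    moreover have "0 \<le> (z + h) ^ 4" by simp
    ultimately have "\<bar>(z + h) ^ 4\<bar> \<le> 4 * (\<bar>z\<bar> * \<bar>h\<bar> ^ 3) + 11 * \<bar>h\<bar> ^ 4" using nn by linarith
    then show ?thesis unfolding r m by simp
  next
    case 4
    then have m: "max 0 z = 0" "max 0 (z + h) = 0" by simp_all
    have "0 \<le> 4 * (\<bar>z\<bar> * \<bar>h\<bar> ^ 3) + 11 * \<bar>h\<bar> ^ 4" using nn by linarith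
    then show ?thesis unfolding r m by simp
  qed
qed

text \<open>\<open>p\<close> is the first derivative and \<open>q\<close> half the second. The
  expansion results from inserting the increment \<open>h = - 2 * t * s - s^2\<close> of
  \<open>1 - t^2\<close> into the expansion of the positive part; \<open>10000\<close> is a generous
  common bound.\<close>

lemma bump_taylor:
  obtains p q :: "real \<Rightarrow> real" where "\<And>t. \<bar>p t\<bar> \<le> 10000" "\<And>t. \<bar>q t\<bar> \<le> 10000"
    "\<And>t s. \<bar>s\<bar> \<le> 1 \<Longrightarrow> \<bar>bump (t + s) - bump t - p t * s - q t * s\<^sup>2\<bar> \<le> 10000 * \<bar>s\<bar> ^ 3"
proof -
  define Z where "Z t = max 0 (1 - t\<^sup>2)" for t :: real
  define p where "p t = - 8 * t * Z t ^ 3" for t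
  define q where "q t = - 4 * Z t ^ 3 + 24 * (t\<^sup>2 * Z t ^ 2)" for t
  have Z: "0 \<le> Z t" "Z t \<le> 1" for t by (auto simp: Z_def)
  have ZP: "0 \<le> Z t ^ 3" "Z t ^ 3 \<le> 1" "0 \<le> Z t ^ 2" "Z t ^ 2 \<le> 1" for t
    using Z by (auto intro!: power_le_one)
  have Z0: "Z t = 0" if "1 \<le> \<bar>t\<bar>" for t
    using power_mono[of 1 "\<bar>t\<bar>" 2] that by (simp add: Z_def)
  have pb: "\<bar>p t\<bar> \<le> 10000" and qb: "\<bar>q t\<bar> \<le> 10000" for t
  proof -
    have "\<bar>p t\<bar> \<le> 10000 \<and> \<bar>q t\<bar> \<le> 10000"
    proof (cases "1 \<le> \<bar>t\<bar>")
      case True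
      then show ?thesis using Z0[OF True] by (simp add: p_def q_def)
    next
      case False
      then have "\<bar>t\<bar> * Z t ^ 3 \<le> 1 * 1" "t\<^sup>2 * Z t ^ 2 \<le> 1 * 1"
        using ZP[of t] by (intro mult_mono; simp add: abs_square_le_1)+
      moreover have "0 \<le> t\<^sup>2 * Z t ^ 2" by simp
      moreover have "\<bar>p t\<bar> = 8 * (\<bar>t\<bar> * Z t ^ 3)" using ZP[of t] by (simp add: p_def abs_mult)
      ultimately show ?thesis using ZP[of t] unfolding q_def by linarith
    qed
    then show "\<bar>p t\<bar> \<le> 10000" "\<bar>q t\<bar> \<le> 10000" by auto
  qed
  have "\<bar>bump (t + s) - bump t - p t * s - q t * s\<^sup>2\<bar> \<le> 10000 * \<bar>s\<bar> ^ 3" if s: "\<bar>s\<bar> \<le> 1" for t s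
  proof (cases "2 \<le> \<bar>t\<bar>")
    case True
    \<comment> \<open>Both points are outside the open support and everything vanishes. This
      confines \<open>t\<close> to a bounded range in the other case.\<close>
    then have "1 \<le> \<bar>t + s\<bar>" "1 \<le> \<bar>t\<bar>" using s by linarith+
    then show ?thesis using Z0[of t] by (simp add: bump_eq_0 p_def q_def)
  next
    case False
    define h where "h = - 2 * t * s - s\<^sup>2"
    have "s\<^sup>2 \<le> \<bar>s\<bar>" using s power_decreasing[of 1 2 "\<bar>s\<bar>"] by simp
    moreover have "\<bar>t * s\<bar> \<le> 2 * \<bar>s\<bar>" unfolding abs_mult using False by (intro mult_right_mono) auto
    moreover have "h = - 2 * (t * s) - s\<^sup>2" "0 \<le> s\<^sup>2" by (simp_all add: h_def)
    ultimately have h: "\<bar>h\<bar> \<le> 5 * \<bar>s\<bar>" by linarith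
    then have h3: "\<bar>h\<bar> ^ 3 \<le> (5 * \<bar>s\<bar>) ^ 3" by (intro power_mono) auto
    have "\<bar>t\<bar>\<^sup>2 \<le> 2\<^sup>2" using False by (intro power_mono) auto
    then have "t\<^sup>2 \<le> 4" by simp
    then have z: "\<bar>1 - t\<^sup>2\<bar> \<le> 3" using zero_le_power2[of t] by linarith
    \<comment> \<open>\<open>67 = 4 * 3 + 11 * 5\<close> from
      \<open>\<bar>1 - t^2\<bar> \<le> 3\<close>,
      \<open>\<bar>h\<bar> \<le> 5 * \<bar>s\<bar>\<close> and \<open>\<bar>s\<bar> \<le> 1\<close>;
      the cube contributes \<open>125\<close>.\<close>
    have "(4 * \<bar>1 - t\<^sup>2\<bar> + 11 * \<bar>h\<bar>) * \<bar>h\<bar> ^ 3 \<le> 67 * (5 * \<bar>s\<bar>) ^ 3"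
      using h3 z h s by (intro mult_mono) auto
    also have "\<dots> = 8375 * \<bar>s\<bar> ^ 3" by (simp add: power_mult_distrib)
    finally have 1: "\<bar>max 0 (1 - t\<^sup>2 + h) ^ 4 - Z t ^ 4 - 4 * Z t ^ 3 * h - 6 * Z t ^ 2 * h\<^sup>2\<bar> \<le> 8375 * \<bar>s\<bar> ^ 3"
      unfolding Z_def using positive_part_power4_taylor[of "1 - t\<^sup>2" h] by linarith
    have hz: "1 - t\<^sup>2 + h = 1 - (t + s)\<^sup>2" by (simp add: h_def power2_sum)
    then have b: "max 0 (1 - t\<^sup>2 + h) ^ 4 = bump (t + s)" "Z t ^ 4 = bump t"
      by (simp_all only: bump_def Z_def hz)
    \<comment> \<open>The square of \<open>h\<close> also yields powers \<open>s ^ 3\<close> and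
      \<open>s ^ 4\<close>, which join the remainder. As \<open>\<bar>t\<bar> < 2\<close>, they cost
      at most \<open>24 * 2 + 6 = 54\<close> times \<open>\<bar>s\<bar> ^ 3\<close>.\<close>
    have e: "4 * Z t ^ 3 * h + 6 * Z t ^ 2 * h\<^sup>2 = p t * s + q t * s\<^sup>2 + Z t ^ 2 * (24 * t * s ^ 3 + 6 * s ^ 4)"
    proof -
      have "s ^ 3 = s * s\<^sup>2" "s ^ 4 = s\<^sup>2 * s\<^sup>2" by (simp_all add: power_numeral_reduce)
      moreover have "4 * A * (- 2 * t * s - s\<^sup>2) + 6 * B * (- 2 * t * s - s\<^sup>2)\<^sup>2 = (- 8 * t * A) * s +
          (- 4 * A + 24 * (t\<^sup>2 * B)) * s\<^sup>2 + B * (24 * t * (s * s\<^sup>2) + 6 * (s\<^sup>2 * s\<^sup>2))" for A B :: real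
        by (simp add: power2_eq_square algebra_simps)
      ultimately show ?thesis unfolding p_def q_def h_def by (simp only:)
    qed
    have "\<bar>24 * t * s ^ 3 + 6 * s ^ 4\<bar> \<le> 24 * (\<bar>t\<bar> * \<bar>s\<bar> ^ 3) + 6 * \<bar>s\<bar> ^ 4"
      by (rule order_trans[OF abs_triangle_ineq]) (simp add: abs_mult power_abs)
    moreover have "\<bar>t\<bar> * \<bar>s\<bar> ^ 3 \<le> 2 * \<bar>s\<bar> ^ 3" using False by (intro mult_right_mono) auto
    moreover have "\<bar>s\<bar> ^ 4 \<le> \<bar>s\<bar> ^ 3" using s by (intro power_decreasing) auto
    ultimately have "\<bar>24 * t * s ^ 3 + 6 * s ^ 4\<bar> \<le> 54 * \<bar>s\<bar> ^ 3" by linarith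
    then have W: "\<bar>Z t ^ 2 * (24 * t * s ^ 3 + 6 * s ^ 4)\<bar> \<le> 1 * (54 * \<bar>s\<bar> ^ 3)"
      unfolding abs_mult using ZP[of t] by (intro mult_mono) auto
    have split: "bump (t + s) - bump t - p t * s - q t * s\<^sup>2 =
        (bump (t + s) - bump t - 4 * Z t ^ 3 * h - 6 * Z t ^ 2 * h\<^sup>2) + Z t ^ 2 * (24 * t * s ^ 3 + 6 * s ^ 4)"
      using e by linarith
    have "\<bar>bump (t + s) - bump t - p t * s - q t * s\<^sup>2\<bar> \<le> 8375 * \<bar>s\<bar> ^ 3 + 1 * (54 * \<bar>s\<bar> ^ 3)"
      unfolding split by (rule order_trans[OF abs_triangle_ineq add_mono[OF 1[unfolded b] W]])
    also have "\<dots> \<le> 10000 * \<bar>s\<bar> ^ 3" by simp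
    finally show ?thesis .
  qed
  then show thesis using that pb qb by blast
qed

text \<open>Only coordinate \<open>j\<close> matters, and there the expansion of \<open>bump\<close>
  is composed with a linear functional. Division by \<open>R \<ge> 1\<close> merely shrinks the
  coefficients, so the constants of \<open>bump_taylor\<close> serve for every \<open>R\<close> and
  every centre \<open>m\<close>.\<close>

lemma test_function_bump:
  fixes a :: "'v::euclidean_space"
  assumes a: "a \<in> Basis" and R: "1 \<le> R"
  shows "test_function (\<lambda>x. bump ((x j \<bullet> a - m) / R))"
proof -
  obtain p q where pq: "\<And>t. \<bar>p t\<bar> \<le> (10000::real)" "\<And>t. \<bar>q t\<bar> \<le> (10000::real)"
    "\<And>t s. \<bar>s\<bar> \<le> 1 \<Longrightarrow> \<bar>bump (t + s) - bump t - p t * s - q t * s\<^sup>2\<bar> \<le> 10000 * \<bar>s\<bar> ^ 3"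
    using bump_taylor by blast
  have na: "norm a = 1" using a by simp
  have va: "\<bar>v \<bullet> a\<bar> \<le> norm v" for v using Cauchy_Schwarz_ineq2[of v a] na by simp
  have "taylor2 10000 (\<lambda>v. bump ((add_at i x v j \<bullet> a - m) / R))" for i and x :: "nat \<Rightarrow> 'v"
  proof (cases "i = j")
    case False
    then show ?thesis
      using taylor2_mono[OF taylor2_const, of "bump ((x j \<bullet> a - m) / R)" 10000] bump_bounds[of "(x j \<bullet> a - m) / R"]
      by (simp add: add_at_def)
  next
    case True
    define t where "t = (x j \<bullet> a - m) / R"
    have shift: "(add_at i x v j \<bullet> a - m) / R = t + (v \<bullet> a) / R" for v
      using True by (simp add: add_at_def t_def inner_add_left diff_divide_distrib add_divide_distrib)
    define w where "w = (q t / R\<^sup>2) *\<^sub>R a"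
    let ?g = "(p t / R) *\<^sub>R a" and ?L = "\<lambda>v. (v \<bullet> a) *\<^sub>R w"
    show ?thesis unfolding taylor2_def shift
    proof (intro conjI exI[of _ ?g] exI[of _ ?L] allI impI)
      show "\<bar>bump (t + 0 \<bullet> a / R)\<bar> \<le> 10000" using bump_bounds[of t] by simp
      have "\<bar>p t\<bar> / R \<le> \<bar>p t\<bar>" using R by (simp add: divide_le_eq mult_le_cancel_left1)
      then show "norm ?g \<le> 10000" using pq(1)[of t] R na by simp
      show "linear ?L" by (rule linearI) (simp_all add: inner_add_left scaleR_add_left)
      show "norm (?L v) \<le> 10000 * norm v" for v
      proof -
        have "1 \<le> R\<^sup>2" using R by simp
        then have "\<bar>q t\<bar> / R\<^sup>2 \<le> \<bar>q t\<bar>" by (simp add: divide_le_eq mult_le_cancel_left1)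
        then have "\<bar>q t\<bar> / R\<^sup>2 \<le> 10000" using pq(2)[of t] by linarith
        then have "(\<bar>q t\<bar> / R\<^sup>2) * \<bar>v \<bullet> a\<bar> \<le> 10000 * norm v" using va by (intro mult_mono) auto
        then show ?thesis using na by (simp add: w_def abs_mult mult.commute)
      qed
      show "\<bar>bump (t + v \<bullet> a / R) - bump (t + 0 \<bullet> a / R) - ?g \<bullet> v - v \<bullet> ?L v\<bar> \<le> 10000 * norm v ^ 3"
        if "norm v \<le> 1" for v
      proof -
        have "\<bar>v \<bullet> a / R\<bar> \<le> \<bar>v \<bullet> a\<bar>" using R by (simp add: divide_le_eq mult_le_cancel_left1)
        then have s: "\<bar>v \<bullet> a / R\<bar> \<le> norm v" using va[of v] by linarith
        then have "\<bar>bump (t + v \<bullet> a / R) - bump t - p t * (v \<bullet> a / R) - q t * (v \<bullet> a / R)\<^sup>2\<bar> \<le> 10000 * \<bar>v \<bullet> a / R\<bar> ^ 3"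
          using that by (intro pq(3)) linarith
        also have "\<dots> \<le> 10000 * norm v ^ 3" using s by (intro mult_left_mono power_mono) auto
        finally have *: "\<bar>bump (t + v \<bullet> a / R) - bump t - p t * (v \<bullet> a / R) - q t * (v \<bullet> a / R)\<^sup>2\<bar> \<le> 10000 * norm v ^ 3" .
        have g: "?g \<bullet> v = p t * (v \<bullet> a / R)" by (simp add: inner_commute[of a v])
        have l: "v \<bullet> ?L v = q t * (v \<bullet> a / R)\<^sup>2" by (simp add: w_def power2_eq_square)
        show ?thesis unfolding g l using * by simp
      qed
    qed
  qed
  moreover have "continuous_on UNIV (\<lambda>x :: nat \<Rightarrow> 'v. bump ((x j \<bullet> a - m) / R))"
    by (rule continuous_on_compose2[OF continuous_on_bump])
      (use R in \<open>auto intro!: continuous_intros\<close>)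
  moreover have "\<bar>bump t\<bar> \<le> 10000" for t using bump_bounds[of t] by simp
  ultimately show ?thesis unfolding test_function_def by blast
qed

text \<open>Tychonoff's theorem: the box restricts all infinitely many coordinates.\<close>

lemma compact_Pi_box:
  fixes R :: real
  shows "compact {x :: nat \<Rightarrow> 'v::euclidean_space. \<forall>j. x j \<in> cbox (- R *\<^sub>R One) (R *\<^sub>R One)}"
proof -
  have "compactin (product_topology (\<lambda>_. euclidean) UNIV) (PiE UNIV (\<lambda>j::nat. cbox (- R *\<^sub>R One :: 'v) (R *\<^sub>R One)))"
    by (simp add: compactin_PiE)
  moreover have "PiE UNIV (\<lambda>j::nat. cbox (- R *\<^sub>R One :: 'v) (R *\<^sub>R One)) = {x. \<forall>j. x j \<in> cbox (- R *\<^sub>R One) (R *\<^sub>R One)}"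
    by (auto simp: PiE_def Pi_def)
  ultimately show ?thesis by (simp add: euclidean_product_topology)
qed

lemma test_function_dense:
  fixes g :: "(nat \<Rightarrow> 'v::euclidean_space) \<Rightarrow> real"
  assumes "continuous_on UNIV g" "0 < e"
  obtains P where "test_function P"
    "\<And>x. (\<And>j. x j \<in> cbox (- R *\<^sub>R One) (R *\<^sub>R One)) \<Longrightarrow> \<bar>g x - P x\<bar> < e"
proof -
  let ?K = "{x :: nat \<Rightarrow> 'v. \<forall>j. x j \<in> cbox (- R *\<^sub>R One) (R *\<^sub>R One)}"
  have sep: "\<exists>f. test_function f \<and> f x \<noteq> f y" if "x \<noteq> y" for x y :: "nat \<Rightarrow> 'v"
  proof -
    have "\<exists>j. x j \<noteq> y j" using that by (simp add: fun_eq_iff)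
    then obtain j where "x j \<noteq> y j" ..
    then obtain a where a: "a \<in> Basis" "x j \<bullet> a \<noteq> y j \<bullet> a" using euclidean_eqI by blast
    \<comment> \<open>A bump centred at the coordinate of \<open>x\<close> attains its strict
      maximum there, hence separates \<open>x\<close> from \<open>y\<close>.\<close>
    have "bump ((y j \<bullet> a - x j \<bullet> a) / 1) < bump ((x j \<bullet> a - x j \<bullet> a) / 1)"
      using bump_less_1[of "y j \<bullet> a - x j \<bullet> a"] a by simp
    then show ?thesis
      using test_function_bump[OF a(1), of 1 j "x j \<bullet> a"]
      by (intro exI[of _ "\<lambda>z. bump ((z j \<bullet> a - x j \<bullet> a) / 1)"]) simp
  qed
  have "\<exists>P. test_function P \<and> (\<forall>x\<in>?K. \<bar>g x - P x\<bar> < e)"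
  proof (rule Stone_Weierstrass_HOL)
    show "continuous_on ?K f" if "test_function f" for f
      using continuous_on_subset[OF test_functionD[OF that]] by blast
    show "continuous_on ?K g" using continuous_on_subset[OF assms(1)] by blast
  qed (use compact_Pi_box assms(2) test_function_const test_function_add_mult sep in auto)
  then show thesis using that by blast
qed

section \<open>Cutting off, and tightness for free\<close>

definition cutoff :: "nat \<Rightarrow> real \<Rightarrow> (nat \<Rightarrow> 'v::euclidean_space) \<Rightarrow> real" where
  "cutoff k R x = (\<Prod>j<k. \<Prod>a\<in>Basis. bump (x j \<bullet> a / R))"

lemma test_function_cutoff: "1 \<le> R \<Longrightarrow> test_function (cutoff k R)"
  unfolding cutoff_def[abs_def] using test_function_bump[where m=0]
  by (intro test_function_prod) auto

lemma cutoff_bounds: "0 \<le> cutoff k R x" "cutoff k R x \<le> 1"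
  unfolding cutoff_def using bump_bounds by (auto intro!: prod_nonneg prod_le_1)

lemma abs_cutoff_le: "\<bar>cutoff k R x\<bar> \<le> 1"
  using cutoff_bounds[of k R x] by simp

lemma cutoff_eq_0:
  assumes "0 < R" "\<And>j. k \<le> j \<Longrightarrow> x j = 0" "\<not> (\<forall>j. x j \<in> cbox (- R *\<^sub>R One) (R *\<^sub>R One))"
  shows "cutoff k R x = 0"
proof -
  obtain j a where a: "a \<in> Basis" and *: "\<not> (- R \<le> x j \<bullet> a \<and> x j \<bullet> a \<le> R)"
    using assms(3) by (auto simp: mem_box)
  have "j < k" using * assms(1) assms(2)[of j] by (cases "j < k") auto
  have "bump (x j \<bullet> a / R) = 0" using * assms(1) by (intro bump_eq_0) (auto simp: field_simps)
  then show ?thesis unfolding cutoff_def using \<open>j < k\<close> a by (auto intro!: prod_zero)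
qed

lemma cutoff_tendsto_1:
  fixes x :: "nat \<Rightarrow> 'v::euclidean_space"
  shows "(\<lambda>r. cutoff k (real (Suc r)) x) \<longlonglongrightarrow> 1"
proof -
  have "(\<lambda>r. cutoff k (real (Suc r)) x) \<longlonglongrightarrow> (\<Prod>j<k. \<Prod>a\<in>(Basis :: 'v set). bump 0)"
    unfolding cutoff_def
  proof (intro tendsto_prod)
    fix j and a :: 'v
    have "(\<lambda>r. x j \<bullet> a / real (Suc r)) \<longlonglongrightarrow> 0" by (rule LIMSEQ_Suc[OF lim_const_over_n])
    moreover have "isCont bump 0" using continuous_on_bump[of UNIV] by (simp add: continuous_on_eq_continuous_at)
    ultimately show "(\<lambda>r. bump (x j \<bullet> a / real (Suc r))) \<longlonglongrightarrow> bump 0"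
      using isCont_tendsto_compose by blast
  qed
  then show ?thesis by simp
qed

text \<open>Tightness of the \<open>Z n\<close> is not assumed but derived: the cutoff is itself a
  test function, so its expectations converge to one that is nearly \<open>1\<close>. That leaves
  little mass where approximation by test functions fails.\<close>

lemma weak_convergence_of_test_functions:
  fixes Z :: "nat \<Rightarrow> 'a \<Rightarrow> nat \<Rightarrow> 'v::euclidean_space" and W :: "'b \<Rightarrow> nat \<Rightarrow> 'v"
  assumes M: "prob_space M" and N: "prob_space N"
    and Z [measurable]: "\<And>n. Z n \<in> borel_measurable M" and W [measurable]: "W \<in> borel_measurable N"
    and Z0: "\<And>n \<omega> j. k \<le> j \<Longrightarrow> Z n \<omega> j = 0" and W0: "\<And>\<omega> j. k \<le> j \<Longrightarrow> W \<omega> j = 0"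
    and test: "\<And>H. test_function H \<Longrightarrow> (\<lambda>n. \<integral>\<omega>. H (Z n \<omega>) \<partial>M) \<longlonglongrightarrow> (\<integral>\<omega>. H (W \<omega>) \<partial>N)"
    and g: "continuous_on UNIV g" "\<And>x. \<bar>g x\<bar> \<le> (B::real)"
  shows "(\<lambda>n. \<integral>\<omega>. g (Z n \<omega>) \<partial>M) \<longlonglongrightarrow> (\<integral>\<omega>. g (W \<omega>) \<partial>N)"
  unfolding tendsto_iff
proof (intro allI impI)
  fix e :: real assume "0 < e"
  interpret M: prob_space M by fact
  interpret N: prob_space N by fact
  have gm [measurable]: "g \<in> borel_measurable borel" using g(1) by (rule borel_measurable_continuous_onI)
  have cm [measurable]: "cutoff k R \<in> borel_measurable borel" if "1 \<le> R" for R
    by (rule borel_measurable_continuous_onI[OF test_functionD[OF test_function_cutoff[OF that]]])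
  have B: "0 \<le> B" using g(2)[of undefined] by linarith
  \<comment> \<open>Each of the two approximations will cost \<open>B * d + d\<close> and the
    comparison of test functions \<open>d\<close>, in total less than
    \<open>(4 * B + 4) * d = e\<close>.\<close>
  define d where "d = e / (4 * B + 4)"
  have d: "0 < d" "(4 * B + 4) * d = e" using B \<open>0 < e\<close> by (auto simp: d_def)
  have "(\<lambda>r. \<integral>\<omega>. cutoff k (real (Suc r)) (W \<omega>) \<partial>N) \<longlonglongrightarrow> (\<integral>\<omega>. 1 \<partial>N)"
    by (rule integral_dominated_convergence[where w="\<lambda>_. 1"])
      (auto simp: cutoff_tendsto_1 abs_cutoff_le simp del: of_nat_Suc intro!: measurable_compose[OF W cm])
  then have "(\<lambda>r. \<integral>\<omega>. cutoff k (real (Suc r)) (W \<omega>) \<partial>N) \<longlonglongrightarrow> 1" by (simp add: N.prob_space)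
  from order_tendstoD(1)[OF this, of "1 - d"] d(1)
  obtain r where r: "1 - d < (\<integral>\<omega>. cutoff k (real (Suc r)) (W \<omega>) \<partial>N)"
    by (auto simp: eventually_sequentially)
  define R where "R = real (Suc r)"
  have R: "1 \<le> R" "0 < R" by (auto simp: R_def)
  obtain P where P: "test_function P" "\<And>x. (\<And>j. x j \<in> cbox (- R *\<^sub>R One) (R *\<^sub>R One)) \<Longrightarrow> \<bar>g x - P x\<bar> < d"
    using test_function_dense[OF g(1) d(1)] by blast
  \<comment> \<open>\<open>P\<close> approximates \<open>g\<close> on the box only and is
    uncontrolled outside. The cutoff vanishes there, and on the box it keeps the error below
    \<open>d\<close>.\<close>
  define H where "H x = P x * cutoff k R x" for x
  have H: "test_function H" unfolding H_def[abs_def] by (intro test_function_add_mult P test_function_cutoff R)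
  have Hm [measurable]: "H \<in> borel_measurable borel" by (rule borel_measurable_continuous_onI[OF test_functionD[OF H]])
  obtain D where D: "\<And>x. \<bar>H x\<bar> \<le> D" using H unfolding test_function_def by blast
  have gH: "\<bar>g x - H x\<bar> \<le> B * (1 - cutoff k R x) + d" if x0: "\<And>j. k \<le> j \<Longrightarrow> x j = 0" for x
  proof -
    have 1: "\<bar>g x * cutoff k R x - H x\<bar> \<le> d"
    proof (cases "\<forall>j. x j \<in> cbox (- R *\<^sub>R One) (R *\<^sub>R One)")
      case True
      have "\<bar>g x * cutoff k R x - H x\<bar> = \<bar>g x - P x\<bar> * \<bar>cutoff k R x\<bar>"
        by (simp add: H_def left_diff_distrib flip: abs_mult)
      also have "\<dots> \<le> d * 1" using P(2)[of x] True cutoff_bounds[of k R x] d(1) by (intro mult_mono) (auto intro: less_imp_le)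
      finally show ?thesis by simp
    next
      case False
      then show ?thesis using cutoff_eq_0[OF R(2) x0 False] d(1) by (simp add: H_def)
    qed
    have "\<bar>g x - g x * cutoff k R x\<bar> = \<bar>g x * (1 - cutoff k R x)\<bar>" by (simp add: right_diff_distrib)
    also have "\<dots> = \<bar>g x\<bar> * (1 - cutoff k R x)" using cutoff_bounds[of k R x] by (simp add: abs_mult)
    also have "\<dots> \<le> B * (1 - cutoff k R x)" using g(2) cutoff_bounds[of k R x] by (intro mult_right_mono) auto
    finally show ?thesis using 1 by linarith
  qed
  have approx: "\<bar>(\<integral>\<omega>. g (V \<omega>) \<partial>Q) - (\<integral>\<omega>. H (V \<omega>) \<partial>Q)\<bar> \<le> B * (1 - (\<integral>\<omega>. cutoff k R (V \<omega>) \<partial>Q)) + d"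
    if Q: "prob_space Q" and V [measurable]: "V \<in> borel_measurable Q" and V0: "\<And>\<omega> j. k \<le> j \<Longrightarrow> V \<omega> j = 0"
    for Q :: "'c measure" and V
  proof -
    interpret Q: prob_space Q by fact
    note [measurable] = measurable_compose[OF V cm[OF R(1)]]
    have i: "integrable Q (\<lambda>\<omega>. g (V \<omega>))" "integrable Q (\<lambda>\<omega>. H (V \<omega>))" "integrable Q (\<lambda>\<omega>. cutoff k R (V \<omega>))"
      by (rule Q.integrable_const_bound[of _ B] Q.integrable_const_bound[of _ D] Q.integrable_const_bound[of _ 1];
          simp add: g(2) D abs_cutoff_le)+
    have "\<bar>(\<integral>\<omega>. g (V \<omega>) \<partial>Q) - (\<integral>\<omega>. H (V \<omega>) \<partial>Q)\<bar> = \<bar>\<integral>\<omega>. g (V \<omega>) - H (V \<omega>) \<partial>Q\<bar>"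
      using i by simp
    also have "\<dots> \<le> (\<integral>\<omega>. \<bar>g (V \<omega>) - H (V \<omega>)\<bar> \<partial>Q)" by (rule integral_abs_bound)
    also have "\<dots> \<le> (\<integral>\<omega>. B * (1 - cutoff k R (V \<omega>)) + d \<partial>Q)"
      using i gH V0 by (intro integral_mono) auto
    also have "\<dots> = B * (1 - (\<integral>\<omega>. cutoff k R (V \<omega>) \<partial>Q)) + d"
      using i by (simp add: Q.prob_space)
    finally show ?thesis .
  qed
  have cW: "1 - d < (\<integral>\<omega>. cutoff k R (W \<omega>) \<partial>N)" using r by (simp add: R_def)
  have "eventually (\<lambda>n. 1 - d < (\<integral>\<omega>. cutoff k R (Z n \<omega>) \<partial>M)) sequentially"
    using order_tendstoD(1)[OF test[OF test_function_cutoff[OF R(1)]] cW] .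
  moreover have "eventually (\<lambda>n. dist (\<integral>\<omega>. H (Z n \<omega>) \<partial>M) (\<integral>\<omega>. H (W \<omega>) \<partial>N) < d) sequentially"
    using test[OF H] d(1) by (simp add: tendsto_iff)
  ultimately show "eventually (\<lambda>n. dist (\<integral>\<omega>. g (Z n \<omega>) \<partial>M) (\<integral>\<omega>. g (W \<omega>) \<partial>N) < e) sequentially"
  proof eventually_elim
    case (elim n)
    have "B * (1 - (\<integral>\<omega>. cutoff k R (Z n \<omega>) \<partial>M)) \<le> B * d" "B * (1 - (\<integral>\<omega>. cutoff k R (W \<omega>) \<partial>N)) \<le> B * d"
      using elim(1) cW B by (auto intro!: mult_left_mono)
    then have "\<bar>(\<integral>\<omega>. g (Z n \<omega>) \<partial>M) - (\<integral>\<omega>. H (Z n \<omega>) \<partial>M)\<bar> \<le> B * d + d"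
      "\<bar>(\<integral>\<omega>. g (W \<omega>) \<partial>N) - (\<integral>\<omega>. H (W \<omega>) \<partial>N)\<bar> \<le> B * d + d"
      using approx[OF M Z[of n] Z0] approx[OF N W W0] by linarith+
    moreover have "e = 4 * (B * d) + 4 * d" using d(2) by (simp add: algebra_simps)
    moreover have "0 \<le> B * d" using B d by simp
    ultimately show ?case using elim(2) d(1) unfolding dist_real_def by linarith
  qed
qed

section \<open>A maximal inequality\<close>

text \<open>Mixed terms vanish: independence of two summands passes to their coordinates, which have
  mean zero.\<close>

lemma (in prob_space) second_moment_sum_indep:
  fixes X :: "nat \<Rightarrow> 'a \<Rightarrow> 'v::euclidean_space"
  assumes ind: "indep_vars (\<lambda>_. borel) X I" and I: "finite I"
    and X2: "\<And>i. i \<in> I \<Longrightarrow> integrable M (\<lambda>\<omega>. norm (X i \<omega>) ^ 2)"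
    and X0: "\<And>i a. i \<in> I \<Longrightarrow> a \<in> Basis \<Longrightarrow> expectation (\<lambda>\<omega>. X i \<omega> \<bullet> a) = 0"
  shows "integrable M (\<lambda>\<omega>. norm (\<Sum>i\<in>I. X i \<omega>) ^ 2)"
    "expectation (\<lambda>\<omega>. norm (\<Sum>i\<in>I. X i \<omega>) ^ 2) = (\<Sum>i\<in>I. expectation (\<lambda>\<omega>. norm (X i \<omega>) ^ 2))"
proof -
  have rv [measurable]: "X i \<in> borel_measurable M" if "i \<in> I" for i
    using ind that by (auto simp: indep_vars_def)
  have int1: "integrable M (\<lambda>\<omega>. X i \<omega> \<bullet> a)" if "i \<in> I" for i a
    using integrable_inner_of_square(1)[OF rv[OF that] X2[OF that]] .
  have cross: "has_bochner_integral M (\<lambda>\<omega>. X i \<omega> \<bullet> X j \<omega>) (if i = j then expectation (\<lambda>\<omega>. norm (X i \<omega>) ^ 2) else 0)"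
    if ij: "i \<in> I" "j \<in> I" for i j
  proof (cases "i = j")
    case True
    then show ?thesis using has_bochner_integral_integrable[OF X2[OF ij(1)]] by (simp add: power2_norm_eq_inner)
  next
    case False
    have *: "has_bochner_integral M (\<lambda>\<omega>. (X i \<omega> \<bullet> a) * (X j \<omega> \<bullet> a)) 0" if a: "a \<in> Basis" for a
    proof -
      have "indep_vars (\<lambda>_. borel) (\<lambda>i \<omega>. X i \<omega> \<bullet> a) {i, j}"
        by (rule indep_vars_compose2[OF indep_vars_subset[OF ind], where Y = "\<lambda>_ x. x \<bullet> a"]) (use ij in auto)
      from indep_vars_integrable[OF _ this] indep_vars_lebesgue_integral[OF _ this] int1 ij
      have "integrable M (\<lambda>\<omega>. \<Prod>i\<in>{i, j}. X i \<omega> \<bullet> a)"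
        "expectation (\<lambda>\<omega>. \<Prod>i\<in>{i, j}. X i \<omega> \<bullet> a) = (\<Prod>i\<in>{i, j}. expectation (\<lambda>\<omega>. X i \<omega> \<bullet> a))"
        by auto
      then show ?thesis using False X0[OF ij(1) a] by (simp add: has_bochner_integral_iff)
    qed
    have "has_bochner_integral M (\<lambda>\<omega>. \<Sum>a\<in>Basis. (X i \<omega> \<bullet> a) * (X j \<omega> \<bullet> a)) (\<Sum>a\<in>(Basis :: 'v set). 0)"
      by (intro has_bochner_integral_sum *)
    moreover have "(\<lambda>\<omega>. \<Sum>a\<in>Basis. (X i \<omega> \<bullet> a) * (X j \<omega> \<bullet> a)) = (\<lambda>\<omega>. X i \<omega> \<bullet> X j \<omega>)"
      by (simp add: fun_eq_iff euclidean_inner[symmetric])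
    ultimately show ?thesis using False by simp
  qed
  have "has_bochner_integral M (\<lambda>\<omega>. \<Sum>i\<in>I. \<Sum>j\<in>I. X i \<omega> \<bullet> X j \<omega>)
      (\<Sum>i\<in>I. \<Sum>j\<in>I. if i = j then expectation (\<lambda>\<omega>. norm (X i \<omega>) ^ 2) else 0)"
    by (intro has_bochner_integral_sum cross)
  moreover have "(\<lambda>\<omega>. \<Sum>i\<in>I. \<Sum>j\<in>I. X i \<omega> \<bullet> X j \<omega>) = (\<lambda>\<omega>. norm (\<Sum>i\<in>I. X i \<omega>) ^ 2)"
    by (intro ext, simp add: power2_norm_eq_inner inner_sum_left inner_sum_right, rule sum.swap)
  ultimately have h: "has_bochner_integral M (\<lambda>\<omega>. norm (\<Sum>i\<in>I. X i \<omega>) ^ 2)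
      (\<Sum>i\<in>I. expectation (\<lambda>\<omega>. norm (X i \<omega>) ^ 2))"
    using I by simp
  from h show "integrable M (\<lambda>\<omega>. norm (\<Sum>i\<in>I. X i \<omega>) ^ 2)"
    "expectation (\<lambda>\<omega>. norm (\<Sum>i\<in>I. X i \<omega>) ^ 2) = (\<Sum>i\<in>I. expectation (\<lambda>\<omega>. norm (X i \<omega>) ^ 2))"
    by (simp_all add: has_bochner_integral_iff)
qed

lemma (in prob_space) prob_norm_sum_ge:
  fixes X :: "nat \<Rightarrow> 'a \<Rightarrow> 'v::euclidean_space"
  assumes ind: "indep_vars (\<lambda>_. borel) X I" and I: "finite I"
    and X2: "\<And>i. i \<in> I \<Longrightarrow> integrable M (\<lambda>\<omega>. norm (X i \<omega>) ^ 2)"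
    and X0: "\<And>i a. i \<in> I \<Longrightarrow> a \<in> Basis \<Longrightarrow> expectation (\<lambda>\<omega>. X i \<omega> \<bullet> a) = 0"
    and v: "\<And>i. i \<in> I \<Longrightarrow> expectation (\<lambda>\<omega>. norm (X i \<omega>) ^ 2) \<le> v" and l: "0 < l"
  shows "prob {\<omega>\<in>space M. l \<le> norm (\<Sum>i\<in>I. X i \<omega>)} \<le> real (card I) * v / l\<^sup>2"
proof -
  note moments = second_moment_sum_indep[OF ind I X2 X0]
  have "{\<omega>\<in>space M. l \<le> norm (\<Sum>i\<in>I. X i \<omega>)} = {\<omega>\<in>space M. l\<^sup>2 \<le> norm (\<Sum>i\<in>I. X i \<omega>) ^ 2}"
    using l by (auto simp: power_mono_iff)
  then have "prob {\<omega>\<in>space M. l \<le> norm (\<Sum>i\<in>I. X i \<omega>)} \<le> expectation (\<lambda>\<omega>. norm (\<Sum>i\<in>I. X i \<omega>) ^ 2) / l\<^sup>2"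
    using integral_Markov_inequality_measure[OF moments(1), of "{}" "l\<^sup>2"] l by simp
  also have "\<dots> \<le> real (card I) * v / l\<^sup>2"
    using sum_bounded_above[of I "\<lambda>i. expectation (\<lambda>\<omega>. norm (X i \<omega>) ^ 2)" v] v moments(2)
    by (intro divide_right_mono) auto
  finally show ?thesis .
qed

text \<open>Stop at the first \<open>i\<close> at which the sum has norm at least
  \<open>2 * l\<close>. The event \<open>A i\<close> depends on the past; with probability at least
  one half the independent remainder has norm below \<open>l\<close>, and then the full sum has norm
  at least \<open>l\<close>. Hence half the probability of crossing is bounded by that of a large
  final sum.\<close>

lemma (in prob_space) ottaviani:
  fixes X :: "nat \<Rightarrow> 'a \<Rightarrow> 'v::euclidean_space"
  assumes ind: "indep_vars (\<lambda>_. borel) X {s..<s + m}"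
    and c: "\<And>i. i \<le> m \<Longrightarrow> prob {\<omega>\<in>space M. l \<le> norm (\<Sum>j=s+i..<s+m. X j \<omega>)} \<le> 1 / 2"
  shows "prob {\<omega>\<in>space M. \<exists>i\<le>m. 2 * l \<le> norm (\<Sum>j=s..<s+i. X j \<omega>)} \<le>
    2 * prob {\<omega>\<in>space M. l \<le> norm (\<Sum>j=s..<s+m. X j \<omega>)}"
proof -
  have rv: "X j \<in> borel_measurable M" if "j \<in> {s..<s+m}" for j
    using ind that by (auto simp: indep_vars_def)
  have rvS: "(\<lambda>\<omega>. \<Sum>j=s+a..<s+b. X j \<omega>) \<in> borel_measurable M" if "b \<le> m" for a b
    using that by (intro borel_measurable_sum rv) auto
  have rvS0: "(\<lambda>\<omega>. \<Sum>j=s..<s+b. X j \<omega>) \<in> borel_measurable M" if "b \<le> m" for b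
    using rvS[OF that, of 0] by simp
  define A where "A i = {\<omega>\<in>space M. 2 * l \<le> norm (\<Sum>j=s..<s+i. X j \<omega>) \<and> (\<forall>i'<i. norm (\<Sum>j=s..<s+i'. X j \<omega>) < 2 * l)}" for i
  define B where "B i = {\<omega>\<in>space M. norm (\<Sum>j=s+i..<s+m. X j \<omega>) < l}" for i
  define G where "G = {\<omega>\<in>space M. l \<le> norm (\<Sum>j=s..<s+m. X j \<omega>)}"
  have Am: "A i \<in> events" if "i \<le> m" for i
  proof -
    have 1: "{\<omega>\<in>space M. 2 * l \<le> norm (\<Sum>j=s..<s+i. X j \<omega>)} \<in> events"
      using rvS0[OF that] by measurable
    have 2: "{\<omega>\<in>space M. norm (\<Sum>j=s..<s+i'. X j \<omega>) < 2 * l} \<in> events" if "i' < i" for i'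
    proof -
      have [measurable]: "(\<lambda>\<omega>. \<Sum>j=s..<s+i'. X j \<omega>) \<in> borel_measurable M"
        using \<open>i \<le> m\<close> that by (intro rvS0) simp
      show ?thesis by measurable
    qed
    have "A i = {\<omega>\<in>space M. 2 * l \<le> norm (\<Sum>j=s..<s+i. X j \<omega>)} \<inter>
        {\<omega>\<in>space M. \<forall>i'\<in>{..<i}. norm (\<Sum>j=s..<s+i'. X j \<omega>) < 2 * l}" by (auto simp: A_def)
    moreover have "{\<omega>\<in>space M. \<forall>i'\<in>{..<i}. norm (\<Sum>j=s..<s+i'. X j \<omega>) < 2 * l} \<in> events"
      using 2 by (intro sets.sets_Collect_finite_All) auto
    ultimately show ?thesis using 1 by auto
  qed
  have Bm: "B i \<in> events" for i unfolding B_def using rvS[OF order.refl, of i] by measurable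
  have Gm: "G \<in> events" unfolding G_def using rvS0[OF order.refl] by measurable
  \<comment> \<open>The two events are preimages under the restrictions \<open>RA\<close> and
    \<open>RB\<close> of the family to disjoint index ranges, and these restrictions are
    independent.\<close>
  have indep: "prob (A i \<inter> B i) = prob (A i) * prob (B i)" if i: "i \<le> m" for i
  proof -
    let ?P = "PiM {s..<s+i} (\<lambda>_. borel :: 'v measure)" and ?Q = "PiM {s+i..<s+m} (\<lambda>_. borel :: 'v measure)"
    let ?XA = "{f\<in>space ?P. 2 * l \<le> norm (\<Sum>j=s..<s+i. f j) \<and> (\<forall>i'\<in>{..<i}. norm (\<Sum>j=s..<s+i'. f j) < 2 * l)}"
    let ?XB = "{f\<in>space ?Q. norm (\<Sum>j=s+i..<s+m. f j) < l}"
    have fP: "(\<lambda>f. \<Sum>j=s..<s+i'. f j) \<in> borel_measurable ?P" if "i' \<le> i" for i'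
      using that by (intro borel_measurable_sum measurable_component_singleton) auto
    have XA: "?XA \<in> sets ?P"
    proof -
      have 1: "{f\<in>space ?P. 2 * l \<le> norm (\<Sum>j=s..<s+i. f j)} \<in> sets ?P"
        using fP[OF order.refl] by measurable
      have 2: "{f\<in>space ?P. norm (\<Sum>j=s..<s+i'. f j) < 2 * l} \<in> sets ?P" if "i' < i" for i'
      proof -
        have [measurable]: "(\<lambda>f. \<Sum>j=s..<s+i'. f j) \<in> borel_measurable ?P"
          using that by (intro fP) simp
        show ?thesis by measurable
      qed
      have "?XA = {f\<in>space ?P. 2 * l \<le> norm (\<Sum>j=s..<s+i. f j)} \<inter>
        {f\<in>space ?P. \<forall>i'\<in>{..<i}. norm (\<Sum>j=s..<s+i'. f j) < 2 * l}" by auto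
      moreover have "{f\<in>space ?P. \<forall>i'\<in>{..<i}. norm (\<Sum>j=s..<s+i'. f j) < 2 * l} \<in> sets ?P"
        using 2 by (intro sets.sets_Collect_finite_All) auto
      ultimately show ?thesis using 1 by auto
    qed
    have fQ: "(\<lambda>f. \<Sum>j=s+i..<s+m. f j) \<in> borel_measurable ?Q"
      by (intro borel_measurable_sum measurable_component_singleton) auto
    have XB: "?XB \<in> sets ?Q" using fQ by measurable
    define RA where "RA \<omega> = restrict (\<lambda>j. X j \<omega>) {s..<s+i}" for \<omega>
    define RB where "RB \<omega> = restrict (\<lambda>j. X j \<omega>) {s+i..<s+m}" for \<omega>
    have ind2: "indep_var ?P RA ?Q RB"
      unfolding RA_def[abs_def] RB_def[abs_def] using i by (intro indep_var_restrict[OF ind]) auto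
    have sA: "(\<Sum>j=s..<s+i'. RA \<omega> j) = (\<Sum>j=s..<s+i'. X j \<omega>)" if "i' \<le> i" for i' \<omega>
      unfolding RA_def using that by (intro sum.cong) auto
    have sB: "(\<Sum>j=s+i..<s+m. RB \<omega> j) = (\<Sum>j=s+i..<s+m. X j \<omega>)" for \<omega>
      unfolding RB_def by (intro sum.cong) auto
    have spA: "RA \<omega> \<in> space ?P" "RB \<omega> \<in> space ?Q" for \<omega> by (auto simp: space_PiM RA_def RB_def)
    have "RA \<omega> \<in> ?XA \<longleftrightarrow> 2 * l \<le> norm (\<Sum>j=s..<s+i. X j \<omega>) \<and> (\<forall>i'<i. norm (\<Sum>j=s..<s+i'. X j \<omega>) < 2 * l)" for \<omega>
    proof -
      have "(\<forall>i'\<in>{..<i}. norm (\<Sum>j=s..<s+i'. RA \<omega> j) < 2 * l) \<longleftrightarrow> (\<forall>i'\<in>{..<i}. norm (\<Sum>j=s..<s+i'. X j \<omega>) < 2 * l)"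
        by (intro ball_cong refl) (simp add: sA)
      then show ?thesis using spA(1)[of \<omega>] sA[OF order.refl] by (auto simp: Ball_def)
    qed
    then have eA: "RA -` ?XA \<inter> space M = A i"
      unfolding A_def by blast
    have "RB \<omega> \<in> ?XB \<longleftrightarrow> norm (\<Sum>j=s+i..<s+m. X j \<omega>) < l" for \<omega>
      using spA(2)[of \<omega>] sB by simp
    then have eB: "RB -` ?XB \<inter> space M = B i"
      unfolding B_def by blast
    have "(\<lambda>x. (RA x, RB x)) -` (?XA \<times> ?XB) \<inter> space M = A i \<inter> B i"
      unfolding eA[symmetric] eB[symmetric] by blast
    then show ?thesis using indep_varD[OF ind2 XA XB] unfolding eA eB by simp
  qed
  have half: "prob (A i) / 2 \<le> prob (A i \<inter> B i)" if i: "i \<le> m" for i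
  proof -
    have "B i = space M - {\<omega>\<in>space M. l \<le> norm (\<Sum>j=s+i..<s+m. X j \<omega>)}" by (auto simp: B_def)
    moreover have "{\<omega>\<in>space M. l \<le> norm (\<Sum>j=s+i..<s+m. X j \<omega>)} \<in> events" using rvS[OF order.refl, of i] by measurable
    ultimately have "1 / 2 \<le> prob (B i)" using c[OF i] prob_compl by simp
    then have "prob (A i) * (1 / 2) \<le> prob (A i) * prob (B i)" by (intro mult_left_mono) auto
    then show ?thesis using indep[OF i] by simp
  qed
  have AA: "A i \<inter> A i' = {}" if "i < i'" for i i'
  proof (rule equals0I)
    fix \<omega> assume "\<omega> \<in> A i \<inter> A i'"
    then have "2 * l \<le> norm (\<Sum>j=s..<s+i. X j \<omega>)" "norm (\<Sum>j=s..<s+i. X j \<omega>) < 2 * l"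
      using that unfolding A_def by blast+
    then show False by linarith
  qed
  have disj: "disjoint_family_on A {..m}"
    unfolding disjoint_family_on_def by (metis AA Int_commute linorder_neqE_nat)
  then have disj': "disjoint_family_on (\<lambda>i. A i \<inter> B i) {..m}"
    unfolding disjoint_family_on_def by blast
  have "{\<omega>\<in>space M. \<exists>i\<le>m. 2 * l \<le> norm (\<Sum>j=s..<s+i. X j \<omega>)} \<subseteq> (\<Union>i\<le>m. A i)"
  proof safe
    fix \<omega> i assume \<omega>: "\<omega> \<in> space M" and i: "i \<le> m" "2 * l \<le> norm (\<Sum>j=s..<s+i. X j \<omega>)"
    define k where "k = (LEAST i. 2 * l \<le> norm (\<Sum>j=s..<s+i. X j \<omega>))"
    have "2 * l \<le> norm (\<Sum>j=s..<s+k. X j \<omega>)" "k \<le> i" unfolding k_def using i(2)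
      by (auto intro: LeastI Least_le)
    moreover have "norm (\<Sum>j=s..<s+i'. X j \<omega>) < 2 * l" if "i' < k" for i'
      using not_less_Least[OF that[unfolded k_def]] by (simp add: not_le)
    ultimately show "\<omega> \<in> (\<Union>i\<le>m. A i)" using \<omega> i(1) by (auto simp: A_def intro!: bexI[of _ k])
  qed
  then have "prob {\<omega>\<in>space M. \<exists>i\<le>m. 2 * l \<le> norm (\<Sum>j=s..<s+i. X j \<omega>)} \<le> prob (\<Union>i\<le>m. A i)"
    using Am by (intro finite_measure_mono sets.finite_UN) auto
  also have "\<dots> = (\<Sum>i\<le>m. prob (A i))"
    by (rule finite_measure_finite_Union[OF _ _ disj]) (use Am in auto)
  also have "\<dots> \<le> (\<Sum>i\<le>m. 2 * prob (A i \<inter> B i))"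
  proof (rule sum_mono)
    fix i assume "i \<in> {..m}"
    then show "prob (A i) \<le> 2 * prob (A i \<inter> B i)" using half[of i] by simp
  qed
  also have "\<dots> = 2 * prob (\<Union>i\<le>m. A i \<inter> B i)"
    unfolding sum_distrib_left[symmetric]
    by (subst finite_measure_finite_Union[OF _ _ disj']) (use Am Bm in auto)
  also have "prob (\<Union>i\<le>m. A i \<inter> B i) \<le> prob G"
  proof (rule finite_measure_mono[OF _ Gm], safe)
    fix \<omega> i assume i: "i \<le> m" and \<omega>: "\<omega> \<in> A i" "\<omega> \<in> B i"
    have "{s..<s+m} = {s..<s+i} \<union> {s+i..<s+m}" using i by auto
    then have "(\<Sum>j=s..<s+m. X j \<omega>) = (\<Sum>j=s..<s+i. X j \<omega>) + (\<Sum>j=s+i..<s+m. X j \<omega>)"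
      by (simp add: sum.union_disjoint ivl_disj_int)
    then have "norm (\<Sum>j=s..<s+i. X j \<omega>) \<le> norm (\<Sum>j=s..<s+m. X j \<omega>) + norm (\<Sum>j=s+i..<s+m. X j \<omega>)"
      by (metis add_diff_cancel_right' norm_triangle_ineq4)
    then show "\<omega> \<in> G" using \<omega> by (auto simp: A_def B_def G_def)
  qed
  finally show ?thesis unfolding G_def by simp
qed

section \<open>Increments of Brownian motion\<close>

lemma Basis_vec_real: "(Basis :: (real ^ 'n) set) = (\<lambda>j. axis j 1) ` UNIV"
  by (auto simp: Basis_vec_def)

lemma norm_vec_square: "norm (x :: real ^ 'n) ^ 2 = (\<Sum>j\<in>UNIV. (x $ j) ^ 2)"
  unfolding power2_norm_eq_inner inner_vec_def by (simp add: power2_eq_square)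

lemma norm_power4_le_sum:
  fixes x :: "real ^ 'n"
  shows "norm x ^ 4 \<le> real CARD('n) * (\<Sum>j\<in>UNIV. (x $ j) ^ 4)"
proof -
  have "norm x ^ 4 = (norm x ^ 2) ^ 2" by simp
  also have "norm x ^ 2 = (\<Sum>j\<in>UNIV. (x $ j) ^ 2)" by (rule norm_vec_square)
  also have "(\<Sum>j\<in>UNIV. (x $ j) ^ 2) ^ 2 \<le> real CARD('n) * (\<Sum>j\<in>UNIV. ((x $ j) ^ 2) ^ 2)"
    using sum_squared_le_sum_of_squares[of "\<lambda>j. (x $ j) ^ 2" "UNIV :: 'n set"] by (simp add: mult.commute)
  finally show ?thesis by simp
qed

lemma distributed_normal_moments:
  assumes d: "distributed N lborel X (normal_density 0 \<sigma>)" and s: "0 < \<sigma>"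
  shows "integrable N (\<lambda>\<omega>. X \<omega> :: real)" "(\<integral>\<omega>. X \<omega> \<partial>N) = 0"
    "integrable N (\<lambda>\<omega>. X \<omega> ^ 2)" "(\<integral>\<omega>. X \<omega> ^ 2 \<partial>N) = \<sigma>\<^sup>2"
    "integrable N (\<lambda>\<omega>. X \<omega> ^ 4)" "(\<integral>\<omega>. X \<omega> ^ 4 \<partial>N) = 3 * (\<sigma>\<^sup>2)\<^sup>2"
proof -
  have i: "integrable N (\<lambda>\<omega>. X \<omega> ^ k)" for k
    using distributed_integrable[OF d, of "\<lambda>x. x ^ k"] integrable_normal_moment[OF s, of 0 k]
    by simp
  have e: "(\<integral>\<omega>. X \<omega> ^ k \<partial>N) = (\<integral>x. normal_density 0 \<sigma> x * x ^ k \<partial>lborel)" for k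
    using distributed_integral[OF d, of "\<lambda>x. x ^ k"] by simp
  show "integrable N (\<lambda>\<omega>. X \<omega>)" "integrable N (\<lambda>\<omega>. X \<omega> ^ 2)" "integrable N (\<lambda>\<omega>. X \<omega> ^ 4)"
    using i[of 1] i[of 2] i[of 4] by simp_all
  show "(\<integral>\<omega>. X \<omega> \<partial>N) = 0" using e[of 1] integral_normal_moment_odd[OF s, of 0 0] by simp
  show "(\<integral>\<omega>. X \<omega> ^ 2 \<partial>N) = \<sigma>\<^sup>2" using e[of 2] integral_normal_moment_even[OF s, of 0 1] by simp
  have "fact 4 = (24 :: real)" by (simp add: fact_numeral)
  then show "(\<integral>\<omega>. X \<omega> ^ 4 \<partial>N) = 3 * (\<sigma>\<^sup>2)\<^sup>2"
    using e[of 4] integral_normal_moment_even[OF s, of 0 2] by (simp add: power_divide field_simps)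
qed

text \<open>The Gaussian replacements for the scaled steps of the walk.\<close>

abbreviation brownian_steps ::
  "(real \<Rightarrow> 'b \<Rightarrow> real ^ 'm) \<Rightarrow> real ^ 'm ^ 'm \<Rightarrow> nat \<Rightarrow> nat \<Rightarrow> 'b \<Rightarrow> real ^ 'm" where
  "brownian_steps b R n \<equiv> \<lambda>i \<omega>. R *v (b (real (Suc i) / real n) \<omega> - b (real i / real n) \<omega>)"

context
  fixes N :: "'b measure" and b :: "real \<Rightarrow> 'b \<Rightarrow> real ^ 'm"
  assumes bm: "standard_brownian_motion01 N b"
begin

interpretation N: prob_space N
  using bm by (simp add: standard_brownian_motion01_def)

lemma brownian_measurable: "0 \<le> t \<Longrightarrow> t \<le> 1 \<Longrightarrow> b t \<in> borel_measurable N"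
  using bm by (auto simp: standard_brownian_motion01_def)

lemma brownian_0: "\<omega> \<in> space N \<Longrightarrow> b 0 \<omega> = 0"
  using bm by (auto simp: standard_brownian_motion01_def)

lemma brownian_continuous: "\<omega> \<in> space N \<Longrightarrow> continuous_on {0..1} (\<lambda>t. b t \<omega>)"
  using bm by (auto simp: standard_brownian_motion01_def)

lemma brownian_increment_distributed:
  assumes "0 \<le> s" "s < t" "t \<le> 1"
  shows "distributed N lborel (\<lambda>\<omega>. (b t \<omega> - b s \<omega>) $ j) (normal_density 0 (sqrt (t - s)))"
    "N.indep_vars (\<lambda>_. borel) (\<lambda>j \<omega>. (b t \<omega> - b s \<omega>) $ j) UNIV"
  using bm assms unfolding standard_brownian_motion01_def by blast+

text \<open>In the fourth moment, \<open>3\<close> is the Gaussian constant; one factor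
  \<open>CARD('m)\<close> stems from Cauchy--Schwarz in \<open>norm_power4_le_sum\<close>, the other
  from summing over the coordinates. The square of \<open>t - s\<close> is what later beats the
  number of blocks.\<close>

lemma brownian_increment_moments:
  assumes st: "0 \<le> s" "s < t" "t \<le> 1"
  shows "has_bochner_integral N (\<lambda>\<omega>. (b t \<omega> - b s \<omega>) $ j) 0"
    "has_bochner_integral N (\<lambda>\<omega>. (b t \<omega> - b s \<omega>) $ j * (b t \<omega> - b s \<omega>) $ l) (if j = l then t - s else 0)"
    "integrable N (\<lambda>\<omega>. norm (b t \<omega> - b s \<omega>) ^ 4)"
    "(\<integral>\<omega>. norm (b t \<omega> - b s \<omega>) ^ 4 \<partial>N) \<le> 3 * real CARD('m) ^ 2 * (t - s)\<^sup>2"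
proof -
  let ?D = "\<lambda>\<omega>. b t \<omega> - b s \<omega>"
  have sq: "0 < sqrt (t - s)" and [simp]: "(sqrt (t - s))\<^sup>2 = t - s" using st by auto
  note m = distributed_normal_moments[OF brownian_increment_distributed(1)[OF st] sq]
  show "has_bochner_integral N (\<lambda>\<omega>. ?D \<omega> $ j) 0" using m(1,2) by (simp add: has_bochner_integral_iff)
  show "has_bochner_integral N (\<lambda>\<omega>. ?D \<omega> $ j * ?D \<omega> $ l) (if j = l then t - s else 0)"
  proof (cases "j = l")
    case True
    then show ?thesis using m(3,4)[of j] st by (simp add: has_bochner_integral_iff power2_eq_square)
  next
    case False
    have ind: "N.indep_vars (\<lambda>_. borel) (\<lambda>j \<omega>. ?D \<omega> $ j) {j, l}"
      by (rule N.indep_vars_subset[OF brownian_increment_distributed(2)[OF st]]) simp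
    have int: "integrable N (\<lambda>\<omega>. ?D \<omega> $ i)" for i using m(1) by simp
    have "integrable N (\<lambda>\<omega>. \<Prod>i\<in>{j, l}. ?D \<omega> $ i)"
      "(\<integral>\<omega>. (\<Prod>i\<in>{j, l}. ?D \<omega> $ i) \<partial>N) = (\<Prod>i\<in>{j, l}. \<integral>\<omega>. ?D \<omega> $ i \<partial>N)"
      using N.indep_vars_integrable[OF _ ind int] N.indep_vars_lebesgue_integral[OF _ ind int] by auto
    then show ?thesis using False m(2)[of j] by (simp add: has_bochner_integral_iff)
  qed
  have "integrable N (\<lambda>\<omega>. real CARD('m) * (\<Sum>j\<in>UNIV. (?D \<omega> $ j) ^ 4))" using m(5) by auto
  moreover have meas: "(\<lambda>\<omega>. norm (?D \<omega>) ^ 4) \<in> borel_measurable N"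
    using brownian_measurable[of s] brownian_measurable[of t] st by auto
  ultimately show int4: "integrable N (\<lambda>\<omega>. norm (?D \<omega>) ^ 4)"
    by (rule Bochner_Integration.integrable_bound) (auto intro!: AE_I2 order_trans[OF norm_power4_le_sum] simp: sum_nonneg)
  have "(\<integral>\<omega>. norm (?D \<omega>) ^ 4 \<partial>N) \<le> (\<integral>\<omega>. real CARD('m) * (\<Sum>j\<in>UNIV. (?D \<omega> $ j) ^ 4) \<partial>N)"
    using int4 m(5) by (intro integral_mono norm_power4_le_sum) auto
  also have "\<dots> = real CARD('m) * (\<Sum>j\<in>(UNIV :: 'm set). 3 * (t - s)\<^sup>2)"
    using m(5,6) by (simp add: Bochner_Integration.integral_sum)
  finally show "(\<integral>\<omega>. norm (?D \<omega>) ^ 4 \<partial>N) \<le> 3 * real CARD('m) ^ 2 * (t - s)\<^sup>2"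
    by (simp add: power2_eq_square mult_ac)
qed

lemma brownian_image_increment_moments:
  fixes R :: "real ^ 'm ^ 'm"
  assumes st: "0 \<le> s" "s < t" "t \<le> 1" and K: "\<And>x. norm (R *v x) \<le> K * norm x"
  shows "integrable N (\<lambda>\<omega>. norm (R *v (b t \<omega> - b s \<omega>)) ^ 2)"
    "(\<integral>\<omega>. (R *v (b t \<omega> - b s \<omega>)) $ j \<partial>N) = 0"
    "(\<integral>\<omega>. (R *v (b t \<omega> - b s \<omega>)) $ j * (R *v (b t \<omega> - b s \<omega>)) $ l \<partial>N) = (t - s) * (R ** transpose R) $ j $ l"
    "integrable N (\<lambda>\<omega>. norm (R *v (b t \<omega> - b s \<omega>)) ^ 4)"
    "(\<integral>\<omega>. norm (R *v (b t \<omega> - b s \<omega>)) ^ 4 \<partial>N) \<le> K ^ 4 * (3 * real CARD('m) ^ 2) * (t - s)\<^sup>2"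
proof -
  let ?D = "\<lambda>\<omega>. b t \<omega> - b s \<omega>"
  note m = brownian_increment_moments[OF st]
  have Dm [measurable]: "?D \<in> borel_measurable N"
    using brownian_measurable[of s] brownian_measurable[of t] st by auto
  have [measurable]: "(\<lambda>\<omega>. R *v ?D \<omega>) \<in> borel_measurable N"
    by (rule measurable_compose[OF Dm borel_measurable_continuous_onI]) (rule matrix_vector_mult_linear_continuous_on)
  have K4: "norm (R *v x) ^ 4 \<le> K ^ 4 * norm x ^ 4" for x
    using power_mono[OF K[of x], of 4] by (simp add: power_mult_distrib)
  show i4: "integrable N (\<lambda>\<omega>. norm (R *v ?D \<omega>) ^ 4)"
  proof (rule Bochner_Integration.integrable_bound)
    show "integrable N (\<lambda>\<omega>. K ^ 4 * norm (?D \<omega>) ^ 4)" using m(3) by simp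
  qed (auto intro!: AE_I2 order_trans[OF K4])
  have "(\<integral>\<omega>. norm (R *v ?D \<omega>) ^ 4 \<partial>N) \<le> (\<integral>\<omega>. K ^ 4 * norm (?D \<omega>) ^ 4 \<partial>N)"
    using i4 m(3) K4 by (intro integral_mono) auto
  also have "\<dots> = K ^ 4 * (\<integral>\<omega>. norm (?D \<omega>) ^ 4 \<partial>N)" by simp
  also have "\<dots> \<le> K ^ 4 * (3 * real CARD('m) ^ 2 * (t - s)\<^sup>2)"
    by (rule mult_left_mono[OF m(4)]) simp
  finally show "(\<integral>\<omega>. norm (R *v ?D \<omega>) ^ 4 \<partial>N) \<le> K ^ 4 * (3 * real CARD('m) ^ 2) * (t - s)\<^sup>2" by (simp add: mult.assoc)
  show "integrable N (\<lambda>\<omega>. norm (R *v ?D \<omega>) ^ 2)"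
  proof (rule Bochner_Integration.integrable_bound)
    show "integrable N (\<lambda>\<omega>. 1 + norm (R *v ?D \<omega>) ^ 4)" using i4 by simp
    have "x ^ 2 \<le> 1 + x ^ 4" for x :: real using le_one_plus_square[of "x\<^sup>2"] by simp
    then show "AE \<omega> in N. norm (norm (R *v ?D \<omega>) ^ 2) \<le> norm (1 + norm (R *v ?D \<omega>) ^ 4)" by simp
  qed measurable
  have Rj: "(R *v x) $ j = (\<Sum>c\<in>UNIV. R $ j $ c * x $ c)" for x j by (simp add: matrix_vector_mult_def)
  have "has_bochner_integral N (\<lambda>\<omega>. (R *v ?D \<omega>) $ j) (\<Sum>c\<in>(UNIV :: 'm set). R $ j $ c * 0)"
    unfolding Rj by (intro has_bochner_integral_sum has_bochner_integral_mult_right m(1))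
  then show "(\<integral>\<omega>. (R *v ?D \<omega>) $ j \<partial>N) = 0" by (simp add: has_bochner_integral_iff)
  have "has_bochner_integral N (\<lambda>\<omega>. \<Sum>c\<in>UNIV. \<Sum>c'\<in>UNIV. (R $ j $ c * R $ l $ c') * (?D \<omega> $ c * ?D \<omega> $ c'))
      (\<Sum>c\<in>UNIV. \<Sum>c'\<in>UNIV. (R $ j $ c * R $ l $ c') * (if c = c' then t - s else 0))"
    by (intro has_bochner_integral_sum has_bochner_integral_mult_right m(2))
  moreover have "(\<lambda>\<omega>. \<Sum>c\<in>UNIV. \<Sum>c'\<in>UNIV. (R $ j $ c * R $ l $ c') * (?D \<omega> $ c * ?D \<omega> $ c')) =
      (\<lambda>\<omega>. (R *v ?D \<omega>) $ j * (R *v ?D \<omega>) $ l)"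
    unfolding Rj by (simp add: sum_product mult_ac)
  moreover have "(\<Sum>c\<in>UNIV. \<Sum>c'\<in>UNIV. (R $ j $ c * R $ l $ c') * (if c = c' then t - s else 0)) =
      (t - s) * (R ** transpose R) $ j $ l"
    by (simp add: matrix_matrix_mult_def transpose_def if_distrib[of "(*) _"] sum_distrib_left mult_ac cong: if_cong)
  ultimately show "(\<integral>\<omega>. (R *v ?D \<omega>) $ j * (R *v ?D \<omega>) $ l \<partial>N) = (t - s) * (R ** transpose R) $ j $ l"
    by (simp add: has_bochner_integral_iff)
qed

lemma brownian_image_increments_indep:
  fixes R :: "real ^ 'm ^ 'm"
  assumes "0 < n"
  shows "N.indep_vars (\<lambda>_. borel) (brownian_steps b R n) {..<n}"
proof -
  have sm: "strict_mono_on {..n} (\<lambda>i. real i / real n) \<and> (\<lambda>i. real i / real n) ` {..n} \<subseteq> {0..1}"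
    using assms by (auto simp: strict_mono_on_def divide_strict_right_mono)
  have "N.indep_vars (\<lambda>_. borel) (\<lambda>i \<omega>. b (real (Suc i) / real n) \<omega> - b (real i / real n) \<omega>) {..<n}"
    using bm sm unfolding standard_brownian_motion01_def by blast
  then show ?thesis
    by (rule N.indep_vars_compose2[where Y="\<lambda>_ x. R *v x"])
      (auto intro!: borel_measurable_continuous_onI matrix_vector_mult_linear_continuous_on)
qed

end

section \<open>Joint convergence of the block increments\<close>

definition grid :: "nat \<Rightarrow> nat \<Rightarrow> nat \<Rightarrow> nat" where
  "grid n k j = (j * n) div k"

text \<open>For \<open>n > 0\<close> this is the ceiling of \<open>(i + 1) * k / n\<close>, minus
  one. The shift matches the rounding down in \<open>grid\<close>: \<open>grid n k j \<le> i\<close>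
  holds exactly if \<open>j * n < Suc i * k\<close>, that is
  \<open>j * n \<le> Suc i * k - 1\<close>.\<close>

definition block_index :: "nat \<Rightarrow> nat \<Rightarrow> nat \<Rightarrow> nat" where
  "block_index n k i = (Suc i * k - 1) div n"

lemma block_index_less: "i < n \<Longrightarrow> 0 < k \<Longrightarrow> block_index n k i < k"
proof -
  assume "i < n" "0 < k"
  then have "Suc i * k \<le> k * n" "0 < Suc i * k"
    using mult_le_mono1[of "Suc i" n k] by (simp_all add: Suc_le_eq mult.commute[of k n] del: mult_Suc)
  then have "Suc i * k - 1 < k * n" by linarith
  then show ?thesis using \<open>i < n\<close> by (simp add: block_index_def div_less_iff_less_mult)
qed

lemma grid_k: "0 < k \<Longrightarrow> grid n k k = n"
  by (simp add: grid_def)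

lemma grid_0 [simp]: "grid n k 0 = 0"
  by (simp add: grid_def)

lemma grid_mono: "i \<le> j \<Longrightarrow> grid n k i \<le> grid n k j"
  unfolding grid_def by (intro div_le_mono mult_le_mono1)

lemma grid_le: "0 < k \<Longrightarrow> j \<le> k \<Longrightarrow> grid n k j \<le> n"
  using grid_mono[of j k n k] grid_k by simp

lemma block_index_eq_iff:
  assumes "0 < n" "0 < k"
  shows "block_index n k i = j \<longleftrightarrow> grid n k j \<le> i \<and> i < grid n k (Suc j)"
proof -
  have pos: "0 < Suc i * k" using assms by simp
  have "block_index n k i = j \<longleftrightarrow> j * n \<le> Suc i * k - 1 \<and> Suc i * k - 1 < Suc j * n"
    unfolding block_index_def using assms(1)
    by (metis div_less_iff_less_mult le_antisym less_Suc_eq_le less_eq_div_iff_mult_less_eq order.refl)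
  also have "j * n \<le> Suc i * k - 1 \<longleftrightarrow> j * n < Suc i * k" using pos by linarith
  also have "\<dots> \<longleftrightarrow> grid n k j < Suc i"
    unfolding grid_def using assms(2) by (simp add: div_less_iff_less_mult)
  also have "Suc i * k - 1 < Suc j * n \<longleftrightarrow> Suc i * k \<le> Suc j * n" using pos by linarith
  also have "\<dots> \<longleftrightarrow> Suc i \<le> grid n k (Suc j)"
    unfolding grid_def using assms(2) by (simp add: less_eq_div_iff_mult_less_eq del: mult_Suc)
  finally show ?thesis by auto
qed

lemma block_sum_block_index:
  assumes "0 < n" "0 < k"
  shows "block_sum (block_index n k) X n \<omega> j = (if j < k then \<Sum>i=grid n k j..<grid n k (Suc j). X i \<omega> else 0)"
proof (cases "j < k")
  case True
  have "{i. i < n \<and> block_index n k i = j} = {grid n k j..<grid n k (Suc j)}"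
    using grid_le[OF assms(2), of "Suc j" n] True by (auto simp: block_index_eq_iff[OF assms])
  then show ?thesis using True by (simp add: block_sum_def)
next
  case False
  then have "{i. i < n \<and> block_index n k i = j} = {}" using block_index_less[OF _ assms(2)] by auto
  then show ?thesis using False by (simp only: block_sum_def sum.empty if_False)
qed

lemma grid_real_bounds:
  assumes "0 < k"
  shows "real (j * n) / real k - 1 \<le> real (grid n k j)" "real (grid n k j) \<le> real (j * n) / real k"
proof -
  have "real (j * n) = real (grid n k j) * real k + real (j * n mod k)"
    unfolding grid_def by (metis div_mult_mod_eq of_nat_add of_nat_mult)
  then have "real (j * n) / real k = real (grid n k j) + real (j * n mod k) / real k"
    using assms by (simp add: field_simps)
  moreover have "real (j * n mod k) / real k \<le> 1" "0 \<le> real (j * n mod k) / real k"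
    using assms by (simp_all add: divide_le_eq less_imp_le)
  ultimately show "real (j * n) / real k - 1 \<le> real (grid n k j)" "real (grid n k j) \<le> real (j * n) / real k"
    by linarith+
qed

lemma grid_tendsto:
  assumes "0 < k"
  shows "(\<lambda>n. real (grid n k j) / real n) \<longlonglongrightarrow> real j / real k"
proof -
  have "norm (real (grid n k j) / real n - real j / real k) \<le> 1 / real n" if "0 < n" for n
  proof -
    have "\<bar>real (grid n k j) - real (j * n) / real k\<bar> \<le> 1"
      using grid_real_bounds(1)[OF assms, of j n] grid_real_bounds(2)[OF assms, of n j] by linarith
    moreover have "real (grid n k j) / real n - real j / real k = (real (grid n k j) - real (j * n) / real k) / real n"
      using that assms by (simp add: field_simps)
    ultimately show ?thesis using that by (simp add: abs_divide divide_right_mono)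
  qed
  then have "(\<lambda>n. real (grid n k j) / real n - real j / real k) \<longlonglongrightarrow> 0"
    by (intro Lim_null_comparison[OF _ lim_inverse_n'] eventually_sequentiallyI[of 1]) (auto simp: inverse_eq_divide)
  then show ?thesis by (simp add: LIM_zero_iff)
qed

lemma tendsto_product_topology:
  fixes f :: "'c \<Rightarrow> 'i \<Rightarrow> 'v::topological_space"
  assumes "\<And>j. ((\<lambda>n. f n j) \<longlongrightarrow> l j) F"
  shows "(f \<longlongrightarrow> l) F"
proof -
  have "limitin (product_topology (\<lambda>_. euclidean) UNIV) f l F"
    using assms by (simp add: limitin_componentwise)
  then show ?thesis by (simp add: euclidean_product_topology)
qed

lemma min_power_scaled:
  fixes v :: "'v::real_normed_vector"
  assumes "0 < n"
  shows "capped (v /\<^sub>R sqrt (real n)) =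
    capped_at n v / real n"
proof -
  have "sqrt (real n) ^ 3 = sqrt (real n) * real n" by (simp add: power3_eq_cube)
  then have "norm (v /\<^sub>R sqrt (real n)) ^ 2 = norm v ^ 2 / real n"
    "norm (v /\<^sub>R sqrt (real n)) ^ 3 = norm v ^ 3 / sqrt (real n) / real n"
    by (simp_all add: power_mult_distrib power_inverse field_simps power_divide)
  then show ?thesis using assms by (simp add: min_divide_distrib_right)
qed

text \<open>The arithmetic-geometric mean inequality for \<open>d * x ^ 2\<close> and
  \<open>x ^ 4 / d\<close>, whose geometric mean is the cube; it replaces third absolute moments by
  even ones.\<close>

lemma min_power_le:
  fixes x d :: real
  assumes "0 < d"
  shows "min (x ^ 2) (x ^ 3) \<le> (d * x ^ 2 + x ^ 4 / d) / 2"
proof -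
  have "0 \<le> (x\<^sup>2 / d) * (x - d)\<^sup>2" using assms by simp
  also have "(x\<^sup>2 / d) * (x - d)\<^sup>2 = x ^ 4 / d - 2 * x ^ 3 + d * x ^ 2"
    using assms by (simp add: field_simps power2_eq_square power_numeral_reduce)
  finally show ?thesis by (simp add: min_le_iff_disj)
qed

definition block_increments :: "(nat \<Rightarrow> 'a \<Rightarrow> 'v::euclidean_space) \<Rightarrow> nat \<Rightarrow> nat \<Rightarrow> 'a \<Rightarrow> nat \<Rightarrow> 'v" where
  "block_increments \<eta> k n = block_sum (block_index n k) (\<lambda>i \<omega>. \<eta> i \<omega> /\<^sub>R sqrt (real n)) n"

definition brownian_increments ::
  "(real \<Rightarrow> 'b \<Rightarrow> real ^ 'm) \<Rightarrow> real ^ 'm ^ 'm \<Rightarrow> nat \<Rightarrow> 'b \<Rightarrow> nat \<Rightarrow> real ^ 'm" where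
  "brownian_increments b R k \<omega> j =
     (if j < k then R *v (b (real (Suc j) / real k) \<omega> - b (real j / real k) \<omega>) else 0)"

lemma measurable_matrix_image:
  fixes R :: "real ^ 'm ^ 'm"
  assumes "f \<in> borel_measurable N"
  shows "(\<lambda>\<omega>. R *v f \<omega>) \<in> borel_measurable N"
  by (rule measurable_compose[OF assms borel_measurable_continuous_onI]) (rule matrix_vector_mult_linear_continuous_on)

lemma measurable_brownian_increments:
  assumes bm: "standard_brownian_motion01 N b"
  shows "brownian_increments b R k \<in> borel_measurable N"
proof (rule measurable_coordinatewise_then_product)
  fix j
  have "(\<lambda>\<omega>. R *v (b (real (Suc j) / real k) \<omega> - b (real j / real k) \<omega>)) \<in> borel_measurable N" if "j < k"
    using that by (intro measurable_matrix_image borel_measurable_diff brownian_measurable[OF bm]) auto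
  then show "(\<lambda>\<omega>. brownian_increments b R k \<omega> j) \<in> borel_measurable N"
    by (cases "j < k") (simp_all add: brownian_increments_def)
qed

lemma identically_distributed_integral:
  fixes f :: "'c \<Rightarrow> real"
  assumes [measurable]: "X \<in> M \<rightarrow>\<^sub>M K" "Y \<in> M \<rightarrow>\<^sub>M K" "f \<in> borel_measurable K"
    and eq: "distr M K X = distr M K Y"
  shows "(\<integral>\<omega>. f (X \<omega>) \<partial>M) = (\<integral>\<omega>. f (Y \<omega>) \<partial>M)"
    "integrable M (\<lambda>\<omega>. f (X \<omega>)) \<longleftrightarrow> integrable M (\<lambda>\<omega>. f (Y \<omega>))"
proof -
  show "(\<integral>\<omega>. f (X \<omega>) \<partial>M) = (\<integral>\<omega>. f (Y \<omega>) \<partial>M)"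
    using integral_distr[OF assms(1,3)] integral_distr[OF assms(2,3)] by (simp add: eq)
  show "integrable M (\<lambda>\<omega>. f (X \<omega>)) \<longleftrightarrow> integrable M (\<lambda>\<omega>. f (Y \<omega>))"
    using integrable_distr_eq[OF assms(1,3)] integrable_distr_eq[OF assms(2,3)] by (simp add: eq)
qed

section \<open>A centred walk with covariance \<open>S\<close> and Brownian motion transformed by a
  root of \<open>S\<close>\<close>

context
  fixes M :: "'a measure" and \<eta> :: "nat \<Rightarrow> 'a \<Rightarrow> real ^ 'm" and N :: "'b measure" and b :: "real \<Rightarrow> 'b \<Rightarrow> real ^ 'm"
    and R S :: "real ^ 'm ^ 'm"
  assumes M: "prob_space M" and ind: "prob_space.indep_vars M (\<lambda>_. borel) \<eta> UNIV"
    and id: "\<And>i. distr M borel (\<eta> i) = distr M borel (\<eta> 0)"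
    and sq: "integrable M (\<lambda>\<omega>. norm (\<eta> 0 \<omega>) ^ 2)"
    and mean: "\<And>j. (\<integral>\<omega>. \<eta> 0 \<omega> $ j \<partial>M) = 0"
    and cov: "\<And>j l. (\<integral>\<omega>. \<eta> 0 \<omega> $ j * \<eta> 0 \<omega> $ l \<partial>M) = S $ j $ l"
    and bm: "standard_brownian_motion01 N b" and R: "R ** transpose R = S"
begin

interpretation M: prob_space M by (rule M)
interpretation N: prob_space N using bm by (simp add: standard_brownian_motion01_def)

lemma eta_measurable [measurable]: "\<eta> i \<in> borel_measurable M"
  using ind by (auto simp: M.indep_vars_def)

lemma eta_integral:
  fixes f :: "real ^ 'm \<Rightarrow> real"
  assumes [measurable]: "f \<in> borel_measurable borel"
  shows "(\<integral>\<omega>. f (\<eta> i \<omega>) \<partial>M) = (\<integral>\<omega>. f (\<eta> 0 \<omega>) \<partial>M)"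
    "integrable M (\<lambda>\<omega>. f (\<eta> i \<omega>)) \<longleftrightarrow> integrable M (\<lambda>\<omega>. f (\<eta> 0 \<omega>))"
  by (rule identically_distributed_integral[OF eta_measurable eta_measurable assms id])+

lemma measurable_block_increments: "block_increments \<eta> k n \<in> borel_measurable M"
  unfolding block_increments_def by (rule measurable_block_sum) measurable

text \<open>The Lindeberg condition. The cubic branch tends to \<open>0\<close> pointwise, while the
  quadratic branch is an integrable dominating function by the second-moment hypothesis.\<close>

lemma lindeberg_error_tendsto_0:
  "(\<lambda>n. \<integral>\<omega>. capped_at n (\<eta> 0 \<omega>) \<partial>M) \<longlonglongrightarrow> 0"
proof -
  have "(\<lambda>n. \<integral>\<omega>. capped_at n (\<eta> 0 \<omega>) \<partial>M) \<longlonglongrightarrow> (\<integral>\<omega>. 0 \<partial>M)"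
  proof (rule integral_dominated_convergence[where w="\<lambda>\<omega>. norm (\<eta> 0 \<omega>) ^ 2"])
    have "(\<lambda>n. min (x ^ 2) (x ^ 3 / sqrt (real n))) \<longlonglongrightarrow> 0" for x :: real
    proof -
      have "(\<lambda>n. x ^ 3 / sqrt (real n)) \<longlonglongrightarrow> 0"
        by (intro tendsto_divide_0[OF tendsto_const] filterlim_at_top_imp_at_infinity
            filterlim_compose[OF sqrt_at_top filterlim_real_sequentially])
      then have "(\<lambda>n. min (x ^ 2) (x ^ 3 / sqrt (real n))) \<longlonglongrightarrow> min (x ^ 2) 0"
        by (intro tendsto_min tendsto_const)
      then show ?thesis by (simp add: min_absorb2)
    qed
    then show "AE \<omega> in M. (\<lambda>n. capped_at n (\<eta> 0 \<omega>)) \<longlonglongrightarrow> 0" by auto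
  qed (use sq in auto)
  then show ?thesis by simp
qed

text \<open>Both kinds of steps have mean zero and covariance \<open>S / n\<close>. Each exchange
  costs \<open>1 / n\<close> times the bracket, up to a constant, and there are \<open>n\<close> of
  them.\<close>

lemma block_increments_lindeberg:
  assumes H: "test_function H"
  obtains C where "\<And>n. 0 < n \<Longrightarrow> \<bar>(\<integral>\<omega>. H (block_increments \<eta> k n \<omega>) \<partial>M) -
      (\<integral>\<omega>. H (block_sum (block_index n k) (brownian_steps b R n) n \<omega>) \<partial>N)\<bar> \<le>
    C * ((\<integral>\<omega>. capped_at n (\<eta> 0 \<omega>) \<partial>M) + 1 / sqrt (real n))"
proof -
  obtain K where K: "\<And>x. norm (R *v x) \<le> K * norm x"
    using bounded_linear.bounded[OF matrix_vector_mul_bounded_linear, of R] by (auto simp: mult.commute)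
  \<comment> \<open>The first part bounds \<open>n\<close> times the second moment of a Brownian
    replacement, through the trace of \<open>S\<close>; the second bounds \<open>n^2\<close> times
    its fourth moment.\<close>
  define K2 where "K2 = (\<Sum>j\<in>UNIV. \<bar>S $ j $ j\<bar>) + K ^ 4 * (3 * real CARD('m) ^ 2)"
  have K2: "0 \<le> K2" unfolding K2_def by (intro add_nonneg_nonneg sum_nonneg) auto
  obtain C where C: "\<And>n \<beta> (X :: nat \<Rightarrow> 'a \<Rightarrow> real ^ 'm) (X' :: nat \<Rightarrow> 'b \<Rightarrow> real ^ 'm) M N.
    \<lbrakk>prob_space M; prob_space N;
     prob_space.indep_vars M (\<lambda>_. borel) X {..<n}; prob_space.indep_vars N (\<lambda>_. borel) X' {..<n};
     \<And>i. i < n \<Longrightarrow> integrable M (\<lambda>\<omega>. norm (X i \<omega>) ^ 2); \<And>i. i < n \<Longrightarrow> integrable N (\<lambda>\<omega>. norm (X' i \<omega>) ^ 2);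
     \<And>i a. i < n \<Longrightarrow> a \<in> Basis \<Longrightarrow> (\<integral>\<omega>. X i \<omega> \<bullet> a \<partial>M) = (\<integral>\<omega>. X' i \<omega> \<bullet> a \<partial>N);
     \<And>i a b. i < n \<Longrightarrow> a \<in> Basis \<Longrightarrow> b \<in> Basis \<Longrightarrow>
       (\<integral>\<omega>. (X i \<omega> \<bullet> a) * (X i \<omega> \<bullet> b) \<partial>M) = (\<integral>\<omega>. (X' i \<omega> \<bullet> a) * (X' i \<omega> \<bullet> b) \<partial>N)\<rbrakk> \<Longrightarrow>
    \<bar>(\<integral>\<omega>. H (block_sum \<beta> X n \<omega>) \<partial>M) - (\<integral>\<omega>. H (block_sum \<beta> X' n \<omega>) \<partial>N)\<bar> \<le>
      C * (\<Sum>i<n. (\<integral>\<omega>. capped (X i \<omega>) \<partial>M) +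
        (\<integral>\<omega>. capped (X' i \<omega>) \<partial>N))"
    using lindeberg[OF H] by blast
  show thesis
  proof (rule that)
    fix n :: nat assume n: "0 < n"
    let ?X = "\<lambda>i \<omega>. \<eta> i \<omega> /\<^sub>R sqrt (real n)"
    let ?X' = "brownian_steps b R n"
    have st: "0 \<le> real i / real n" "real i / real n < real (Suc i) / real n" "real (Suc i) / real n \<le> 1"
      and len: "real (Suc i) / real n - real i / real n = 1 / real n" if "i < n" for i
      using that n by (auto simp: field_simps)
    note bmom = brownian_image_increment_moments[OF bm st K]
    have e1: "(\<integral>\<omega>. capped (?X i \<omega>) \<partial>M) =
        (\<integral>\<omega>. capped_at n (\<eta> 0 \<omega>) \<partial>M) / real n" for i
      unfolding min_power_scaled[OF n]
      using eta_integral(1)[of "\<lambda>v. capped_at n v" i] by simp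
    have e2: "(\<integral>\<omega>. capped (?X' i \<omega>) \<partial>N) \<le> K2 * (1 / sqrt (real n)) / real n" if i: "i < n" for i
    proof -
      have X'm: "?X' i \<in> borel_measurable N"
        using st[OF i] by (intro measurable_matrix_image borel_measurable_diff brownian_measurable[OF bm]) auto
      have dd: "(\<lambda>\<omega>. norm (?X' i \<omega>) ^ 2) = (\<lambda>\<omega>. \<Sum>j\<in>UNIV. ?X' i \<omega> $ j * ?X' i \<omega> $ j)"
        unfolding norm_vec_square by (simp add: power2_eq_square)
      have comp: "integrable N (\<lambda>\<omega>. ?X' i \<omega> $ j * ?X' i \<omega> $ j)" for j
      proof (rule Bochner_Integration.integrable_bound[OF bmom(1)[OF i i i]])
        show "(\<lambda>\<omega>. ?X' i \<omega> $ j * ?X' i \<omega> $ j) \<in> borel_measurable N"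
        proof -
          have "(\<lambda>v :: real ^ 'm. v $ j) \<in> borel_measurable borel" by measurable
          from measurable_compose[OF X'm this] show ?thesis by simp
        qed
        have "\<bar>x $ j * x $ j\<bar> \<le> norm x ^ 2" for x :: "real ^ 'm"
          unfolding abs_mult power2_eq_square by (intro mult_mono component_le_norm_cart) auto
        then show "AE \<omega> in N. norm (?X' i \<omega> $ j * ?X' i \<omega> $ j) \<le> norm (norm (?X' i \<omega>) ^ 2)"
          by (simp only: real_norm_def abs_of_nonneg[OF zero_le_power2]) (rule AE_I2, simp)
      qed
      have s2: "(\<integral>\<omega>. norm (?X' i \<omega>) ^ 2 \<partial>N) = (\<Sum>j\<in>UNIV. S $ j $ j) / real n"
        unfolding dd using comp bmom(3)[OF i i i] len[OF i]
        by (simp add: Bochner_Integration.integral_sum R sum_divide_distrib)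
      \<comment> \<open>With this weight both terms of \<open>min_power_le\<close> have expectation
        of order \<open>1 / (n * sqrt n)\<close>, the second and fourth moments being of order
        \<open>1 / n\<close> and \<open>1 / n^2\<close>.\<close>
      let ?d = "1 / sqrt (real n)"
      have d: "0 < ?d" "inverse ?d = sqrt (real n)" using n by (auto simp: inverse_eq_divide)
      have "(\<integral>\<omega>. capped (?X' i \<omega>) \<partial>N) \<le>
          (\<integral>\<omega>. (?d * norm (?X' i \<omega>) ^ 2 + norm (?X' i \<omega>) ^ 4 / ?d) / 2 \<partial>N)"
      proof (rule integral_mono)
        show "integrable N (\<lambda>\<omega>. capped (?X' i \<omega>))"
          by (rule N.integrable_inner_of_square(3)[OF X'm bmom(1)[OF i i i]])
      qed (use bmom(1,4)[OF i i i] min_power_le[OF d(1)] in auto)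
      also have "\<dots> = (?d * (\<integral>\<omega>. norm (?X' i \<omega>) ^ 2 \<partial>N) + (\<integral>\<omega>. norm (?X' i \<omega>) ^ 4 \<partial>N) * sqrt (real n)) / 2"
        using bmom(1,4)[OF i i i] by simp
      also have "\<dots> \<le> (?d * ((\<Sum>j\<in>UNIV. \<bar>S $ j $ j\<bar>) / real n) + (K ^ 4 * (3 * real CARD('m) ^ 2) * (1 / real n)\<^sup>2) * sqrt (real n)) / 2"
        using bmom(5)[OF i i i] len[OF i] d(1) unfolding s2
        by (intro divide_right_mono add_mono mult_left_mono mult_right_mono divide_right_mono sum_mono) auto
      also have "(1 / real n)\<^sup>2 * sqrt (real n) = ?d / real n"
        using n by (simp add: power2_eq_square field_simps)
      then have "(?d * ((\<Sum>j\<in>UNIV. \<bar>S $ j $ j\<bar>) / real n) + (K ^ 4 * (3 * real CARD('m) ^ 2) * (1 / real n)\<^sup>2) * sqrt (real n)) / 2 = (K2 * ?d / real n) / 2"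
        unfolding mult.assoc K2_def by (simp add: algebra_simps add_divide_distrib)
      also have "\<dots> \<le> K2 * ?d / real n"
      proof -
        have "0 \<le> K2 * ?d / real n" using K2 by simp
        moreover have "x / 2 \<le> x" if "0 \<le> x" for x :: real using that by simp
        ultimately show ?thesis by blast
      qed
      finally show ?thesis .
    qed
    have "\<bar>(\<integral>\<omega>. H (block_sum (block_index n k) ?X n \<omega>) \<partial>M) - (\<integral>\<omega>. H (block_sum (block_index n k) ?X' n \<omega>) \<partial>N)\<bar> \<le>
      C * (\<Sum>i<n. (\<integral>\<omega>. capped (?X i \<omega>) \<partial>M) +
        (\<integral>\<omega>. capped (?X' i \<omega>) \<partial>N))"
    proof (rule C[OF M N.prob_space_axioms])
      show "M.indep_vars (\<lambda>_. borel) ?X {..<n}"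
        by (rule M.indep_vars_compose2[OF M.indep_vars_subset[OF ind]]) auto
      show "N.indep_vars (\<lambda>_. borel) ?X' {..<n}" by (rule brownian_image_increments_indep[OF bm n])
      fix i assume i: "i < n"
      show "integrable M (\<lambda>\<omega>. norm (?X i \<omega>) ^ 2)"
        using eta_integral(2)[of "\<lambda>v. norm v ^ 2" i] sq by (simp add: power_mult_distrib)
      show "integrable N (\<lambda>\<omega>. norm (?X' i \<omega>) ^ 2)" using bmom(1)[OF i i i] .
      fix a :: "real ^ 'm" assume "a \<in> Basis"
      then obtain j where j: "a = axis j 1" by (auto simp: Basis_vec_real)
      show "(\<integral>\<omega>. ?X i \<omega> \<bullet> a \<partial>M) = (\<integral>\<omega>. ?X' i \<omega> \<bullet> a \<partial>N)"
        using eta_integral(1)[of "\<lambda>v. v $ j" i] mean[of j] bmom(2)[OF i i i, of j] by (simp add: j inner_axis)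
      fix a' :: "real ^ 'm" assume "a' \<in> Basis"
      then obtain l where l: "a' = axis l 1" by (auto simp: Basis_vec_real)
      have "(\<integral>\<omega>. (?X i \<omega> \<bullet> a) * (?X i \<omega> \<bullet> a') \<partial>M) = (\<integral>\<omega>. (\<eta> i \<omega> $ j * \<eta> i \<omega> $ l) / real n \<partial>M)"
        using n by (intro Bochner_Integration.integral_cong) (auto simp: j l inner_axis field_simps)
      also have "\<dots> = S $ j $ l / real n"
        using eta_integral(1)[of "\<lambda>v. v $ j * v $ l" i] cov[of j l] by simp
      finally show "(\<integral>\<omega>. (?X i \<omega> \<bullet> a) * (?X i \<omega> \<bullet> a') \<partial>M) = (\<integral>\<omega>. (?X' i \<omega> \<bullet> a) * (?X' i \<omega> \<bullet> a') \<partial>N)"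
        using bmom(3)[OF i i i, of j l] len[OF i] by (simp add: j l inner_axis R)
    qed
    \<comment> \<open>The sign of \<open>C\<close> is unknown, and the estimates of the sum that
      follow call for a nonnegative factor.\<close>
    also have "\<dots> \<le> \<bar>C\<bar> * (\<Sum>i<n. (\<integral>\<omega>. capped (?X i \<omega>) \<partial>M) +
        (\<integral>\<omega>. capped (?X' i \<omega>) \<partial>N))"
      by (intro mult_right_mono sum_nonneg add_nonneg_nonneg Bochner_Integration.integral_nonneg) auto
    also have "\<dots> \<le> \<bar>C\<bar> * (\<Sum>i<n. ((\<integral>\<omega>. capped_at n (\<eta> 0 \<omega>) \<partial>M) + K2 * (1 / sqrt (real n))) / real n)"
      using e2 unfolding e1 add_divide_distrib by (intro mult_left_mono sum_mono add_left_mono) auto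
    also have "\<dots> = \<bar>C\<bar> * ((\<integral>\<omega>. capped_at n (\<eta> 0 \<omega>) \<partial>M) + K2 * (1 / sqrt (real n)))"
      using n by simp
    also have "\<dots> \<le> \<bar>C\<bar> * ((1 + K2) * (\<integral>\<omega>. capped_at n (\<eta> 0 \<omega>) \<partial>M) + (1 + K2) * (1 / sqrt (real n)))"
    proof (intro mult_left_mono add_mono)
      have "0 \<le> (\<integral>\<omega>. capped_at n (\<eta> 0 \<omega>) \<partial>M)"
        by (rule Bochner_Integration.integral_nonneg) auto
      then show "(\<integral>\<omega>. capped_at n (\<eta> 0 \<omega>) \<partial>M) \<le>
        (1 + K2) * (\<integral>\<omega>. capped_at n (\<eta> 0 \<omega>) \<partial>M)"
        using K2 by (simp add: distrib_right)
      show "K2 * (1 / sqrt (real n)) \<le> (1 + K2) * (1 / sqrt (real n))" by (rule mult_right_mono) auto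
    qed simp
    finally have *: "\<bar>(\<integral>\<omega>. H (block_sum (block_index n k) ?X n \<omega>) \<partial>M) - (\<integral>\<omega>. H (block_sum (block_index n k) ?X' n \<omega>) \<partial>N)\<bar> \<le>
      \<bar>C\<bar> * ((1 + K2) * (\<integral>\<omega>. capped_at n (\<eta> 0 \<omega>) \<partial>M) + (1 + K2) * (1 / sqrt (real n)))" .
    show "\<bar>(\<integral>\<omega>. H (block_increments \<eta> k n \<omega>) \<partial>M) - (\<integral>\<omega>. H (block_sum (block_index n k) ?X' n \<omega>) \<partial>N)\<bar> \<le>
      (\<bar>C\<bar> * (1 + K2)) * ((\<integral>\<omega>. capped_at n (\<eta> 0 \<omega>) \<partial>M) + 1 / sqrt (real n))"
    proof -
      have "\<bar>C\<bar> * ((1 + K2) * A + (1 + K2) * A') = (\<bar>C\<bar> * (1 + K2)) * (A + A')" for A A'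
        by (simp add: algebra_simps)
      then show ?thesis using * unfolding block_increments_def by (simp only:)
    qed
  qed
qed

text \<open>Telescoping inside a block, with the matrix pulled out by linearity.\<close>

lemma brownian_grid_increments:
  assumes "0 < n" "0 < k"
  shows "block_sum (block_index n k) (brownian_steps b R n) n \<omega> j =
    (if j < k then R *v (b (real (grid n k (Suc j)) / real n) \<omega> - b (real (grid n k j) / real n) \<omega>) else 0)"
proof -
  have "(\<Sum>i=l..<u. R *v (b (real (Suc i) / real n) \<omega> - b (real i / real n) \<omega>)) =
    R *v (b (real u / real n) \<omega> - b (real l / real n) \<omega>)" if "l \<le> u" for l u
    using sum_Suc_diff'[OF that, of "\<lambda>i. b (real i / real n) \<omega>"]
    by (simp flip: linear_sum[OF matrix_vector_mul_linear])
  then show ?thesis by (simp add: block_sum_block_index[OF assms] grid_mono)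
qed

lemma brownian_grid_increments_tendsto:
  assumes k: "0 < k" and \<omega>: "\<omega> \<in> space N"
  shows "(\<lambda>n. block_sum (block_index n k) (brownian_steps b R n) n \<omega>)
    \<longlonglongrightarrow> brownian_increments b R k \<omega>"
proof (rule tendsto_product_topology)
  fix j
  have b: "(\<lambda>n. b (real (grid n k i) / real n) \<omega>) \<longlonglongrightarrow> b (real i / real k) \<omega>" if "i \<le> k" for i
  proof (rule continuous_on_tendsto_compose[OF brownian_continuous[OF bm \<omega>] grid_tendsto[OF k]])
    show "real i / real k \<in> {0..1}" using that k by auto
    show "eventually (\<lambda>n. real (grid n k i) / real n \<in> {0..1}) sequentially"
      using grid_le[OF k that] by (intro eventually_sequentiallyI[of 1]) (auto simp: divide_le_eq)
  qed
  have "(\<lambda>n. if j < k then R *v (b (real (grid n k (Suc j)) / real n) \<omega> - b (real (grid n k j) / real n) \<omega>) else 0)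
      \<longlonglongrightarrow> brownian_increments b R k \<omega> j"
  proof (cases "j < k")
    case True
    have "(\<lambda>n. R *v (b (real (grid n k (Suc j)) / real n) \<omega> - b (real (grid n k j) / real n) \<omega>))
      \<longlonglongrightarrow> R *v (b (real (Suc j) / real k) \<omega> - b (real j / real k) \<omega>)"
      by (rule bounded_linear.tendsto[OF matrix_vector_mul_bounded_linear])
        (rule tendsto_diff; rule b; use True in simp)
    then show ?thesis using True by (simp add: brownian_increments_def)
  qed (simp add: brownian_increments_def)
  moreover have "eventually (\<lambda>n. (if j < k then R *v (b (real (grid n k (Suc j)) / real n) \<omega> - b (real (grid n k j) / real n) \<omega>) else 0) =
      block_sum (block_index n k) (brownian_steps b R n) n \<omega> j) sequentially"
    using brownian_grid_increments[OF _ k] by (intro eventually_sequentiallyI[of 1]) simp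
  ultimately show "(\<lambda>n. block_sum (block_index n k) (brownian_steps b R n) n \<omega> j)
    \<longlonglongrightarrow> brownian_increments b R k \<omega> j"
    by (rule Lim_transform_eventually)
qed

text \<open>For a test function the limit splits in two. The walk and the replaced sums differ by
  the vanishing Lindeberg error; the replaced sums converge for each sample point of
  \<open>N\<close>, because the grid times tend to \<open>j / k\<close> and the paths are
  continuous.\<close>

lemma block_increments_weak_convergence:
  fixes g :: "(nat \<Rightarrow> real ^ 'm) \<Rightarrow> real"
  assumes k: "0 < k" and g: "continuous_on UNIV g" "\<And>x. \<bar>g x\<bar> \<le> B"
  shows "(\<lambda>n. \<integral>\<omega>. g (block_increments \<eta> k n \<omega>) \<partial>M) \<longlonglongrightarrow> (\<integral>\<omega>. g (brownian_increments b R k \<omega>) \<partial>N)"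
proof (rule weak_convergence_of_test_functions[OF M N.prob_space_axioms measurable_block_increments measurable_brownian_increments[OF bm] _ _ _ g])
  show "block_increments \<eta> k n \<omega> j = 0" if "k \<le> j" for n \<omega> j
  proof (cases "n = 0")
    case True
    then show ?thesis by (simp add: block_increments_def block_sum_def)
  next
    case False
    then show ?thesis using k that by (simp add: block_increments_def block_sum_block_index)
  qed
  show "brownian_increments b R k \<omega> j = 0" if "k \<le> j" for \<omega> j using that by (simp add: brownian_increments_def)
  fix H :: "(nat \<Rightarrow> real ^ 'm) \<Rightarrow> real" assume H: "test_function H"
  let ?Z = "\<lambda>n. block_sum (block_index n k) (brownian_steps b R n) n"
  obtain B where B: "\<And>x. \<bar>H x\<bar> \<le> B" using H unfolding test_function_def by blast
  have Hm: "H \<in> borel_measurable borel" by (rule borel_measurable_continuous_onI[OF test_functionD[OF H]])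
  have Zm: "?Z n \<in> borel_measurable N" for n
    by (intro measurable_block_sum measurable_matrix_image borel_measurable_diff brownian_measurable[OF bm]) (auto simp: divide_le_eq)
  have Z: "(\<lambda>n. \<integral>\<omega>. H (?Z n \<omega>) \<partial>N) \<longlonglongrightarrow> (\<integral>\<omega>. H (brownian_increments b R k \<omega>) \<partial>N)"
  proof (rule integral_dominated_convergence[where w="\<lambda>_. B"])
    show "AE \<omega> in N. (\<lambda>n. H (?Z n \<omega>)) \<longlonglongrightarrow> H (brownian_increments b R k \<omega>)"
      using continuous_on_tendsto_compose[OF test_functionD[OF H] brownian_grid_increments_tendsto[OF k]] by auto
    show "(\<lambda>\<omega>. H (brownian_increments b R k \<omega>)) \<in> borel_measurable N" "(\<lambda>\<omega>. H (?Z n \<omega>)) \<in> borel_measurable N" for n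
      by (rule measurable_compose[OF measurable_brownian_increments[OF bm] Hm], rule measurable_compose[OF Zm Hm])
  qed (use B in auto)
  obtain C where C: "\<And>n. 0 < n \<Longrightarrow> \<bar>(\<integral>\<omega>. H (block_increments \<eta> k n \<omega>) \<partial>M) - (\<integral>\<omega>. H (?Z n \<omega>) \<partial>N)\<bar> \<le>
    C * ((\<integral>\<omega>. capped_at n (\<eta> 0 \<omega>) \<partial>M) + 1 / sqrt (real n))"
    using block_increments_lindeberg[OF H, of k] by blast
  have "(\<lambda>n. 1 / sqrt (real n)) \<longlonglongrightarrow> 0"
    by (intro tendsto_divide_0[OF tendsto_const] filterlim_at_top_imp_at_infinity
        filterlim_compose[OF sqrt_at_top filterlim_real_sequentially])
  from tendsto_mult[OF tendsto_const[of C] tendsto_add[OF lindeberg_error_tendsto_0 this]]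
  have "(\<lambda>n. C * ((\<integral>\<omega>. capped_at n (\<eta> 0 \<omega>) \<partial>M) + 1 / sqrt (real n))) \<longlonglongrightarrow> 0"
    by simp
  then have "(\<lambda>n. (\<integral>\<omega>. H (block_increments \<eta> k n \<omega>) \<partial>M) - (\<integral>\<omega>. H (?Z n \<omega>) \<partial>N)) \<longlonglongrightarrow> 0"
    by (rule Lim_null_comparison[rotated]) (use C in \<open>auto intro!: eventually_sequentiallyI[of 1]\<close>)
  from tendsto_add[OF this Z] show "(\<lambda>n. \<integral>\<omega>. H (block_increments \<eta> k n \<omega>) \<partial>M) \<longlonglongrightarrow> (\<integral>\<omega>. H (brownian_increments b R k \<omega>) \<partial>N)"
    by simp
qed

end

section \<open>Hulls of block paths\<close>

lemma vec_cons_simps: "vec_cons a v $ None = a" "vec_cons a v $ Some j = v $ j"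
  by (simp_all add: vec_cons_def)

lemma vec_option_eq_iff: "x = y \<longleftrightarrow> x $ None = y $ None \<and> (\<forall>j. x $ Some j = y $ Some j)"
  by (metis option.exhaust vec_eq_iff)

lemma vec_cons_linear: "linear (\<lambda>p. vec_cons (fst p) (snd p))"
  by (rule linearI) (simp_all add: vec_option_eq_iff vec_cons_simps)

lemma vec_cons_0 [simp]: "vec_cons 0 0 = 0"
  by (simp add: vec_option_eq_iff vec_cons_simps)

lemma vec_cons_diff: "vec_cons a v - vec_cons a' v' = vec_cons (a - a') (v - v')"
  by (simp add: vec_option_eq_iff vec_cons_simps)

lemma norm_vec_cons_le: "norm (vec_cons a (v :: real ^ 'm)) \<le> \<bar>a\<bar> + norm v"
proof -
  have "norm (vec_cons a v) = sqrt (a\<^sup>2 + (norm v)\<^sup>2)"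
    by (simp add: norm_vec_def L2_set_def UNIV_option_conv sum.reindex vec_cons_simps sum_nonneg)
  also have "\<dots> \<le> \<bar>a\<bar> + norm v"
    using sqrt_add_le_add_sqrt[of "a\<^sup>2" "(norm v)\<^sup>2"] by simp
  finally show ?thesis .
qed

lemma continuous_on_vec_cons:
  assumes "continuous_on S f" "continuous_on S g"
  shows "continuous_on S (\<lambda>x. vec_cons (f x) (g x :: real ^ 'm))"
proof -
  have "continuous_on S (\<lambda>x. vec_cons (fst (f x, g x)) (snd (f x, g x)))"
    by (rule continuous_on_compose2[OF linear_continuous_on[OF vec_cons_linear[THEN linear_conv_bounded_linear[THEN iffD1]]] continuous_on_Pair[OF assms]])
      (rule subset_UNIV)
  then show ?thesis by simp
qed

lemma block_diag1_vec_cons: "block_diag1 A *v vec_cons a v = vec_cons a (A *v v)"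
  by (simp add: vec_option_eq_iff vec_cons_simps matrix_vector_mult_def block_diag1_def UNIV_option_conv sum.reindex)

lemma scaling_linear: "linear (scaling u \<mu> n)"
  unfolding scaling_def
  by (rule linearI) (simp_all add: vec_option_eq_iff vec_cons_simps inner_add_left add_divide_distrib)

lemma hausdorff_dist_hull_image_le:
  fixes p q :: "nat \<Rightarrow> 'd::euclidean_space"
  assumes "\<And>j. j \<le> k \<Longrightarrow> norm (p j - q j) \<le> r"
  shows "hausdorff_dist (convex hull (p ` {0..k})) (convex hull (q ` {0..k})) \<le> r"
proof (rule hausdorff_dist_convex_hull_le)
  show "\<exists>y\<in>q ` {0..k}. norm (x - y) \<le> r" if "x \<in> p ` {0..k}" for x
    using that assms by fastforce
  show "\<exists>x\<in>p ` {0..k}. norm (x - y) \<le> r" if "y \<in> q ` {0..k}" for y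
    using that assms by fastforce
qed (auto intro!: finite_imp_compact)

lemma hull_image_in_convex_compacts0:
  fixes p :: "nat \<Rightarrow> 'd::euclidean_space"
  shows "p 0 = 0 \<Longrightarrow> convex hull (p ` {0..k}) \<in> convex_compacts0"
  by (intro convex_hull_in_convex_compacts0) (auto intro!: finite_imp_compact image_eqI[of _ _ 0])

lemma hull_map_continuous:
  fixes V :: "nat \<Rightarrow> 'e::topological_space \<Rightarrow> 'd::euclidean_space"
  assumes "\<And>j. j \<le> k \<Longrightarrow> continuous_on UNIV (V j)" "0 < e"
  shows "eventually (\<lambda>y. hausdorff_dist (convex hull ((\<lambda>j. V j x) ` {0..k})) (convex hull ((\<lambda>j. V j y) ` {0..k})) < e) (nhds x)"
proof -
  have "eventually (\<lambda>y. dist (V j y) (V j x) < e / 2) (nhds x)" if "j \<le> k" for j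
  proof -
    have "(V j \<longlongrightarrow> V j x) (nhds x)"
      by (rule continuous_on_tendsto_compose[OF assms(1)[OF that] filterlim_ident]) auto
    then show ?thesis by (rule tendstoD) (use assms(2) in simp)
  qed
  then have "eventually (\<lambda>y. \<forall>j\<in>{0..k}. dist (V j y) (V j x) < e / 2) (nhds x)"
    by (intro eventually_ball_finite) auto
  then show ?thesis
  proof eventually_elim
    case (elim y)
    have "hausdorff_dist (convex hull ((\<lambda>j. V j x) ` {0..k})) (convex hull ((\<lambda>j. V j y) ` {0..k})) \<le> e / 2"
      using elim by (intro hausdorff_dist_hull_image_le) (auto simp: dist_norm norm_minus_commute intro: less_imp_le)
    then show ?case using assms(2) by linarith
  qed
qed

lemma hull_map_measurable:
  fixes V :: "nat \<Rightarrow> 'e::topological_space \<Rightarrow> 'd::euclidean_space"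
  assumes "\<And>j. j \<le> k \<Longrightarrow> continuous_on UNIV (V j)" "\<And>x. V 0 x = 0"
  shows "(\<lambda>x. convex hull ((\<lambda>j. V j x) ` {0..k})) \<in> borel \<rightarrow>\<^sub>M borel_of hausdorff_topology0"
  by (rule Metric_space.measurable_borel_of_mtopologyI[OF Metric_space_convex_compacts0])
    (use assms in \<open>auto intro!: hull_image_in_convex_compacts0 hull_map_continuous\<close>)

definition block_path :: "nat \<Rightarrow> (nat \<Rightarrow> real ^ 'm) \<Rightarrow> nat \<Rightarrow> real ^ ('m::finite option)" where
  "block_path k x j = vec_cons (real j / real k) (\<Sum>l<j. x l)"

definition block_hull :: "nat \<Rightarrow> (nat \<Rightarrow> real ^ 'm) \<Rightarrow> (real ^ ('m::finite option)) set" where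
  "block_hull k x = convex hull (block_path k x ` {0..k})"

lemma block_path_0: "block_path k x 0 = 0"
  by (simp add: block_path_def)

lemma block_hull_in_convex_compacts0: "block_hull k x \<in> convex_compacts0"
  unfolding block_hull_def by (rule hull_image_in_convex_compacts0[where p="block_path k x", OF block_path_0])

lemma continuous_on_block_path: "continuous_on UNIV (\<lambda>x. block_path k x j)"
  unfolding block_path_def
  by (intro continuous_on_vec_cons continuous_on_const continuous_on_sum continuous_on_product_coordinates)

lemma block_hull_measurable: "block_hull k \<in> borel \<rightarrow>\<^sub>M borel_of hausdorff_topology0"
  unfolding block_hull_def[abs_def]
  by (rule hull_map_measurable[where V="\<lambda>j x. block_path k x j"]) (auto intro: continuous_on_block_path simp: block_path_0)

text \<open>This admits Lipschitz functions of the hull as test functions for the joint convergence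
  of the block increments.\<close>

lemma continuous_on_compose_block_hull:
  fixes F :: "(real ^ ('m::finite option)) set \<Rightarrow> real"
  assumes F: "\<And>A B. A \<in> convex_compacts0 \<Longrightarrow> B \<in> convex_compacts0 \<Longrightarrow> \<bar>F A - F B\<bar> \<le> L * hausdorff_dist A B"
  shows "continuous_on UNIV (\<lambda>x. F (block_hull k x))"
  unfolding continuous_on_eq_continuous_at[OF open_UNIV]
proof (intro ballI)
  fix x :: "nat \<Rightarrow> real ^ 'm"
  have "((\<lambda>y. F (block_hull k y)) \<longlongrightarrow> F (block_hull k x)) (nhds x)"
    unfolding tendsto_iff
  proof (intro allI impI)
    fix e :: real assume "0 < e"
    then have "eventually (\<lambda>y. hausdorff_dist (block_hull k x) (block_hull k y) < e / (\<bar>L\<bar> + 1)) (nhds x)"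
      unfolding block_hull_def
      by (intro hull_map_continuous[where V="\<lambda>j x. block_path k x j"]) (auto intro: continuous_on_block_path)
    then show "eventually (\<lambda>y. dist (F (block_hull k y)) (F (block_hull k x)) < e) (nhds x)"
    proof eventually_elim
      case (elim y)
      let ?r = "hausdorff_dist (block_hull k x) (block_hull k y)"
      have "0 \<le> ?r" by (rule Metric_space.nonneg[OF Metric_space_convex_compacts0])
      then have "L * ?r \<le> (\<bar>L\<bar> + 1) * ?r" by (intro mult_right_mono) auto
      also have "\<dots> < e" using elim by (simp add: field_simps)
      finally show ?case
        using F[OF block_hull_in_convex_compacts0 block_hull_in_convex_compacts0, of k x k y]
        by (simp add: dist_real_def abs_minus_commute)
    qed
  qed
  then show "isCont (\<lambda>y. F (block_hull k y)) x"
    unfolding isCont_def by (rule tendsto_mono[OF at_within_le_nhds])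
qed

lemma grid_bounds:
  assumes "0 < k" "k \<le> n" "grid n k j \<le> i" "i \<le> grid n k (Suc j)"
  shows "\<bar>real i / real n - real j / real k\<bar> \<le> 1 / real k"
proof -
  have n: "0 < n" using assms by simp
  have "real (j * n) / real k - 1 \<le> real i" "real i \<le> real (Suc j * n) / real k"
    using grid_real_bounds(1)[OF assms(1), of j n] grid_real_bounds(2)[OF assms(1), of n "Suc j"] assms(3,4) by linarith+
  then have 1: "(real (j * n) / real k - 1) / real n \<le> real i / real n"
    and 2: "real i / real n \<le> (real (Suc j * n) / real k) / real n"
    by (intro divide_right_mono; simp)+
  have "(real (j * n) / real k - 1) / real n = real j / real k - 1 / real n"
    "(real (Suc j * n) / real k) / real n = real j / real k + 1 / real k"
    using n by (simp_all add: diff_divide_distrib add_divide_distrib)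
  with 1 2 have "real j / real k \<le> real i / real n + 1 / real n" "real i / real n \<le> real j / real k + 1 / real k"
    by linarith+
  \<comment> \<open>Rounding down in the grid shifts a block start by less than one step;
    \<open>k \<le> n\<close> makes that at most one block length.\<close>
  moreover have "1 / real n \<le> 1 / real k" using assms n by (simp add: frac_le)
  ultimately show ?thesis by linarith
qed

text \<open>Each path point is matched with the start of its block, and each block point with the
  path at its grid index. The three error terms belong to time, to the perturbation of the first
  coordinate and to the oscillation of the others.\<close>

lemma hull_block_approximation:
  fixes a :: "nat \<Rightarrow> real" and w :: "nat \<Rightarrow> real ^ 'm"
  assumes k: "0 < k" "k \<le> n"
    and a: "\<And>i. i \<le> n \<Longrightarrow> \<bar>a i\<bar> \<le> d"
    and w: "\<And>i j. j < k \<Longrightarrow> grid n k j \<le> i \<Longrightarrow> i \<le> grid n k (Suc j) \<Longrightarrow> norm (w i - w (grid n k j)) \<le> d'"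
  shows "hausdorff_dist (convex hull ((\<lambda>i. vec_cons (real i / real n + a i) (w i)) ` {0..n}))
    (convex hull ((\<lambda>j. vec_cons (real j / real k) (w (grid n k j))) ` {0..k})) \<le> 1 / real k + d + d'"
proof -
  have n: "0 < n" using k by simp
  let ?p = "\<lambda>i. vec_cons (real i / real n + a i) (w i)" and ?q = "\<lambda>j. vec_cons (real j / real k) (w (grid n k j))"
  have close: "norm (?p i - ?q j) \<le> 1 / real k + d + d'"
    if "j < k" "grid n k j \<le> i" "i \<le> grid n k (Suc j)" for i j
  proof -
    have "i \<le> n" using grid_le[OF k(1), of "Suc j" n] that by simp
    have "norm (?p i - ?q j) \<le> \<bar>real i / real n + a i - real j / real k\<bar> + norm (w i - w (grid n k j))"
      unfolding vec_cons_diff by (rule norm_vec_cons_le)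
    then show ?thesis
      using grid_bounds[OF k that(2,3)] a[OF \<open>i \<le> n\<close>] w[OF that] by linarith
  qed
  have d': "0 \<le> d'" using w[of 0 0] k by simp
  show ?thesis
  proof (rule hausdorff_dist_convex_hull_le)
    fix x assume "x \<in> ?p ` {0..n}"
    then obtain i where i: "i \<le> n" "x = ?p i" by auto
    show "\<exists>y\<in>?q ` {0..k}. norm (x - y) \<le> 1 / real k + d + d'"
    proof (cases "i < n")
      case True
      have "block_index n k i < k" using block_index_less[OF True k(1)] .
      moreover have "grid n k (block_index n k i) \<le> i \<and> i < grid n k (Suc (block_index n k i))"
        using block_index_eq_iff[OF n k(1)] by blast
      ultimately show ?thesis using close[of "block_index n k i" i] i by (intro bexI[of _ "?q (block_index n k i)"]) auto
    next
      case False
      \<comment> \<open>The final index lies in none of the half-open blocks; it is matched with the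
        start of the last one, whose closed range contains it.\<close>
      then have "i = n" using i by simp
      obtain k' where k': "k = Suc k'" using k(1) gr0_implies_Suc by blast
      have "grid n k k' \<le> i" "i \<le> grid n k (Suc k')"
        using grid_le[OF k(1), of k' n] grid_k[OF k(1), of n] k' \<open>i = n\<close> by auto
      then have "norm (?p i - ?q k') \<le> 1 / real k + d + d'" using k' by (intro close) auto
      moreover have "?q k' \<in> ?q ` {0..k}" using k' by (intro imageI) simp
      ultimately show ?thesis unfolding i(2) by blast
    qed
  next
    fix y assume "y \<in> ?q ` {0..k}"
    then obtain j where j: "j \<le> k" "y = ?q j" by auto
    show "\<exists>x\<in>?p ` {0..n}. norm (x - y) \<le> 1 / real k + d + d'"
    proof (cases "j < k")
      case True
      then have "norm (?p (grid n k j) - ?q j) \<le> 1 / real k + d + d'"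
        by (intro close grid_mono) auto
      then show ?thesis using j grid_le[OF k(1) j(1)] by (intro bexI[of _ "?p (grid n k j)"]) auto
    next
      case False
      then have jk: "j = k" using j by simp
      \<comment> \<open>At the end both paths are at time \<open>1\<close> and position
        \<open>w n\<close>, and only the perturbation \<open>a n\<close> remains.\<close>
      have "?p n - ?q k = vec_cons (a n) 0" unfolding vec_cons_diff using n k grid_k[OF k(1)] by simp
      then have "norm (?p n - ?q k) \<le> d" using norm_vec_cons_le[of "a n" "0 :: real ^ 'm"] a[of n] by simp
      then have "norm (?p n - y) \<le> 1 / real k + d + d'" using d' j jk k by (simp add: add_increasing add_increasing2)
      moreover have "?p n \<in> ?p ` {0..n}" by (intro imageI) simp
      ultimately show ?thesis by blast
    qed
  qed (auto intro!: finite_imp_compact)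
qed

lemma sum_block_increments:
  assumes "0 < n" "0 < k" "j \<le> k"
  shows "(\<Sum>l<j. block_increments \<eta> k n \<omega> l) = (\<Sum>i<grid n k j. \<eta> i \<omega> /\<^sub>R sqrt (real n))"
  using assms(3)
proof (induction j)
  case (Suc j)
  have "(\<Sum>l<Suc j. block_increments \<eta> k n \<omega> l) =
      (\<Sum>i<grid n k j. \<eta> i \<omega> /\<^sub>R sqrt (real n)) + (\<Sum>i=grid n k j..<grid n k (Suc j). \<eta> i \<omega> /\<^sub>R sqrt (real n))"
    using Suc by (simp add: block_increments_def block_sum_block_index[OF assms(1,2)])
  also have "\<dots> = (\<Sum>i<grid n k (Suc j). \<eta> i \<omega> /\<^sub>R sqrt (real n))"
    using sum.atLeastLessThan_concat[of 0 "grid n k j" "grid n k (Suc j)"] grid_mono[of j "Suc j" n k]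
    by (simp add: atLeast0LessThan)
  finally show ?case .
qed simp

lemma block_path_brownian_increments:
  assumes "j \<le> k" "b 0 \<omega> = 0"
  shows "block_path k (brownian_increments b R k \<omega>) j = vec_cons (real j / real k) (R *v b (real j / real k) \<omega>)"
proof -
  have "(\<Sum>l<j. brownian_increments b R k \<omega> l) = R *v b (real j / real k) \<omega>"
    using assms(1)
  proof (induction j)
    case (Suc j)
    then show ?case by (simp add: brownian_increments_def matrix_vector_mult_diff_distrib)
  qed (simp add: assms(2))
  then show ?thesis by (simp add: block_path_def)
qed

section \<open>The Brownian hull as a limit of hulls of finitely many points\<close>

context
  fixes N :: "'b measure" and b :: "real \<Rightarrow> 'b \<Rightarrow> real ^ 'm" and Sig :: "real ^ 'm ^ 'm"
  assumes bm: "standard_brownian_motion01 N b"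
begin

lemma brownian_hull_alt:
  "brownian_hull Sig b \<omega> = convex hull ((\<lambda>t. vec_cons t (matrix_sqrt Sig *v b t \<omega>)) ` {0..1})"
  by (simp add: brownian_hull_def block_diag1_vec_cons)

lemma brownian_path_continuous:
  "\<omega> \<in> space N \<Longrightarrow> continuous_on {0..1} (\<lambda>t. vec_cons t (matrix_sqrt Sig *v b t \<omega>))"
  by (intro continuous_on_vec_cons continuous_on_id
      continuous_on_compose2[OF matrix_vector_mult_linear_continuous_on brownian_continuous[OF bm]]) auto

lemma brownian_hull_in_convex_compacts0:
  "\<omega> \<in> space N \<Longrightarrow> brownian_hull Sig b \<omega> \<in> convex_compacts0"
  unfolding brownian_hull_alt
  by (intro convex_hull_in_convex_compacts0 compact_continuous_image brownian_path_continuous)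
    (auto intro!: image_eqI[of _ _ 0] simp: brownian_0[OF bm])

text \<open>The block points lie on the Brownian curve itself, so one direction is immediate. For
  the other, each time \<open>t\<close> is rounded down to the grid of width
  \<open>1 / (k + 1)\<close>, and uniform continuity of the path bounds the displacement.\<close>

lemma block_hull_tendsto_brownian_hull:
  assumes \<omega>: "\<omega> \<in> space N"
  shows "(\<lambda>k. hausdorff_dist (block_hull (Suc k) (brownian_increments b (matrix_sqrt Sig) (Suc k) \<omega>)) (brownian_hull Sig b \<omega>)) \<longlonglongrightarrow> 0"
proof (rule LIMSEQ_I)
  fix e :: real assume e: "0 < e"
  let ?g = "\<lambda>t. vec_cons t (matrix_sqrt Sig *v b t \<omega>)"
  have "uniformly_continuous_on {0..1} ?g"
    by (intro compact_uniformly_continuous brownian_path_continuous \<omega>) auto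
  then obtain d where d: "0 < d" "\<And>s t. s \<in> {0..1} \<Longrightarrow> t \<in> {0..1} \<Longrightarrow> dist s t < d \<Longrightarrow> dist (?g s) (?g t) < e / 2"
    unfolding uniformly_continuous_on_def using half_gt_zero[OF e] by blast
  obtain k0 where k0: "1 / real (Suc k0) < d" using nat_approx_posE[OF d(1)] by blast
  have "norm (hausdorff_dist (block_hull (Suc k) (brownian_increments b (matrix_sqrt Sig) (Suc k) \<omega>)) (brownian_hull Sig b \<omega>) - 0) < e"
    if "k \<ge> k0" for k
  proof -
    let ?K = "Suc k"
    have K: "1 / real ?K < d" using k0 that by (smt (verit) frac_le of_nat_0_less_iff of_nat_mono Suc_le_mono zero_less_Suc)
    have img: "block_path ?K (brownian_increments b (matrix_sqrt Sig) ?K \<omega>) ` {0..?K} = (\<lambda>j. ?g (real j / real ?K)) ` {0..?K}"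
      by (intro image_cong refl block_path_brownian_increments[where b=b, OF _ brownian_0[OF bm \<omega>]]) simp
    have j01: "real j / real ?K \<in> {0..1}" if "j \<le> ?K" for j using that by (simp add: divide_le_eq)
    have "hausdorff_dist (block_hull ?K (brownian_increments b (matrix_sqrt Sig) ?K \<omega>)) (brownian_hull Sig b \<omega>) \<le> e / 2"
      unfolding block_hull_def brownian_hull_alt img
    proof (rule hausdorff_dist_convex_hull_le)
      show "compact (?g ` {0..1})" by (intro compact_continuous_image brownian_path_continuous \<omega>) auto
      show "\<exists>y\<in>?g ` {0..1}. norm (x - y) \<le> e / 2" if "x \<in> (\<lambda>j. ?g (real j / real ?K)) ` {0..?K}" for x
        using that j01 e by (intro bexI[of _ x]) auto
      fix y assume "y \<in> ?g ` {0..1}"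
      then obtain t where t: "t \<in> {0..1}" "y = ?g t" by auto
      define j where "j = nat \<lfloor>t * real ?K\<rfloor>"
      have "real j \<le> t * real ?K" "t * real ?K < real j + 1"
        unfolding j_def using t(1) by (simp_all del: of_nat_Suc)
      then have j: "real j / real ?K \<le> t" "t < real j / real ?K + 1 / real ?K"
        by (simp_all add: field_simps del: of_nat_Suc)
      moreover have "j \<le> ?K"
      proof -
        have "t * real ?K \<le> 1 * real ?K" by (rule mult_right_mono) (use t(1) in auto)
        then have "real j \<le> 1 * real ?K" using \<open>real j \<le> t * real ?K\<close> by linarith
        then show ?thesis by (simp only: mult_1 of_nat_le_iff)
      qed
      moreover have "dist (real j / real ?K) t < d" using j K by (simp add: dist_real_def)
      ultimately have "dist (?g (real j / real ?K)) (?g t) < e / 2" using d(2)[OF j01 t(1)] by blast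
      then show "\<exists>x\<in>(\<lambda>j. ?g (real j / real ?K)) ` {0..?K}. norm (x - y) \<le> e / 2"
        using \<open>j \<le> ?K\<close> t(2) by (intro bexI[of _ "?g (real j / real ?K)"]) (auto simp: dist_norm)
    qed (auto intro!: finite_imp_compact)
    then show ?thesis
      using e Metric_space.nonneg[OF Metric_space_convex_compacts0, of "block_hull ?K (brownian_increments b (matrix_sqrt Sig) ?K \<omega>)" "brownian_hull Sig b \<omega>"]
      by simp
  qed
  then show "\<exists>no. \<forall>k\<ge>no. norm (hausdorff_dist (block_hull (Suc k) (brownian_increments b (matrix_sqrt Sig) (Suc k) \<omega>)) (brownian_hull Sig b \<omega>) - 0) < e"
    by blast
qed

text \<open>The hull is generated by uncountably many random points, so its measurability is
  obtained from the finitely generated block hulls in the limit.\<close>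

lemma brownian_hull_measurable: "brownian_hull Sig b \<in> N \<rightarrow>\<^sub>M borel_of hausdorff_topology0"
proof (rule Metric_space.measurable_borel_of_mtopology_limit[OF Metric_space_convex_compacts0])
  show "(\<lambda>\<omega>. block_hull (Suc k) (brownian_increments b (matrix_sqrt Sig) (Suc k) \<omega>)) \<in> N \<rightarrow>\<^sub>M borel_of hausdorff_topology0" for k
    by (rule measurable_compose[OF measurable_brownian_increments[OF bm] block_hull_measurable])
qed (use brownian_hull_in_convex_compacts0 block_hull_tendsto_brownian_hull in auto)

end

section \<open>Tightness and the limit theorem\<close>

text \<open>Every remainder has at most \<open>m\<close> summands, so a single application of
  Chebyshev's bound supplies the hypothesis of Ottaviani's inequality for all of them.\<close>

lemma (in prob_space) max_sum_bound:
  fixes X :: "nat \<Rightarrow> 'a \<Rightarrow> 'v::euclidean_space"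
  assumes ind: "indep_vars (\<lambda>_. borel) X UNIV"
    and X2: "\<And>i. integrable M (\<lambda>\<omega>. norm (X i \<omega>) ^ 2)"
    and X0: "\<And>i a. a \<in> Basis \<Longrightarrow> expectation (\<lambda>\<omega>. X i \<omega> \<bullet> a) = 0"
    and v: "\<And>i. expectation (\<lambda>\<omega>. norm (X i \<omega>) ^ 2) \<le> v" and l: "0 < l" and m: "real m * v / l\<^sup>2 \<le> 1 / 2"
  shows "prob {\<omega>\<in>space M. \<exists>i\<le>m. 2 * l \<le> norm (\<Sum>j=s..<s+i. X j \<omega>)} \<le>
    2 * prob {\<omega>\<in>space M. l \<le> norm (\<Sum>j=s..<s+m. X j \<omega>)}"
proof (rule ottaviani)
  show "indep_vars (\<lambda>_. borel) X {s..<s+m}" by (rule indep_vars_subset[OF ind]) simp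
  fix i assume i: "i \<le> m"
  have "0 \<le> expectation (\<lambda>\<omega>. norm (X 0 \<omega>) ^ 2)" by simp
  then have v0: "0 \<le> v" using v[of 0] by linarith
  have "prob {\<omega>\<in>space M. l \<le> norm (\<Sum>j=s+i..<s+m. X j \<omega>)} \<le> real (card {s+i..<s+m}) * v / l\<^sup>2"
    by (rule prob_norm_sum_ge[OF indep_vars_subset[OF ind]]) (use X2 X0 v l in auto)
  also have "\<dots> \<le> real m * v / l\<^sup>2" using v0 by (intro divide_right_mono mult_right_mono) auto
  finally show "prob {\<omega>\<in>space M. l \<le> norm (\<Sum>j=s+i..<s+m. X j \<omega>)} \<le> 1 / 2" using m by linarith
qed

lemma grid_block_length:
  assumes "0 < k" "k \<le> n"
  shows "real (grid n k (Suc j) - grid n k j) \<le> 2 * real n / real k"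
proof -
  have s: "real (Suc j * n) / real k = real (j * n) / real k + real n / real k" by (simp add: add_divide_distrib)
  \<comment> \<open>Rounding can make a block longer than \<open>n / k\<close> by one step, which
    \<open>k \<le> n\<close> absorbs into the factor \<open>2\<close>.\<close>
  have "1 \<le> real n / real k" using assms by simp
  moreover have "real (grid n k (Suc j) - grid n k j) = real (grid n k (Suc j)) - real (grid n k j)"
    by (rule of_nat_diff) (simp add: grid_mono)
  moreover have "2 * real n / real k = real n / real k + real n / real k" by simp
  ultimately show ?thesis
    using grid_real_bounds(2)[OF assms(1), of n "Suc j"] grid_real_bounds(1)[OF assms(1), of j n] unfolding s by linarith
qed

text \<open>\<open>\<zeta>\<close> is the centred first coordinate of a step, \<open>\<eta>\<close>
  its remaining part, and \<open>c\<close> the length of the drift, so that the drift alone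
  contributes \<open>i / n\<close>.\<close>

definition rescaled_walk ::
  "real \<Rightarrow> (nat \<Rightarrow> 'a \<Rightarrow> real) \<Rightarrow> (nat \<Rightarrow> 'a \<Rightarrow> real ^ 'm) \<Rightarrow> nat \<Rightarrow> 'a \<Rightarrow> nat \<Rightarrow> real ^ ('m::finite option)" where
  "rescaled_walk c \<zeta> \<eta> n \<omega> i =
     vec_cons (real i / real n + (\<Sum>l<i. \<zeta> l \<omega>) / (real n * c)) (\<Sum>l<i. \<eta> l \<omega> /\<^sub>R sqrt (real n))"

section \<open>The rescaled walk: measurability, fluctuations and limit\<close>

context
  fixes M :: "'a measure" and \<eta> :: "nat \<Rightarrow> 'a \<Rightarrow> real ^ 'm" and \<zeta> :: "nat \<Rightarrow> 'a \<Rightarrow> real"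
    and N :: "'b measure" and b :: "real \<Rightarrow> 'b \<Rightarrow> real ^ 'm"
    and R S :: "real ^ 'm ^ 'm" and c v v' :: real
  assumes M: "prob_space M" and ind: "prob_space.indep_vars M (\<lambda>_. borel) \<eta> UNIV"
    and id: "\<And>i. distr M borel (\<eta> i) = distr M borel (\<eta> 0)"
    and sq: "integrable M (\<lambda>\<omega>. norm (\<eta> 0 \<omega>) ^ 2)"
    and mean: "\<And>j. (\<integral>\<omega>. \<eta> 0 \<omega> $ j \<partial>M) = 0"
    and cov: "\<And>j l. (\<integral>\<omega>. \<eta> 0 \<omega> $ j * \<eta> 0 \<omega> $ l \<partial>M) = S $ j $ l"
    and bm: "standard_brownian_motion01 N b" and R: "R ** transpose R = S"
    and ind': "prob_space.indep_vars M (\<lambda>_. borel) \<zeta> UNIV"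
    and sq': "\<And>i. integrable M (\<lambda>\<omega>. norm (\<zeta> i \<omega>) ^ 2)"
    and mean': "\<And>i. (\<integral>\<omega>. \<zeta> i \<omega> \<partial>M) = 0"
    and var': "\<And>i. (\<integral>\<omega>. norm (\<zeta> i \<omega>) ^ 2 \<partial>M) \<le> v'"
    and c: "0 < c"
begin

interpretation M: prob_space M by (rule M)
interpretation N: prob_space N using bm by (simp add: standard_brownian_motion01_def)

lemma zeta_measurable: "\<zeta> i \<in> borel_measurable M"
  using ind' by (auto simp: M.indep_vars_def)

lemma eta_measurable': "\<eta> i \<in> borel_measurable M"
  using ind by (auto simp: M.indep_vars_def)

lemma rescaled_walk_hull_measurable:
  "(\<lambda>\<omega>. convex hull (rescaled_walk c \<zeta> \<eta> n \<omega> ` {0..n})) \<in> M \<rightarrow>\<^sub>M borel_of hausdorff_topology0"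
proof -
  have vc: "(\<lambda>p. vec_cons (fst p) (snd p)) \<in> borel_measurable (borel :: (real \<times> (real ^ 'm)) measure)"
    by (intro borel_measurable_continuous_onI continuous_on_vec_cons continuous_intros)
  have W: "(\<lambda>\<omega>. rescaled_walk c \<zeta> \<eta> n \<omega>) \<in> borel_measurable M"
  proof (rule measurable_coordinatewise_then_product)
    fix i
    have "(\<lambda>\<omega>. (real i / real n + (\<Sum>l<i. \<zeta> l \<omega>) / (real n * c), \<Sum>l<i. \<eta> l \<omega> /\<^sub>R sqrt (real n))) \<in> borel_measurable M"
      using zeta_measurable eta_measurable' by (intro borel_measurable_Pair) auto
    from measurable_compose[OF this vc] show "(\<lambda>\<omega>. rescaled_walk c \<zeta> \<eta> n \<omega> i) \<in> borel_measurable M"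
      by (simp add: rescaled_walk_def)
  qed
  \<comment> \<open>A general sequence need not start at the origin, so its entry \<open>0\<close>
    is overwritten by zero to keep all hulls in \<open>convex_compacts0\<close>. The rescaled walk
    starts at zero and is unaffected.\<close>
  have V: "(\<lambda>x :: nat \<Rightarrow> real ^ ('m option). convex hull ((\<lambda>j. if j = 0 then 0 else x j) ` {0..n})) \<in> borel \<rightarrow>\<^sub>M borel_of hausdorff_topology0"
  proof (rule hull_map_measurable[where V="\<lambda>j (x :: nat \<Rightarrow> real ^ ('m option)). if j = 0 then 0 else x j"])
    show "continuous_on UNIV (\<lambda>x :: nat \<Rightarrow> real ^ ('m option). if j = 0 then 0 else x j)" for j
      by (cases "j = 0") (auto intro: continuous_on_product_coordinates)
  qed simp
  have eq: "(\<lambda>j. if j = 0 then 0 else rescaled_walk c \<zeta> \<eta> n \<omega> j) = rescaled_walk c \<zeta> \<eta> n \<omega>" for \<omega>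
    by (auto simp: rescaled_walk_def)
  show ?thesis using measurable_compose[OF W V] by (simp only: eq)
qed

lemma rescaled_walk_hull_in_convex_compacts0:
  "convex hull (rescaled_walk c \<zeta> \<eta> n \<omega> ` {0..n}) \<in> convex_compacts0"
  by (rule hull_image_in_convex_compacts0) (simp add: rescaled_walk_def)

lemma drift_fluctuation_tendsto_0:
  assumes e: "0 < e"
  shows "(\<lambda>n. M.prob {\<omega>\<in>space M. \<exists>i\<le>n. 2 * (e * real n) \<le> \<bar>\<Sum>l<i. \<zeta> l \<omega>\<bar>}) \<longlonglongrightarrow> 0"
proof -
  \<comment> \<open>The variance grows like \<open>n\<close>, the squared threshold like
    \<open>n^2\<close>. From \<open>2 * v' / e^2\<close> on, their quotient is at most one half, as
    Ottaviani's inequality demands.\<close>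
  define n0 where "n0 = Suc (nat \<lceil>2 * v' / e\<^sup>2\<rceil>)"
  have "M.prob {\<omega>\<in>space M. \<exists>i\<le>n. 2 * (e * real n) \<le> \<bar>\<Sum>l<i. \<zeta> l \<omega>\<bar>} \<le> 2 * (v' / e\<^sup>2) * (1 / real n)" if n: "n0 \<le> n" for n
  proof -
    have n1: "0 < n" using n by (simp add: n0_def)
    have "2 * v' / e\<^sup>2 \<le> real (nat \<lceil>2 * v' / e\<^sup>2\<rceil>)" by (rule real_nat_ceiling_ge)
    also have "\<dots> \<le> real n" by (rule of_nat_mono, rule Suc_leD) (use n in \<open>simp only: n0_def\<close>)
    finally have "2 * (v' / e\<^sup>2) \<le> real n" by simp
    then have n2: "v' / e\<^sup>2 \<le> real n / 2" by linarith
    have "real n * v' / (e * real n)\<^sup>2 = (v' / e\<^sup>2) * (1 / real n)"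
      using n1 by (simp add: power_mult_distrib power2_eq_square)
    also have "\<dots> \<le> (real n / 2) * (1 / real n)"
      by (rule mult_right_mono[OF n2]) simp
    also have "\<dots> = 1 / 2" using n1 by simp
    finally have half: "real n * v' / (e * real n)\<^sup>2 \<le> 1 / 2" .
    have l: "0 < e * real n" using e n1 by simp
    have mean0: "M.expectation (\<lambda>\<omega>. \<zeta> i \<omega> \<bullet> a) = 0" if "a \<in> Basis" for i a
      using mean'[of i] that by simp
    have "M.prob {\<omega>\<in>space M. \<exists>i\<le>n. 2 * (e * real n) \<le> norm (\<Sum>j=0..<0+i. \<zeta> j \<omega>)} \<le>
        2 * M.prob {\<omega>\<in>space M. e * real n \<le> norm (\<Sum>j=0..<0+n. \<zeta> j \<omega>)}"
      by (rule M.max_sum_bound[OF ind' sq' mean0 var' l half])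
    also have "M.prob {\<omega>\<in>space M. e * real n \<le> norm (\<Sum>j=0..<0+n. \<zeta> j \<omega>)} \<le> real (card {0..<0+n}) * v' / (e * real n)\<^sup>2"
      by (rule M.prob_norm_sum_ge[OF M.indep_vars_subset[OF ind']]) (use sq' mean0 var' l in auto)
    also have "\<dots> = (v' / e\<^sup>2) * (1 / real n)"
      using n1 by (simp add: power_mult_distrib power2_eq_square)
    finally show ?thesis by (simp add: atLeast0LessThan)
  qed
  then show ?thesis
    by (intro Lim_null_comparison[OF _ tendsto_mult_right_zero[OF lim_1_over_n, of "2 * (v' / e\<^sup>2)"]]
        eventually_sequentiallyI[of n0]) simp
qed

text \<open>For \<open>e > 0\<close> this is a majorant of the indicator of
  \<open>e \<le> norm w\<close>. Unlike the indicator it is continuous, so its expectations pass to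
  the limit, and there the fourth moment bounds them.\<close>

definition tail_fun :: "real \<Rightarrow> real ^ 'm \<Rightarrow> real" where
  "tail_fun e w = min 1 ((norm w / e) ^ 4)"

lemma tail_fun: "0 < e \<Longrightarrow> 0 \<le> tail_fun e w" "tail_fun e w \<le> 1" "0 < e \<Longrightarrow> tail_fun e w \<le> norm w ^ 4 / e ^ 4"
  by (auto simp: tail_fun_def power_divide)

lemma continuous_on_tail_fun: "continuous_on A (tail_fun e)"
proof (cases "e = 0")
  case True
  then show ?thesis by (simp add: tail_fun_def[abs_def])
next
  case False
  then show ?thesis unfolding tail_fun_def[abs_def] by (intro continuous_intros) auto
qed

text \<open>A union bound over the blocks, with Ottaviani's inequality reducing each block to its
  total increment and Markov's inequality replacing the probability by an expectation of
  \<open>tail_fun\<close>.\<close>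

lemma block_fluctuation_bound:
  assumes k: "0 < k" "k \<le> n" and e: "0 < e"
    and k4: "4 * (\<integral>\<omega>. norm (\<eta> 0 \<omega>) ^ 2 \<partial>M) \<le> e\<^sup>2 * real k"
  shows "M.prob {\<omega>\<in>space M. \<exists>j<k. \<exists>i\<le>grid n k (Suc j) - grid n k j.
      2 * (e * sqrt (real n)) \<le> norm (\<Sum>l=grid n k j..<grid n k j + i. \<eta> l \<omega>)} \<le>
    (\<Sum>j<k. 2 * (\<integral>\<omega>. tail_fun e (block_increments \<eta> k n \<omega> j) \<partial>M))"
proof -
  have n: "0 < n" using k by simp
  let ?v = "\<integral>\<omega>. norm (\<eta> 0 \<omega>) ^ 2 \<partial>M"
  let ?m = "\<lambda>j. grid n k (Suc j) - grid n k j"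
  let ?A = "\<lambda>j. {\<omega>\<in>space M. \<exists>i\<le>?m j. 2 * (e * sqrt (real n)) \<le> norm (\<Sum>l=grid n k j..<grid n k j + i. \<eta> l \<omega>)}"
  note [measurable] = eta_measurable'
  have v0: "0 \<le> ?v" by simp
  note eta_int = eta_integral[OF M ind id sq mean cov bm R]
  have sqi: "integrable M (\<lambda>\<omega>. norm (\<eta> i \<omega>) ^ 2)" and vi: "(\<integral>\<omega>. norm (\<eta> i \<omega>) ^ 2 \<partial>M) \<le> ?v" for i
    using eta_int(1)[of "\<lambda>x. norm x ^ 2" i] eta_int(2)[of "\<lambda>x. norm x ^ 2" i] sq by simp_all
  have mean0: "M.expectation (\<lambda>\<omega>. \<eta> i \<omega> \<bullet> a) = 0" if a: "a \<in> Basis" for i a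
  proof -
    obtain j where "a = axis j 1" using a by (auto simp: Basis_vec_real)
    then show ?thesis using eta_int(1)[of "\<lambda>x. x $ j" i] mean[of j] by (simp add: inner_axis)
  qed
  have l: "0 < e * sqrt (real n)" using e n by simp
  have A: "?A j \<in> M.events" for j
    unfolding Collect_conj_eq by measurable
  have "M.prob (?A j) \<le> 2 * (\<integral>\<omega>. tail_fun e (block_increments \<eta> k n \<omega> j) \<partial>M)" if j: "j < k" for j
  proof -
    \<comment> \<open>A block has at most \<open>2 * n / k\<close> steps, and \<open>k4\<close> says
      exactly that the resulting Chebyshev quotient is at most one half.\<close>
    have "real (?m j) * ?v / (e * sqrt (real n))\<^sup>2 \<le> (2 * real n / real k) * ?v / (e * sqrt (real n))\<^sup>2"
      using grid_block_length[OF k, of j] v0 by (intro divide_right_mono mult_right_mono) auto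
    also have "\<dots> = (4 * ?v) / (e\<^sup>2 * real k) / 2" using n k e by (simp add: power_mult_distrib field_simps)
    also have "\<dots> \<le> 1 / 2" using k4 k e by (intro divide_right_mono) (auto simp: divide_le_eq)
    finally have half: "real (?m j) * ?v / (e * sqrt (real n))\<^sup>2 \<le> 1 / 2" .
    have mono: "grid n k j \<le> grid n k (Suc j)" by (rule grid_mono) simp
    have "M.prob (?A j) \<le> 2 * M.prob {\<omega>\<in>space M. e * sqrt (real n) \<le> norm (\<Sum>l=grid n k j..<grid n k j + ?m j. \<eta> l \<omega>)}"
      by (rule M.max_sum_bound[OF ind sqi mean0 vi l half])
    also have "{\<omega>\<in>space M. e * sqrt (real n) \<le> norm (\<Sum>l=grid n k j..<grid n k j + ?m j. \<eta> l \<omega>)} =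
      {\<omega>\<in>space M. 1 \<le> tail_fun e (block_increments \<eta> k n \<omega> j)}"
    proof -
      have "e * sqrt (real n) \<le> norm (\<Sum>l=grid n k j..<grid n k j + ?m j. \<eta> l \<omega>) \<longleftrightarrow>
        1 \<le> tail_fun e (block_increments \<eta> k n \<omega> j)" for \<omega>
      proof -
        have "block_increments \<eta> k n \<omega> j = (\<Sum>l=grid n k j..<grid n k j + ?m j. \<eta> l \<omega>) /\<^sub>R sqrt (real n)"
          using j mono by (simp add: block_increments_def block_sum_block_index[OF n k(1)] scaleR_sum_right)
        then have w: "norm (block_increments \<eta> k n \<omega> j) = norm (\<Sum>l=grid n k j..<grid n k j + ?m j. \<eta> l \<omega>) / sqrt (real n)"
          by (simp add: divide_inverse mult.commute)
        have "1 \<le> tail_fun e w \<longleftrightarrow> e \<le> norm w" for w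
        proof -
          have "1 \<le> tail_fun e w \<longleftrightarrow> 1 ^ 4 \<le> (norm w / e) ^ 4" by (simp add: tail_fun_def)
          also have "\<dots> \<longleftrightarrow> 1 \<le> norm w / e" by (rule power_mono_iff) (use e in auto)
          finally show ?thesis using e by simp
        qed
        then show ?thesis using n by (simp add: w pos_le_divide_eq)
      qed
      then show ?thesis by simp
    qed
    also have "M.prob {\<omega>\<in>space M. 1 \<le> tail_fun e (block_increments \<eta> k n \<omega> j)} \<le>
      (\<integral>\<omega>. tail_fun e (block_increments \<eta> k n \<omega> j) \<partial>M) / 1"
    proof (rule integral_Markov_inequality_measure)
      have [measurable]: "(\<lambda>\<omega>. block_increments \<eta> k n \<omega> j) \<in> borel_measurable M"
        using measurable_block_increments[OF M ind id sq mean cov bm R] by (rule measurable_product_then_coordinatewise)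
      show "integrable M (\<lambda>\<omega>. tail_fun e (block_increments \<eta> k n \<omega> j))"
        by (rule M.integrable_const_bound[of _ 1])
          (use tail_fun e in \<open>auto simp: tail_fun_def\<close>)
    qed (use tail_fun e in auto)
    finally show ?thesis by simp
  qed
  then have "(\<Sum>j<k. M.prob (?A j)) \<le> (\<Sum>j<k. 2 * (\<integral>\<omega>. tail_fun e (block_increments \<eta> k n \<omega> j) \<partial>M))"
    by (intro sum_mono) auto
  moreover have "M.prob (\<Union>j\<in>{..<k}. ?A j) \<le> (\<Sum>j<k. M.prob (?A j))"
    using A by (intro M.finite_measure_subadditive_finite) auto
  moreover have "(\<Union>j\<in>{..<k}. ?A j) = {\<omega>\<in>space M. \<exists>j<k. \<exists>i\<le>grid n k (Suc j) - grid n k j.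
      2 * (e * sqrt (real n)) \<le> norm (\<Sum>l=grid n k j..<grid n k j + i. \<eta> l \<omega>)}" by auto
  ultimately show ?thesis by simp
qed

text \<open>In the limit each of the \<open>k\<close> blocks contributes a Gaussian fourth moment of
  order \<open>1 / k^2\<close>, so the sum is of order \<open>1 / k\<close>.\<close>

lemma tail_fun_limit:
  assumes k: "0 < k" and e: "0 < e" and K: "\<And>x. norm (R *v x) \<le> K * norm x"
  obtains L where "(\<lambda>n. \<Sum>j<k. 2 * (\<integral>\<omega>. tail_fun e (block_increments \<eta> k n \<omega> j) \<partial>M)) \<longlonglongrightarrow> L"
    "L \<le> 2 * (K ^ 4 * (3 * real CARD('m) ^ 2) / e ^ 4) / real k"
proof -
  let ?W = "brownian_increments b R k"
  let ?L = "\<Sum>j<k. 2 * (\<integral>\<omega>. tail_fun e (?W \<omega> j) \<partial>N)"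
  have "(\<lambda>n. \<integral>\<omega>. tail_fun e (block_increments \<eta> k n \<omega> j) \<partial>M) \<longlonglongrightarrow> (\<integral>\<omega>. tail_fun e (?W \<omega> j) \<partial>N)" for j
  proof (rule block_increments_weak_convergence[OF M ind id sq mean cov bm R k, where g="\<lambda>x. tail_fun e (x j)" and B=1])
    show "continuous_on UNIV (\<lambda>x. tail_fun e (x j))"
      by (rule continuous_on_compose2[OF continuous_on_tail_fun continuous_on_product_coordinates]) auto
    show "\<bar>tail_fun e (x j)\<bar> \<le> 1" for x using tail_fun(1)[OF e, of "x j"] tail_fun(2)[of e "x j"] by simp
  qed
  then have 1: "(\<lambda>n. \<Sum>j<k. 2 * (\<integral>\<omega>. tail_fun e (block_increments \<eta> k n \<omega> j) \<partial>M)) \<longlonglongrightarrow> ?L"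
    by (intro tendsto_sum tendsto_mult tendsto_const)
  have "(\<integral>\<omega>. tail_fun e (?W \<omega> j) \<partial>N) \<le> (K ^ 4 * (3 * real CARD('m) ^ 2) / e ^ 4) * (1 / real k)\<^sup>2" if j: "j < k" for j
  proof -
    have st: "0 \<le> real j / real k" "real j / real k < real (Suc j) / real k" "real (Suc j) / real k \<le> 1"
      and len: "real (Suc j) / real k - real j / real k = 1 / real k"
      using j k by (auto simp: field_simps)
    note mom = brownian_image_increment_moments[OF bm st K]
    have W: "?W \<omega> j = R *v (b (real (Suc j) / real k) \<omega> - b (real j / real k) \<omega>)" for \<omega>
      using j by (simp only: brownian_increments_def if_True)
    have Wm [measurable]: "(\<lambda>\<omega>. ?W \<omega> j) \<in> borel_measurable N"
      using measurable_brownian_increments[OF bm] by (rule measurable_product_then_coordinatewise)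
    have "(\<integral>\<omega>. tail_fun e (?W \<omega> j) \<partial>N) \<le> (\<integral>\<omega>. norm (?W \<omega> j) ^ 4 / e ^ 4 \<partial>N)"
    proof (rule integral_mono)
      show "integrable N (\<lambda>\<omega>. tail_fun e (?W \<omega> j))"
        by (rule N.integrable_const_bound[of _ 1])
          (use tail_fun e in \<open>auto simp: tail_fun_def\<close>)
      show "integrable N (\<lambda>\<omega>. norm (?W \<omega> j) ^ 4 / e ^ 4)" unfolding W using mom(4) by simp
    qed (rule tail_fun(3)[OF e])
    also have "\<dots> = (\<integral>\<omega>. norm (?W \<omega> j) ^ 4 \<partial>N) / e ^ 4" by simp
    also have "\<dots> \<le> K ^ 4 * (3 * real CARD('m) ^ 2) * (1 / real k)\<^sup>2 / e ^ 4"
      unfolding W using mom(5) e unfolding len by (intro divide_right_mono) auto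
    finally show ?thesis by simp
  qed
  then have "?L \<le> (\<Sum>j<k. 2 * ((K ^ 4 * (3 * real CARD('m) ^ 2) / e ^ 4) * (1 / real k)\<^sup>2))"
    by (intro sum_mono mult_left_mono) auto
  also have "\<dots> = 2 * (K ^ 4 * (3 * real CARD('m) ^ 2) / e ^ 4) / real k"
    using k by (simp add: power2_eq_square)
  finally show thesis using that 1 by blast
qed

text \<open>On the good event, \<open>1 / k\<close> comes from time, one \<open>2 * e\<close> from
  the drift fluctuation and the other from the oscillation. The threshold for \<open>\<zeta>\<close>
  carries the factor \<open>c\<close> because the first coordinate is divided by
  \<open>n * c\<close>.\<close>

lemma rescaled_walk_close:
  assumes k: "0 < k" "k \<le> n"
    and z: "\<not> (\<exists>i\<le>n. 2 * ((e * c) * real n) \<le> \<bar>\<Sum>l<i. \<zeta> l \<omega>\<bar>)"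
    and y: "\<not> (\<exists>j<k. \<exists>i\<le>grid n k (Suc j) - grid n k j.
      2 * (e * sqrt (real n)) \<le> norm (\<Sum>l=grid n k j..<grid n k j + i. \<eta> l \<omega>))"
  shows "hausdorff_dist (convex hull (rescaled_walk c \<zeta> \<eta> n \<omega> ` {0..n})) (block_hull k (block_increments \<eta> k n \<omega>))
    \<le> 1 / real k + 2 * e + 2 * e"
proof -
  have n: "0 < n" using k by simp
  have eq: "block_path k (block_increments \<eta> k n \<omega>) ` {0..k} =
    (\<lambda>j. vec_cons (real j / real k) (\<Sum>l<grid n k j. \<eta> l \<omega> /\<^sub>R sqrt (real n))) ` {0..k}"
    by (intro image_cong refl) (simp add: block_path_def sum_block_increments[OF n k(1)])
  show ?thesis
    unfolding block_hull_def eq rescaled_walk_def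
  proof (rule hull_block_approximation[OF k])
    fix i assume "i \<le> n"
    then have "\<not> 2 * ((e * c) * real n) \<le> \<bar>\<Sum>l<i. \<zeta> l \<omega>\<bar>" using z by blast
    then have "\<bar>\<Sum>l<i. \<zeta> l \<omega>\<bar> \<le> 2 * ((e * c) * real n)" by linarith
    also have "2 * ((e * c) * real n) = 2 * e * (real n * c)" by simp
    finally show "\<bar>(\<Sum>l<i. \<zeta> l \<omega>) / (real n * c)\<bar> \<le> 2 * e"
      using n c by (simp add: abs_divide divide_le_eq)
  next
    fix i j assume j: "j < k" and i: "grid n k j \<le> i" "i \<le> grid n k (Suc j)"
    have "(\<Sum>l<i. f l) = (\<Sum>l<grid n k j. f l) + (\<Sum>l=grid n k j..<i. f l)" for f :: "nat \<Rightarrow> real ^ 'm"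
      using sum.atLeastLessThan_concat[of 0 "grid n k j" i f] i by (simp add: atLeast0LessThan)
    then have "(\<Sum>l<i. \<eta> l \<omega> /\<^sub>R sqrt (real n)) - (\<Sum>l<grid n k j. \<eta> l \<omega> /\<^sub>R sqrt (real n)) =
        (\<Sum>l=grid n k j..<i. \<eta> l \<omega>) /\<^sub>R sqrt (real n)"
      by (simp add: scaleR_sum_right)
    moreover have "norm (\<Sum>l=grid n k j..<i. \<eta> l \<omega>) < 2 * (e * sqrt (real n))"
    proof -
      have "i - grid n k j \<le> grid n k (Suc j) - grid n k j" using i by simp
      then have "\<not> 2 * (e * sqrt (real n)) \<le> norm (\<Sum>l=grid n k j..<grid n k j + (i - grid n k j). \<eta> l \<omega>)"
        using y j by blast
      then show ?thesis using i by simp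
    qed
    ultimately show "norm ((\<Sum>l<i. \<eta> l \<omega> /\<^sub>R sqrt (real n)) - (\<Sum>l<grid n k j. \<eta> l \<omega> /\<^sub>R sqrt (real n))) \<le> 2 * e"
      using n by (simp add: field_simps)
  qed
qed

text \<open>Off the two exceptional events the Lipschitz bound applies; on them the integrands
  differ by at most \<open>2 * B\<close>.\<close>

lemma Lipschitz_expectation_difference:
  assumes F: "\<And>A. A \<in> convex_compacts0 \<Longrightarrow> \<bar>F A\<bar> \<le> B"
    and L: "\<And>A A'. A \<in> convex_compacts0 \<Longrightarrow> A' \<in> convex_compacts0 \<Longrightarrow> \<bar>F A - F A'\<bar> \<le> L * hausdorff_dist A A'"
    and k: "0 < k" "k \<le> n" and e: "0 < e"
    and k4: "4 * (\<integral>\<omega>. norm (\<eta> 0 \<omega>) ^ 2 \<partial>M) \<le> e\<^sup>2 * real k"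
  shows "\<bar>(\<integral>\<omega>. F (convex hull (rescaled_walk c \<zeta> \<eta> n \<omega> ` {0..n})) \<partial>M) - (\<integral>\<omega>. F (block_hull k (block_increments \<eta> k n \<omega>)) \<partial>M)\<bar> \<le>
    \<bar>L\<bar> * (1 / real k + 4 * e) +
    2 * B * (M.prob {\<omega>\<in>space M. \<exists>i\<le>n. 2 * ((e * c) * real n) \<le> \<bar>\<Sum>l<i. \<zeta> l \<omega>\<bar>} +
      (\<Sum>j<k. 2 * (\<integral>\<omega>. tail_fun e (block_increments \<eta> k n \<omega> j) \<partial>M)))"
proof -
  let ?X = "\<lambda>\<omega>. convex hull (rescaled_walk c \<zeta> \<eta> n \<omega> ` {0..n})" and ?Y = "\<lambda>\<omega>. block_hull k (block_increments \<eta> k n \<omega>)"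
  define Z where "Z = {\<omega>\<in>space M. \<exists>i\<le>n. 2 * ((e * c) * real n) \<le> \<bar>\<Sum>l<i. \<zeta> l \<omega>\<bar>}"
  define T where "T = {\<omega>\<in>space M. \<exists>j<k. \<exists>i\<le>grid n k (Suc j) - grid n k j.
      2 * (e * sqrt (real n)) \<le> norm (\<Sum>l=grid n k j..<grid n k j + i. \<eta> l \<omega>)}"
  note [measurable] = eta_measurable' zeta_measurable
  have Zm [measurable]: "Z \<in> M.events" and Tm [measurable]: "T \<in> M.events" unfolding Z_def T_def by measurable
  have B: "0 \<le> B" using F[OF block_hull_in_convex_compacts0] abs_ge_zero order_trans by blast
  have Fm: "F \<in> borel_measurable (borel_of hausdorff_topology0)"
    by (rule continuous_map_measurable_borel_of
        Metric_space.continuous_map_Lipschitz_real[OF Metric_space_convex_compacts0] L)+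
  have top: "space (borel_of hausdorff_topology0 :: (real ^ ('m option)) set measure) = convex_compacts0"
    by (simp add: space_borel_of Metric_space.topspace_mtopology[OF Metric_space_convex_compacts0])
  have iX: "integrable M (\<lambda>\<omega>. F (?X \<omega>))"
    by (rule integrable_bounded_compose[OF M.finite_measure_axioms rescaled_walk_hull_measurable Fm]) (use F top in auto)
  have iY: "integrable M (\<lambda>\<omega>. F (?Y \<omega>))"
    by (rule integrable_bounded_compose[OF M.finite_measure_axioms
        measurable_compose[OF measurable_block_increments[OF M ind id sq mean cov bm R] block_hull_measurable] Fm])
      (use F top in auto)
  have iI: "integrable M (indicat_real Z)" "integrable M (indicat_real T)"
    using Zm Tm by (auto intro!: integrable_real_indicator simp: M.emeasure_eq_measure)
  have pt: "\<bar>F (?X \<omega>) - F (?Y \<omega>)\<bar> \<le> \<bar>L\<bar> * (1 / real k + 4 * e) + 2 * B * (indicator Z \<omega> + indicator T \<omega>)"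
    if \<omega>: "\<omega> \<in> space M" for \<omega>
  proof (cases "\<omega> \<in> Z \<or> \<omega> \<in> T")
    case True
    have "\<bar>F (?X \<omega>) - F (?Y \<omega>)\<bar> \<le> 2 * B * 1"
      using F[OF rescaled_walk_hull_in_convex_compacts0, of n \<omega>] F[OF block_hull_in_convex_compacts0, of k "block_increments \<eta> k n \<omega>"]
      by linarith
    also have "\<dots> \<le> 2 * B * (indicator Z \<omega> + indicator T \<omega>)"
      using True B by (intro mult_left_mono) (auto simp: indicator_def)
    finally show ?thesis using e by (simp add: add_increasing)
  next
    case False
    let ?r = "hausdorff_dist (?X \<omega>) (?Y \<omega>)"
    have "?r \<le> 1 / real k + 2 * e + 2 * e"
      by (rule rescaled_walk_close[OF k]) (use False \<omega> in \<open>auto simp: Z_def T_def\<close>)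
    then have r: "?r \<le> 1 / real k + 4 * e" by simp
    have "0 \<le> ?r" by (rule Metric_space.nonneg[OF Metric_space_convex_compacts0])
    then have "L * ?r \<le> \<bar>L\<bar> * ?r" by (intro mult_right_mono) auto
    also have "\<dots> \<le> \<bar>L\<bar> * (1 / real k + 4 * e)" using r by (intro mult_left_mono) auto
    finally have "\<bar>F (?X \<omega>) - F (?Y \<omega>)\<bar> \<le> \<bar>L\<bar> * (1 / real k + 4 * e)"
      using L[OF rescaled_walk_hull_in_convex_compacts0 block_hull_in_convex_compacts0] order_trans by blast
    then show ?thesis using False by simp
  qed
  have "\<bar>(\<integral>\<omega>. F (?X \<omega>) \<partial>M) - (\<integral>\<omega>. F (?Y \<omega>) \<partial>M)\<bar> = \<bar>\<integral>\<omega>. F (?X \<omega>) - F (?Y \<omega>) \<partial>M\<bar>" using iX iY by simp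
  also have "\<dots> \<le> (\<integral>\<omega>. \<bar>F (?X \<omega>) - F (?Y \<omega>)\<bar> \<partial>M)" by (rule integral_abs_bound)
  also have "\<dots> \<le> (\<integral>\<omega>. \<bar>L\<bar> * (1 / real k + 4 * e) + 2 * B * (indicator Z \<omega> + indicator T \<omega>) \<partial>M)"
    by (rule integral_mono) (use iX iY pt iI in auto)
  also have "\<dots> = \<bar>L\<bar> * (1 / real k + 4 * e) + 2 * B * (M.prob Z + M.prob T)"
    using iI Zm Tm by (simp add: M.prob_space)
  also have "\<dots> \<le> \<bar>L\<bar> * (1 / real k + 4 * e) + 2 * B * (M.prob Z + (\<Sum>j<k. 2 * (\<integral>\<omega>. tail_fun e (block_increments \<eta> k n \<omega> j) \<partial>M)))"
    using B block_fluctuation_bound[OF k e k4] unfolding T_def by (intro add_left_mono mult_left_mono) auto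
  finally show ?thesis unfolding Z_def .
qed

text \<open>The parameters are chosen in the order \<open>d\<close>, \<open>k\<close>,
  \<open>n\<close>: \<open>d\<close> from \<open>e\<close> and \<open>L\<close>, then
  \<open>k\<close> large in terms of \<open>d\<close>, then \<open>n\<close> large for this
  \<open>k\<close>. Six contributions of at most \<open>e / 8\<close> result. The hypothesis
  \<open>Rs\<close> is present because \<open>brownian_hull\<close> selects the symmetric root,
  whereas the context allows every \<open>R\<close> with
  \<open>R ** transpose R = S\<close>.\<close>

lemma rescaled_walk_Lipschitz_convergence:
  assumes Rs: "R = matrix_sqrt S"
    and F: "\<And>A. A \<in> convex_compacts0 \<Longrightarrow> \<bar>F A\<bar> \<le> B"
    and L: "\<And>A A'. A \<in> convex_compacts0 \<Longrightarrow> A' \<in> convex_compacts0 \<Longrightarrow> \<bar>F A - F A'\<bar> \<le> L * hausdorff_dist A A'"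
  shows "(\<lambda>n. \<integral>\<omega>. F (convex hull (rescaled_walk c \<zeta> \<eta> n \<omega> ` {0..n})) \<partial>M) \<longlonglongrightarrow> (\<integral>\<omega>. F (brownian_hull S b \<omega>) \<partial>N)"
  unfolding tendsto_iff
proof (intro allI impI)
  fix e :: real assume e: "0 < e"
  have B: "0 \<le> B" using F[OF block_hull_in_convex_compacts0] abs_ge_zero order_trans by blast
  obtain K where K: "\<And>x. norm (R *v x) \<le> K * norm x"
    using bounded_linear.bounded[OF matrix_vector_mul_bounded_linear, of R] by (auto simp: mult.commute)
  let ?Y = "\<lambda>k \<omega>. F (block_hull k (brownian_increments b R k \<omega>))"
  have cF: "continuous_map hausdorff_topology0 euclideanreal F"
    by (rule Metric_space.continuous_map_Lipschitz_real[OF Metric_space_convex_compacts0 L])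
  note Fm = continuous_map_measurable_borel_of[OF cF]
  have Ylim: "(\<lambda>k. \<integral>\<omega>. ?Y (Suc k) \<omega> \<partial>N) \<longlonglongrightarrow> (\<integral>\<omega>. F (brownian_hull S b \<omega>) \<partial>N)"
  proof (rule integral_dominated_convergence[where w="\<lambda>_. B"])
    show "(\<lambda>\<omega>. F (brownian_hull S b \<omega>)) \<in> borel_measurable N"
      by (rule measurable_compose[OF brownian_hull_measurable[OF bm] Fm])
    show "(\<lambda>\<omega>. ?Y (Suc k) \<omega>) \<in> borel_measurable N" for k
      by (rule measurable_compose[OF measurable_compose[OF measurable_brownian_increments[OF bm] block_hull_measurable] Fm])
    show "AE \<omega> in N. (\<lambda>k. ?Y (Suc k) \<omega>) \<longlonglongrightarrow> F (brownian_hull S b \<omega>)"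
    proof (rule AE_I2)
      fix \<omega> assume \<omega>: "\<omega> \<in> space N"
      let ?r = "\<lambda>k. hausdorff_dist (block_hull (Suc k) (brownian_increments b R (Suc k) \<omega>)) (brownian_hull S b \<omega>)"
      have "?r \<longlonglongrightarrow> 0" using block_hull_tendsto_brownian_hull[OF bm \<omega>, of S] unfolding Rs .
      then have "(\<lambda>k. L * ?r k) \<longlonglongrightarrow> 0" by (rule tendsto_mult_right_zero)
      then have "(\<lambda>k. ?Y (Suc k) \<omega> - F (brownian_hull S b \<omega>)) \<longlonglongrightarrow> 0"
        by (rule Lim_null_comparison[rotated])
          (use L[OF block_hull_in_convex_compacts0 brownian_hull_in_convex_compacts0[OF bm \<omega>]] in auto)
      then show "(\<lambda>k. ?Y (Suc k) \<omega>) \<longlonglongrightarrow> F (brownian_hull S b \<omega>)" by (simp add: LIM_zero_iff)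
    qed
  qed (use F block_hull_in_convex_compacts0 in auto)
  \<comment> \<open>Of the distance \<open>1 / k + 4 * d\<close> the second part must cost at most
    \<open>e / 8\<close> after multiplication by \<open>\<bar>L\<bar>\<close>; the summand
    \<open>1\<close> avoids division by zero.\<close>
  define d where "d = e / (32 * (\<bar>L\<bar> + 1))"
  have d: "0 < d" "\<bar>L\<bar> * (4 * d) \<le> e / 8"
    using e by (auto simp: d_def field_simps)
  define Q where "Q = 2 * (K ^ 4 * (3 * real CARD('m) ^ 2) / d ^ 4)"
  have over_k: "(\<lambda>k. a / real (Suc k)) \<longlonglongrightarrow> 0" for a :: real by (rule LIMSEQ_Suc[OF lim_const_over_n])
  have "eventually (\<lambda>k. \<bar>L\<bar> / real (Suc k) < e / 8) sequentially"
    "eventually (\<lambda>k. 4 * (\<integral>\<omega>. norm (\<eta> 0 \<omega>) ^ 2 \<partial>M) / real (Suc k) < d\<^sup>2) sequentially"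
    "eventually (\<lambda>k. 2 * B * Q / real (Suc k) < e / 8) sequentially"
    using order_tendstoD(2)[OF over_k] e d(1) by auto
  moreover have "eventually (\<lambda>k. dist (\<integral>\<omega>. ?Y (Suc k) \<omega> \<partial>N) (\<integral>\<omega>. F (brownian_hull S b \<omega>) \<partial>N) < e / 8) sequentially"
    by (rule tendstoD[OF Ylim]) (use e in simp)
  ultimately have "eventually (\<lambda>k. \<bar>L\<bar> / real (Suc k) < e / 8 \<and> 4 * (\<integral>\<omega>. norm (\<eta> 0 \<omega>) ^ 2 \<partial>M) / real (Suc k) < d\<^sup>2 \<and>
      2 * B * Q / real (Suc k) < e / 8 \<and> dist (\<integral>\<omega>. ?Y (Suc k) \<omega> \<partial>N) (\<integral>\<omega>. F (brownian_hull S b \<omega>) \<partial>N) < e / 8) sequentially"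
    by eventually_elim blast
  then obtain k0 where "\<bar>L\<bar> / real (Suc k0) < e / 8 \<and> 4 * (\<integral>\<omega>. norm (\<eta> 0 \<omega>) ^ 2 \<partial>M) / real (Suc k0) < d\<^sup>2 \<and>
      2 * B * Q / real (Suc k0) < e / 8 \<and> dist (\<integral>\<omega>. ?Y (Suc k0) \<omega> \<partial>N) (\<integral>\<omega>. F (brownian_hull S b \<omega>) \<partial>N) < e / 8"
    using eventually_happens'[OF sequentially_bot] by blast
  then obtain k where k: "0 < k" "\<bar>L\<bar> / real k < e / 8" "4 * (\<integral>\<omega>. norm (\<eta> 0 \<omega>) ^ 2 \<partial>M) / real k < d\<^sup>2"
      "2 * B * Q / real k < e / 8" "dist (\<integral>\<omega>. ?Y k \<omega> \<partial>N) (\<integral>\<omega>. F (brownian_hull S b \<omega>) \<partial>N) < e / 8"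
    using zero_less_Suc by blast
  have k4: "4 * (\<integral>\<omega>. norm (\<eta> 0 \<omega>) ^ 2 \<partial>M) \<le> d\<^sup>2 * real k"
    using k(1,3) by (simp add: divide_less_eq less_imp_le)
  let ?T = "\<lambda>n. \<Sum>j<k. 2 * (\<integral>\<omega>. tail_fun d (block_increments \<eta> k n \<omega> j) \<partial>M)"
  obtain l where l: "?T \<longlonglongrightarrow> l" "l \<le> Q / real k"
    using tail_fun_limit[OF k(1) d(1) K] unfolding Q_def by blast
  have "2 * B * l \<le> 2 * B * (Q / real k)" using l(2) B by (intro mult_left_mono) auto
  then have "2 * B * l < e / 8" using k(4) by simp
  then have ev1: "eventually (\<lambda>n. 2 * B * ?T n < e / 8) sequentially"
    using order_tendstoD(2)[OF tendsto_mult[OF tendsto_const l(1)]] by blast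
  let ?Z = "\<lambda>n. M.prob {\<omega>\<in>space M. \<exists>i\<le>n. 2 * ((d * c) * real n) \<le> \<bar>\<Sum>l<i. \<zeta> l \<omega>\<bar>}"
  have "?Z \<longlonglongrightarrow> 0" by (rule drift_fluctuation_tendsto_0) (use d c in simp)
  then have "(\<lambda>n. 2 * B * ?Z n) \<longlonglongrightarrow> 0" by (rule tendsto_mult_right_zero)
  then have ev2: "eventually (\<lambda>n. 2 * B * ?Z n < e / 8) sequentially"
    using e by (intro order_tendstoD(2)) auto
  have "(\<lambda>n. \<integral>\<omega>. F (block_hull k (block_increments \<eta> k n \<omega>)) \<partial>M) \<longlonglongrightarrow> (\<integral>\<omega>. ?Y k \<omega> \<partial>N)"
    by (rule block_increments_weak_convergence[OF M ind id sq mean cov bm R k(1), where g="\<lambda>x. F (block_hull k x)"])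
      (rule continuous_on_compose_block_hull[OF L] F[OF block_hull_in_convex_compacts0]; assumption)+
  then have ev3: "eventually (\<lambda>n. dist (\<integral>\<omega>. F (block_hull k (block_increments \<eta> k n \<omega>)) \<partial>M) (\<integral>\<omega>. ?Y k \<omega> \<partial>N) < e / 8) sequentially"
    by (rule tendstoD) (use e in simp)
  show "eventually (\<lambda>n. dist (\<integral>\<omega>. F (convex hull (rescaled_walk c \<zeta> \<eta> n \<omega> ` {0..n})) \<partial>M) (\<integral>\<omega>. F (brownian_hull S b \<omega>) \<partial>N) < e) sequentially"
    using ev1 ev2 ev3 eventually_ge_at_top[of k]
  proof eventually_elim
    case (elim n)
    have "\<bar>L\<bar> * (1 / real k + 4 * d) = \<bar>L\<bar> / real k + \<bar>L\<bar> * (4 * d)" by (simp add: distrib_left)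
    then have "\<bar>L\<bar> * (1 / real k + 4 * d) \<le> e / 8 + e / 8" using d(2) k(2) by linarith
    then show ?case
      using Lipschitz_expectation_difference[OF F L k(1) elim(4) d(1) k4] elim(1-3) k(5) e
      unfolding dist_real_def distrib_left[of "2 * B"] by linarith
  qed
qed

end

section \<open>Reduction of the given walk to the centred setting\<close>

lemma second_moment_matrix_properties:
  fixes X :: "'a \<Rightarrow> real ^ 'm"
  assumes M: "prob_space M" and X: "X \<in> borel_measurable M" and X2: "integrable M (\<lambda>\<omega>. norm (X \<omega>) ^ 2)"
  shows "transpose (second_moment_matrix M X) = second_moment_matrix M X"
    "nonneg_definite (second_moment_matrix M X)"
proof -
  interpret prob_space M by fact
  show "transpose (second_moment_matrix M X) = second_moment_matrix M X"
    by (simp add: second_moment_matrix_def transpose_def vec_eq_iff mult.commute)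
  have int: "integrable M (\<lambda>\<omega>. X \<omega> $ i * X \<omega> $ k)" for i k
    using integrable_inner_of_square(2)[OF X X2, of "axis i 1" "axis k 1"] by (simp add: inner_axis)
  show "nonneg_definite (second_moment_matrix M X)"
    unfolding nonneg_definite_def
  proof
    fix x :: "real ^ 'm"
    have "x \<bullet> (second_moment_matrix M X *v x) = (\<Sum>i\<in>UNIV. \<Sum>k\<in>UNIV. (x $ i * x $ k) * (\<integral>\<omega>. X \<omega> $ i * X \<omega> $ k \<partial>M))"
      by (simp add: inner_vec_def matrix_vector_mult_def second_moment_matrix_def sum_distrib_left mult_ac)
    also have "\<dots> = (\<integral>\<omega>. (\<Sum>i\<in>UNIV. \<Sum>k\<in>UNIV. (x $ i * x $ k) * (X \<omega> $ i * X \<omega> $ k)) \<partial>M)"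
      using int by (simp add: Bochner_Integration.integral_sum)
    also have "\<dots> = (\<integral>\<omega>. (x \<bullet> X \<omega>) ^ 2 \<partial>M)"
      by (simp add: inner_vec_def power2_eq_square sum_product mult_ac)
    also have "0 \<le> \<dots>" by simp
    finally show "0 \<le> x \<bullet> (second_moment_matrix M X *v x)" .
  qed
qed

lemma walk_eq_sum: "walk \<xi> i \<omega> = (\<Sum>l<i. \<xi> (Suc l) \<omega>)"
  by (simp add: walk_def sum.atLeast1_atMost_eq)

text \<open>The walk starts with \<open>\<xi> 1\<close>, while the sums of the rescaled walk start
  at index \<open>0\<close>; the shift by \<open>Suc\<close> reconciles them.\<close>

lemma scaled_walk_eq_rescaled_walk:
  fixes \<xi> :: "nat \<Rightarrow> 'a \<Rightarrow> real ^ ('m::finite option)"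
  assumes "0 < norm \<mu>"
  shows "scaling u \<mu> n (walk \<xi> i \<omega>) =
    rescaled_walk (norm \<mu>) (\<lambda>l \<omega>. \<xi> (Suc l) \<omega> \<bullet> u None - norm \<mu>) (\<lambda>l \<omega>. perp_part u (\<xi> (Suc l) \<omega>)) n \<omega> i"
proof -
  have "(\<Sum>l<i. \<xi> (Suc l) \<omega> \<bullet> u None - norm \<mu>) = walk \<xi> i \<omega> \<bullet> u None - real i * norm \<mu>"
    by (simp add: walk_eq_sum inner_sum_left sum_subtractf)
  \<comment> \<open>For \<open>n = 0\<close> both sides are zero, since division by zero gives
    zero.\<close>
  then have "real i / real n + (\<Sum>l<i. \<xi> (Suc l) \<omega> \<bullet> u None - norm \<mu>) / (real n * norm \<mu>) =
      (walk \<xi> i \<omega> \<bullet> u None) / (real n * norm \<mu>)"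
    using assms by (cases "n = 0") (simp_all add: field_simps)
  moreover have "(\<Sum>l<i. perp_part u (\<xi> (Suc l) \<omega>) /\<^sub>R sqrt (real n)) = (\<chi> j. (walk \<xi> i \<omega> \<bullet> u (Some j)) / sqrt (real n))"
    by (simp add: vec_eq_iff perp_part_def walk_eq_sum inner_sum_left sum_distrib_left divide_inverse mult.commute)
  ultimately show ?thesis by (simp only: scaling_def rescaled_walk_def)
qed

theorem lemma6p6:
  fixes M :: "'a measure"
    and \<xi> :: "nat \<Rightarrow> 'a \<Rightarrow> real ^ ('m::finite option)"
    and \<mu> :: "real ^ ('m option)"
    and u :: "'m option \<Rightarrow> real ^ ('m option)"
    and N :: "'b measure"
    and b :: "real \<Rightarrow> 'b \<Rightarrow> real ^ 'm"
  assumes "prob_space M"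
    and "prob_space.indep_vars M (\<lambda>_. borel) \<xi> UNIV"
    and "\<And>i. distr M borel (\<xi> i) = distr M borel (\<xi> 0)"
    and "integrable M (\<lambda>\<omega>. (norm (\<xi> 0 \<omega>))\<^sup>2)"
    and "(\<integral>\<omega>. \<xi> 0 \<omega> \<partial>M) = \<mu>"
    and "\<mu> \<noteq> 0"
    and "orthonormal_basis u"
    and "u None = \<mu> /\<^sub>R norm \<mu>"
    and "standard_brownian_motion01 N b"
  shows "weakly_converges hausdorff_topology0
           M (\<lambda>n \<omega>. scaling u \<mu> n ` (convex hull ((\<lambda>k. walk \<xi> k \<omega>) ` {0..n})))
           N (brownian_hull (second_moment_matrix M (\<lambda>\<omega>. perp_part u (\<xi> 0 \<omega>))) b)"
proof -
  interpret M: prob_space M by fact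
  have N: "prob_space N" using assms(9) by (simp add: standard_brownian_motion01_def)
  let ?c = "norm \<mu>"
  let ?eta = "\<lambda>l \<omega>. perp_part u (\<xi> (Suc l) \<omega>)" and ?zeta = "\<lambda>l \<omega>. \<xi> (Suc l) \<omega> \<bullet> u None - ?c"
  let ?S = "second_moment_matrix M (\<lambda>\<omega>. perp_part u (\<xi> 0 \<omega>))"
  have c: "0 < ?c" using assms(6) by simp
  have xi [measurable]: "\<xi> i \<in> borel_measurable M" for i using assms(2) by (auto simp: M.indep_vars_def)
  have perp_cont: "continuous_on UNIV (perp_part u)"
    unfolding perp_part_def[abs_def] by (intro continuous_on_vec_lambda continuous_intros)
  have perp [measurable]: "perp_part u \<in> borel_measurable borel"
    by (rule borel_measurable_continuous_onI[OF perp_cont])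
  have xi_distr: "(\<integral>\<omega>. f (\<xi> i \<omega>) \<partial>M) = (\<integral>\<omega>. f (\<xi> 0 \<omega>) \<partial>M)" "integrable M (\<lambda>\<omega>. f (\<xi> i \<omega>)) \<longleftrightarrow> integrable M (\<lambda>\<omega>. f (\<xi> 0 \<omega>))"
    if "f \<in> borel_measurable borel" for f :: "real ^ ('m option) \<Rightarrow> real" and i
    by (rule identically_distributed_integral[OF xi xi that assms(3)])+
  have int2: "integrable M (\<lambda>\<omega>. norm (\<xi> i \<omega>) ^ 2)" for i
    using xi_distr(2)[of "\<lambda>x. norm x ^ 2" i] assms(4) by simp
  have int1: "integrable M (\<lambda>\<omega>. \<xi> i \<omega> \<bullet> w)" for i w
    by (rule M.integrable_inner_of_square(1)[OF xi int2])
  have int: "integrable M (\<xi> 0)"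
  proof (rule Bochner_Integration.integrable_bound)
    show "integrable M (\<lambda>\<omega>. 1 + norm (\<xi> 0 \<omega>) ^ 2)" using int2 by simp
    show "AE \<omega> in M. norm (\<xi> 0 \<omega>) \<le> norm (1 + norm (\<xi> 0 \<omega>) ^ 2)"
      by (rule AE_I2) (use le_one_plus_square in simp)
  qed (rule xi)
  have mean: "(\<integral>\<omega>. \<xi> i \<omega> \<bullet> w \<partial>M) = \<mu> \<bullet> w" for i w
    using xi_distr(1)[of "\<lambda>x. x \<bullet> w" i] int assms(5) by simp
  have orth: "u i \<bullet> u k = (if i = k then 1 else 0)" for i k
    using assms(7) by (simp add: orthonormal_basis_def)
  \<comment> \<open>The drift points along \<open>u None\<close>. Hence the perpendicular
    coordinates of a step are centred, and their second-moment matrix is a covariance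
    matrix.\<close>
  have mu: "\<mu> = ?c *\<^sub>R u None" using assms(6,8) by simp
  have muN: "\<mu> \<bullet> u None = ?c" and muS: "\<mu> \<bullet> u (Some j) = 0" for j
    by (subst mu, simp add: orth)+
  have perp_le: "norm (perp_part u x) ^ 2 \<le> (\<Sum>j\<in>UNIV. norm (u (Some j)) ^ 2) * norm x ^ 2" for x
  proof -
    have "norm (perp_part u x) ^ 2 = (\<Sum>j\<in>UNIV. (x \<bullet> u (Some j)) ^ 2)"
      by (simp add: norm_vec_square perp_part_def)
    also have "\<dots> \<le> (\<Sum>j\<in>UNIV. norm (u (Some j)) ^ 2 * norm x ^ 2)"
    proof (rule sum_mono)
      fix j
      have "\<bar>x \<bullet> u (Some j)\<bar> ^ 2 \<le> (norm x * norm (u (Some j))) ^ 2"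
        by (intro power_mono Cauchy_Schwarz_ineq2) auto
      then show "(x \<bullet> u (Some j)) ^ 2 \<le> norm (u (Some j)) ^ 2 * norm x ^ 2" by (simp add: power_mult_distrib mult.commute)
    qed
    finally show ?thesis by (simp add: sum_distrib_right)
  qed
  have eta2: "integrable M (\<lambda>\<omega>. norm (perp_part u (\<xi> i \<omega>)) ^ 2)" for i
  proof (rule Bochner_Integration.integrable_bound)
    show "integrable M (\<lambda>\<omega>. (\<Sum>j\<in>UNIV. norm (u (Some j)) ^ 2) * norm (\<xi> i \<omega>) ^ 2)" using int2 by simp
  qed (auto intro!: AE_I2 order_trans[OF perp_le] abs_ge_self)
  note S = second_moment_matrix_properties[OF assms(1) measurable_compose[OF xi perp] eta2, of 0]
  note R = matrix_sqrt_properties[OF S]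
  have RR: "matrix_sqrt ?S ** transpose (matrix_sqrt ?S) = ?S" using R(1,3) by simp
  have eta_ind: "M.indep_vars (\<lambda>_. borel) ?eta UNIV" and zeta_ind: "M.indep_vars (\<lambda>_. borel) ?zeta UNIV"
  proof -
    \<comment> \<open>The shifted sequence inherits independence by grouping the original family
      into the disjoint singletons \<open>{Suc l}\<close>.\<close>
    have ind: "M.indep_vars (\<lambda>_. borel) (\<lambda>l. \<xi> (Suc l)) UNIV"
    proof -
      have "M.indep_vars (\<lambda>j. PiM {Suc j} (\<lambda>_. borel)) (\<lambda>j \<omega>. restrict (\<lambda>i. \<xi> i \<omega>) {Suc j}) UNIV"
        by (rule M.indep_vars_restrict[OF assms(2)]) (auto simp: disjoint_family_on_def)
      then have "M.indep_vars (\<lambda>_. borel) (\<lambda>j \<omega>. restrict (\<lambda>i. \<xi> i \<omega>) {Suc j} (Suc j)) UNIV"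
        by (rule M.indep_vars_compose2[where Y="\<lambda>j f. f (Suc j)"]) (rule measurable_component_singleton, simp)
      then show ?thesis by simp
    qed
    show "M.indep_vars (\<lambda>_. borel) ?eta UNIV" by (rule M.indep_vars_compose2[OF ind]) (rule perp)
    show "M.indep_vars (\<lambda>_. borel) ?zeta UNIV"
      by (rule M.indep_vars_compose2[OF ind, where Y="\<lambda>_ x. x \<bullet> u None - ?c"]) measurable
  qed
  have eta_id: "distr M borel (?eta i) = distr M borel (?eta 0)" for i
  proof -
    have "distr M borel (?eta i) = distr (distr M borel (\<xi> 0)) borel (perp_part u)" for i
      by (subst assms(3)[of "Suc i", symmetric], subst distr_distr) (auto simp: comp_def)
    then show ?thesis by simp
  qed
  have eta_mean: "(\<integral>\<omega>. ?eta 0 \<omega> $ j \<partial>M) = 0" for j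
    using mean[of "Suc 0" "u (Some j)"] muS by (simp add: perp_part_def)
  have eta_cov: "(\<integral>\<omega>. ?eta 0 \<omega> $ j * ?eta 0 \<omega> $ l \<partial>M) = ?S $ j $ l" for j l
    using xi_distr(1)[of "\<lambda>x. (x \<bullet> u (Some j)) * (x \<bullet> u (Some l))" "Suc 0"]
    by (simp add: second_moment_matrix_def perp_part_def)
  have zeta2: "integrable M (\<lambda>\<omega>. norm (?zeta i \<omega>) ^ 2)" for i
  proof -
    have "integrable M (\<lambda>\<omega>. (\<xi> (Suc i) \<omega> \<bullet> u None) * (\<xi> (Suc i) \<omega> \<bullet> u None) - 2 * ?c * (\<xi> (Suc i) \<omega> \<bullet> u None) + ?c\<^sup>2)"
      using M.integrable_inner_of_square(2)[OF xi int2] int1 by auto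
    then show ?thesis by (simp add: power2_diff power2_eq_square algebra_simps)
  qed
  have zeta_mean: "(\<integral>\<omega>. ?zeta i \<omega> \<partial>M) = 0" for i
    using int1 mean muN by (simp add: M.prob_space)
  have zeta_var: "(\<integral>\<omega>. norm (?zeta i \<omega>) ^ 2 \<partial>M) \<le> (\<integral>\<omega>. norm (\<xi> 0 \<omega> \<bullet> u None - ?c) ^ 2 \<partial>M)" for i
    using xi_distr(1)[of "\<lambda>x. norm (x \<bullet> u None - ?c) ^ 2" "Suc i"] by simp
  note ctx = assms(1) eta_ind eta_id eta2[of "Suc 0"] eta_mean eta_cov assms(9) RR zeta_ind zeta2 zeta_mean zeta_var c
  \<comment> \<open>The scaling is linear, so it commutes with the convex hull and acts on the
    points of the walk.\<close>
  have X: "(\<lambda>n \<omega>. scaling u \<mu> n ` (convex hull ((\<lambda>k. walk \<xi> k \<omega>) ` {0..n}))) =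
    (\<lambda>n \<omega>. convex hull (rescaled_walk ?c ?zeta ?eta n \<omega> ` {0..n}))"
    by (simp add: convex_hull_linear_image[OF scaling_linear] image_image scaled_walk_eq_rescaled_walk[OF c] fun_eq_iff)
  show ?thesis
    unfolding X
  proof (rule Metric_space.weakly_converges_LipschitzI[OF Metric_space_convex_compacts0 assms(1) N])
    show "(\<lambda>\<omega>. convex hull (rescaled_walk ?c ?zeta ?eta n \<omega> ` {0..n})) \<in> M \<rightarrow>\<^sub>M borel_of hausdorff_topology0" for n
      by (rule rescaled_walk_hull_measurable[OF ctx])
    show "brownian_hull ?S b \<in> N \<rightarrow>\<^sub>M borel_of hausdorff_topology0"
      by (rule brownian_hull_measurable[OF assms(9)])
    fix g :: "(real ^ ('m option)) set \<Rightarrow> real" and L B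
    assume "\<And>A. A \<in> convex_compacts0 \<Longrightarrow> \<bar>g A\<bar> \<le> B"
      "\<And>A A'. A \<in> convex_compacts0 \<Longrightarrow> A' \<in> convex_compacts0 \<Longrightarrow> \<bar>g A - g A'\<bar> \<le> L * hausdorff_dist A A'"
    then show "(\<lambda>n. \<integral>\<omega>. g (convex hull (rescaled_walk ?c ?zeta ?eta n \<omega> ` {0..n})) \<partial>M) \<longlonglongrightarrow> (\<integral>\<omega>. g (brownian_hull ?S b \<omega>) \<partial>N)"
      by (rule rescaled_walk_Lipschitz_convergence[OF ctx refl])
  qed
qed

end
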